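(* Let $A\in\mathcal A$ be an admissible matrix of dimensions $n$ and $p$. Then: (i) If $p$ is odd, that is, if $X_A$ is even-dimensional, then $X_A$ admits a complex structure as an LV-M manifold (i.e. $X_A$ is diffeomorphic to an LV-M manifold). (ii) If $p$ is even, that is, if $X_A$ is odd-dimensional, then $\widetilde X_A$ and $X_A\times\mathbb S^1$ admit a complex structure as an LV-M manifold (i.e. each of them is diffeomorphic to an LV-M manifold).
   Context: **Links.** Let $A=(A_1,\dots,A_n)$ be a real matrix with $n$ columns $A_i\in\mathbb R^p$, $p\ge0$. Its link is $X_A=\{z\in\mathbb C^n:\sum A_i|z_i|^2=0,\ \sum|z_i|^2=1\}$. $A$ is admissible ($A\in\mathcal A$) if $X_A\ne\emptyset$ and the system is non-degenerate at every point of $X_A$; equivalently $0\in\mathrm{Conv}(A_1,\dots,A_n)$ (Siegel condition), and $0\in\mathrm{Conv}(A_i)_{i\in I}$ implies $|I|>p$ (weak hyperbolicity condition). $X_A$ is a smooth compact manifold of dimension $2n-p-1$. $\widetilde X_A=\{[z]\in\mathbb P^{n-1}:\sum A_i|z_i|^2=0\}$ is the (smooth) quotient of $X_A$ by the diagonal action $(u,z)\mapsto u z$ of $\mathbb S^1$. **LV-M manifolds.** Let $m>0$ and $n>2m$, and let $\Lambda=(\Lambda_1,\dots,\Lambda_n)$ be vectors of $\mathbb C^m\cong\mathbb R^{2m}$ satisfying the Siegel and weak hyperbolicity conditions (with $p=2m$). Consider the holomorphic foliation $\mathcal F$ of $\mathbb P^{n-1}$ given by the action of $\mathbb C^m$ $$(T,[z])\mapsto[\exp\langle\Lambda_1,T\rangle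 z_1,\dots,\exp\langle\Lambda_n,T\rangle z_n],\qquad \langle\Lambda_i,T\rangle=\sum_j\Lambda_i^jT_j,$$ and the open set $V=\{[z]\in\mathbb P^{n-1}:0\in\mathrm{Conv}(\Lambda_i:z_i\neq0)\}$. Then $\mathcal F|_V$ is a regular foliation of dimension $m$, and $\mathcal N_\Lambda=\{[z]\in\mathbb P^{n-1}:\sum\Lambda_i|z_i|^2=0\}$ is a smooth compact submanifold contained in $V$ that meets every leaf of $\mathcal F|_V$ transversally in exactly one point. The leaf space $V/\mathcal F$, identified with $\mathcal N_\Lambda$, is thus a compact complex manifold of dimension $n-m-1$, denoted $N_\Lambda$ and called an LV-M manifold. For $m=0$ one sets by definition $N=\mathbb P^{n-1}$. *)

theory Defs
  imports "HOL-Analysis.Analysis"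
begin

section \<open>Smooth and holomorphic maps in coordinates\<close>

text \<open>
  The dimensions of the manifolds below are quantified inside formulas, so \<open>\<real>\<^sup>n\<close> and
  \<open>\<complex>\<^sup>n\<close> are modelled as the sequences vanishing from index \<open>n\<close> on.  The product topology of
  \<open>nat \<Rightarrow> 'a\<close> induces the Euclidean topology on them.
\<close>

definition coord_space :: "nat \<Rightarrow> (nat \<Rightarrow> 'a::zero) set" where
  "coord_space n = {x. \<forall>i\<ge>n. x i = 0}"

abbreviation open_in_space :: "nat \<Rightarrow> (nat \<Rightarrow> 'a::{zero,topological_space}) set \<Rightarrow> bool" where
  "open_in_space n W \<equiv> openin (top_of_set (coord_space n)) W"

text \<open>
  Real partial derivative in the direction \<open>b \<in> Basis\<close> of the \<open>i\<close>-th coordinate.  For complex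
  coordinates \<open>Basis = {1, \<i>}\<close>, so these are the derivatives in the real and imaginary parts.
\<close>

definition partial :: "nat \<Rightarrow> 'a::euclidean_space \<Rightarrow> ((nat \<Rightarrow> 'a) \<Rightarrow> 'c::real_normed_vector) \<Rightarrow> (nat \<Rightarrow> 'a) \<Rightarrow> 'c"
  where "partial i b f x = vector_derivative (\<lambda>t. f (x(i := x i + t *\<^sub>R b))) (at 0)"

primrec Ck_on ::
  "nat \<Rightarrow> nat \<Rightarrow> (nat \<Rightarrow> 'a::euclidean_space) set \<Rightarrow> ((nat \<Rightarrow> 'a) \<Rightarrow> 'c::real_normed_vector) \<Rightarrow> bool"
where
  "Ck_on 0 n W f \<longleftrightarrow> continuous_on W f"
| "Ck_on (Suc k) n W f \<longleftrightarrow> continuous_on W f \<and>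
     (\<forall>i<n. \<forall>b\<in>Basis.
        (\<forall>x\<in>W. (\<lambda>t::real. f (x(i := x i + t *\<^sub>R b))) differentiable (at 0)) \<and>
        Ck_on k n W (partial i b f))"

text \<open>
  Smoothness on an arbitrary subset \<open>S\<close> of \<open>\<real>\<^sup>n\<close> or \<open>\<complex>\<^sup>n\<close>: near every point of \<open>S\<close> there is a
  \<open>C\<^sup>\<infinity>\<close> extension to an open set.
\<close>

definition smooth_map_on ::
  "nat \<Rightarrow> (nat \<Rightarrow> 'a::euclidean_space) set \<Rightarrow> ((nat \<Rightarrow> 'a) \<Rightarrow> (nat \<Rightarrow> 'c::real_normed_vector)) \<Rightarrow> bool"
where
  "smooth_map_on n S f \<longleftrightarrow> (\<forall>x\<in>S. \<exists>W g. open_in_space n W \<and> x \<in> W \<and>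
     (\<forall>l k. Ck_on k n W (\<lambda>y. g y l)) \<and> (\<forall>y\<in>S \<inter> W. g y = f y))"

text \<open>Used for open \<open>W \<subseteq> \<complex>\<^sup>n\<close> only: continuous and holomorphic in each variable.\<close>

definition holomorphic_map_on ::
  "nat \<Rightarrow> (nat \<Rightarrow> complex) set \<Rightarrow> ((nat \<Rightarrow> complex) \<Rightarrow> (nat \<Rightarrow> complex)) \<Rightarrow> bool"
where
  "holomorphic_map_on n W f \<longleftrightarrow> (\<forall>l. continuous_on W (\<lambda>z. f z l) \<and>
     (\<forall>z\<in>W. \<forall>i<n. (\<lambda>t. f (z(i := t)) l) field_differentiable (at (z i))))"

section \<open>Manifolds\<close>

text \<open>
  A manifold is given by its points, its dimension and an atlas, with values in \<open>\<real>\<^sup>d\<close>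
  (\<open>'a = real\<close>) or \<open>\<complex>\<^sup>d\<close> (\<open>'a = complex\<close>, \<open>d\<close> being the complex dimension).
\<close>

record ('b, 'a) manifold =
  points :: "'b set"
  mdim :: nat
  charts :: "('b set \<times> ('b \<Rightarrow> nat \<Rightarrow> 'a)) set"

text \<open>
  The manifold structure on \<open>q ` E\<close>, for \<open>E \<subseteq> \<complex>\<^sup>n\<close>, that makes \<open>q\<close> a submersion: its charts are
  the injective \<open>\<phi>\<close> with open image such that \<open>\<phi> \<circ> q\<close> is regular and \<open>\<phi>\<inverse>\<close> lifts locally to a
  regular map into \<open>E\<close>.  The predicates \<open>R\<close> and \<open>R'\<close> say what regular means on subsets
  of \<open>E\<close> and of the model space.  For \<open>q = id\<close> this is the structure of a submanifold of \<open>\<complex>\<^sup>n\<close>.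
\<close>

definition quotient_manifold ::
  "((nat \<Rightarrow> complex) set \<Rightarrow> ((nat \<Rightarrow> complex) \<Rightarrow> (nat \<Rightarrow> 'a::{zero,topological_space})) \<Rightarrow> bool) \<Rightarrow>
   ((nat \<Rightarrow> 'a) set \<Rightarrow> ((nat \<Rightarrow> 'a) \<Rightarrow> (nat \<Rightarrow> complex)) \<Rightarrow> bool) \<Rightarrow>
   (nat \<Rightarrow> complex) set \<Rightarrow> ((nat \<Rightarrow> complex) \<Rightarrow> 'b) \<Rightarrow> nat \<Rightarrow> ('b, 'a) manifold"
where
  "quotient_manifold R R' E q d =
     \<lparr>points = q ` E, mdim = d,
      charts = {(U, \<phi>). U \<subseteq> q ` E \<and> openin (top_of_set E) {z\<in>E. q z \<in> U} \<and>
        inj_on \<phi> U \<and> open_in_space d (\<phi> ` U) \<and>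
        R {z\<in>E. q z \<in> U} (\<phi> \<circ> q) \<and>
        (\<forall>w\<in>\<phi> ` U. \<exists>W s. open_in_space d W \<and> w \<in> W \<and> R' W s \<and>
           (\<forall>y\<in>W. s y \<in> E \<and> q (s y) \<in> U \<and> \<phi> (q (s y)) = y))}\<rparr>"

definition smooth_quotient ::
  "nat \<Rightarrow> (nat \<Rightarrow> complex) set \<Rightarrow> ((nat \<Rightarrow> complex) \<Rightarrow> 'b) \<Rightarrow> nat \<Rightarrow> ('b, real) manifold" where
  "smooth_quotient n E q d = quotient_manifold (smooth_map_on n) (smooth_map_on d) E q d"

definition complex_quotient ::
  "nat \<Rightarrow> (nat \<Rightarrow> complex) set \<Rightarrow> ((nat \<Rightarrow> complex) \<Rightarrow> 'b) \<Rightarrow> nat \<Rightarrow> ('b, complex) manifold" where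
  "complex_quotient n E q d = quotient_manifold (holomorphic_map_on n) (holomorphic_map_on d) E q d"

text \<open>
  Smoothness in charts.  Real and complex charts may be mixed, because \<open>smooth_map_on\<close> always
  refers to real derivatives.
\<close>

definition smooth_between ::
  "('b, 'a::euclidean_space) manifold \<Rightarrow> ('c, 'e::euclidean_space) manifold \<Rightarrow> ('b \<Rightarrow> 'c) \<Rightarrow> bool"
where
  "smooth_between M N f \<longleftrightarrow> f ` points M \<subseteq> points N \<and>
     (\<forall>x\<in>points M. \<exists>(U, \<phi>)\<in>charts M. \<exists>(W, \<psi>)\<in>charts N. x \<in> U \<and> f ` U \<subseteq> W \<and>
        smooth_map_on (mdim M) (\<phi> ` U) (\<psi> \<circ> f \<circ> inv_into U \<phi>))"

definition diffeomorphic ::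
  "('b, 'a::euclidean_space) manifold \<Rightarrow> ('c, 'e::euclidean_space) manifold \<Rightarrow> bool"
where
  "diffeomorphic M N \<longleftrightarrow> (\<exists>f. bij_betw f (points M) (points N) \<and>
     smooth_between M N f \<and> smooth_between N M (inv_into (points M) f))"

section \<open>Links\<close>

text \<open>
  A matrix with \<open>n\<close> columns in \<open>\<real>\<^sup>p\<close> is a function \<open>A\<close> such that \<open>A i j\<close>, for \<open>i < n\<close> and
  \<open>j < p\<close>, is the \<open>j\<close>-th coordinate of the column \<open>A\<^sub>i\<close>; the other values are irrelevant.
\<close>

definition link_set :: "nat \<Rightarrow> nat \<Rightarrow> (nat \<Rightarrow> nat \<Rightarrow> real) \<Rightarrow> (nat \<Rightarrow> complex) set" where
  "link_set n p A = {z \<in> coord_space n.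
     (\<forall>j<p. (\<Sum>i<n. A i j * (norm (z i))\<^sup>2) = 0) \<and> (\<Sum>i<n. (norm (z i))\<^sup>2) = 1}"

text \<open>
  Surjectivity at \<open>z\<close> of the differential of the \<open>p + 1\<close> equations of the link; the
  differential of \<open>\<bar>z\<^sub>i\<bar>\<^sup>2\<close> is \<open>v \<mapsto> 2 Re (cnj z\<^sub>i v\<^sub>i)\<close>.
\<close>

definition nondegenerate_at :: "nat \<Rightarrow> nat \<Rightarrow> (nat \<Rightarrow> nat \<Rightarrow> real) \<Rightarrow> (nat \<Rightarrow> complex) \<Rightarrow> bool" where
  "nondegenerate_at n p A z \<longleftrightarrow> (\<forall>(b::nat \<Rightarrow> real) c. \<exists>v\<in>coord_space n.
     (\<forall>j<p. (\<Sum>i<n. A i j * (2 * Re (cnj (z i) * v i))) = b j) \<and>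
     (\<Sum>i<n. 2 * Re (cnj (z i) * v i)) = c)"

definition admissible :: "nat \<Rightarrow> nat \<Rightarrow> (nat \<Rightarrow> nat \<Rightarrow> real) \<Rightarrow> bool" where
  "admissible n p A \<longleftrightarrow> link_set n p A \<noteq> {} \<and> (\<forall>z\<in>link_set n p A. nondegenerate_at n p A z)"

definition proj :: "(nat \<Rightarrow> complex) \<Rightarrow> (nat \<Rightarrow> complex) set" where
  "proj z = {(\<lambda>i. c * z i) |c. c \<noteq> 0}"

definition link :: "nat \<Rightarrow> nat \<Rightarrow> (nat \<Rightarrow> nat \<Rightarrow> real) \<Rightarrow> (nat \<Rightarrow> complex, real) manifold" where
  "link n p A = smooth_quotient n (link_set n p A) id (2 * n - p - 1)"

text \<open>
  The projective link as the quotient of the link: the fibres of \<open>proj\<close> on the link are the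
  orbits of the diagonal circle action.
\<close>

definition proj_link :: "nat \<Rightarrow> nat \<Rightarrow> (nat \<Rightarrow> nat \<Rightarrow> real) \<Rightarrow> ((nat \<Rightarrow> complex) set, real) manifold" where
  "proj_link n p A = smooth_quotient n (link_set n p A) proj (2 * n - p - 2)"

lemma points_proj_link:
  "points (proj_link n p A) = proj ` {z \<in> coord_space n - {\<lambda>i. 0}. \<forall>j<p. (\<Sum>i<n. A i j * (norm (z i))\<^sup>2) = 0}"
proof -
  have "proj z \<in> proj ` link_set n p A"
    if z: "z \<in> coord_space n" "z \<noteq> (\<lambda>i. 0)" and eq: "\<forall>j<p. (\<Sum>i<n. A i j * (norm (z i))\<^sup>2) = 0" for z
  proof -
    define r where "r = sqrt (\<Sum>i<n. (norm (z i))\<^sup>2)"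
    obtain k where k: "z k \<noteq> 0" using z(2) by auto
    then have "k < n" using z(1) unfolding coord_space_def by (metis (mono_tags, lifting) mem_Collect_eq not_le)
    then have "0 < (\<Sum>i<n. (norm (z i))\<^sup>2)"
      using k by (intro sum_pos2[of _ k]) auto
    then have r: "r > 0" "r\<^sup>2 = (\<Sum>i<n. (norm (z i))\<^sup>2)" by (auto simp: r_def)
    define y where "y = (\<lambda>i. z i / of_real r)"
    have nrm: "(norm (y i))\<^sup>2 = (norm (z i))\<^sup>2 / r\<^sup>2" for i
      using r by (simp add: y_def norm_divide power_divide)
    have "y \<in> link_set n p A"
      using z eq r unfolding link_set_def
      by (auto simp: nrm sum_divide_distrib[symmetric]) (auto simp: y_def coord_space_def)
    moreover have "proj z = proj y"
    proof -
      have "(\<lambda>i. c * z i) \<in> proj y" if "c \<noteq> 0" for c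
        using r that unfolding proj_def y_def
        by (intro CollectI exI[of _ "c * of_real r"]) auto
      moreover have "(\<lambda>i. c * y i) \<in> proj z" if "c \<noteq> 0" for c
        using r that unfolding proj_def y_def
        by (intro CollectI exI[of _ "c / of_real r"]) auto
      ultimately show ?thesis unfolding proj_def by blast
    qed
    ultimately show ?thesis by blast
  qed
  moreover have "(\<lambda>i. 0) \<notin> link_set n p A" by (simp add: link_set_def)
  ultimately show ?thesis
    unfolding proj_link_def smooth_quotient_def quotient_manifold_def
    by (auto simp: link_set_def)
qed

text \<open>The product with the unit circle, inside \<open>\<complex>\<^sup>n \<times> \<complex> = \<complex>\<^sup>n\<^sup>+\<^sup>1\<close>.\<close>

definition link_times_circle :: "nat \<Rightarrow> nat \<Rightarrow> (nat \<Rightarrow> nat \<Rightarrow> real) \<Rightarrow> (nat \<Rightarrow> complex, real) manifold" where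
  "link_times_circle n p A =
     smooth_quotient (n + 1) {z(n := u) |z u. z \<in> link_set n p A \<and> norm u = 1} id (2 * n - p)"

section \<open>LV-M manifolds\<close>

text \<open>
  \<open>0 \<in> Conv (\<Lambda>\<^sub>i : i \<in> I)\<close> for finite \<open>I\<close>, with \<open>\<Lambda>\<^sub>i = (\<Lambda> i 0, \<dots>, \<Lambda> i (m - 1)) \<in> \<complex>\<^sup>m\<close>.
\<close>

definition zero_in_conv :: "nat \<Rightarrow> (nat \<Rightarrow> nat \<Rightarrow> complex) \<Rightarrow> nat set \<Rightarrow> bool" where
  "zero_in_conv m \<Lambda> I \<longleftrightarrow> (\<exists>c::nat \<Rightarrow> real. (\<forall>i\<in>I. 0 \<le> c i) \<and> sum c I = 1 \<and>
     (\<forall>j<m. (\<Sum>i\<in>I. c i *\<^sub>R \<Lambda> i j) = 0))"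

definition siegel :: "nat \<Rightarrow> nat \<Rightarrow> (nat \<Rightarrow> nat \<Rightarrow> complex) \<Rightarrow> bool" where
  "siegel n m \<Lambda> \<longleftrightarrow> zero_in_conv m \<Lambda> {..<n}"

definition weakly_hyperbolic :: "nat \<Rightarrow> nat \<Rightarrow> (nat \<Rightarrow> nat \<Rightarrow> complex) \<Rightarrow> bool" where
  "weakly_hyperbolic n m \<Lambda> \<longleftrightarrow> (\<forall>I\<subseteq>{..<n}. zero_in_conv m \<Lambda> I \<longrightarrow> card I > 2 * m)"

text \<open>
  The cone in \<open>\<complex>\<^sup>n \<setminus> {0}\<close> over the open set \<open>V \<subseteq> \<P>\<^sup>n\<^sup>-\<^sup>1\<close>; the origin is excluded because
  the convex hull of the empty family is empty.
\<close>

definition cone_V :: "nat \<Rightarrow> nat \<Rightarrow> (nat \<Rightarrow> nat \<Rightarrow> complex) \<Rightarrow> (nat \<Rightarrow> complex) set" where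
  "cone_V n m \<Lambda> = {z \<in> coord_space n. zero_in_conv m \<Lambda> {i. i < n \<and> z i \<noteq> 0}}"

text \<open>The leaf through \<open>[z]\<close>, as a set of points of \<open>\<P>\<^sup>n\<^sup>-\<^sup>1\<close>.\<close>

definition leaf :: "nat \<Rightarrow> (nat \<Rightarrow> nat \<Rightarrow> complex) \<Rightarrow> (nat \<Rightarrow> complex) \<Rightarrow> (nat \<Rightarrow> complex) set set" where
  "leaf m \<Lambda> z = {proj (\<lambda>i. exp (\<Sum>j<m. \<Lambda> i j * T j) * z i) |T. T \<in> coord_space m}"

text \<open>The leaf space \<open>V / \<F>\<close> with the complex structure transverse to the foliation.\<close>

definition LVM_manifold ::
  "nat \<Rightarrow> nat \<Rightarrow> (nat \<Rightarrow> nat \<Rightarrow> complex) \<Rightarrow> ((nat \<Rightarrow> complex) set set, complex) manifold" where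
  "LVM_manifold n m \<Lambda> = complex_quotient n (cone_V n m \<Lambda>) (leaf m \<Lambda>) (n - m - 1)"

definition projective_space :: "nat \<Rightarrow> ((nat \<Rightarrow> complex) set, complex) manifold" where
  "projective_space n = complex_quotient n (coord_space n - {\<lambda>i. 0}) proj (n - 1)"

text \<open>
  \<open>M\<close> admits a complex structure as an LV-M manifold.  The projective spaces are the
  LV-M manifolds with \<open>m = 0\<close>.
\<close>

definition admits_LVM_structure :: "('b, real) manifold \<Rightarrow> bool" where
  "admits_LVM_structure M \<longleftrightarrow>
     (\<exists>n m \<Lambda>. m > 0 \<and> n > 2 * m \<and> siegel n m \<Lambda> \<and> weakly_hyperbolic n m \<Lambda> \<and>
        diffeomorphic M (LVM_manifold n m \<Lambda>)) \<or>
     (\<exists>n>0. diffeomorphic M (projective_space n))"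

end

theory Submission
  imports Defs
begin

text \<open>
  Let first \<open>p = 2 m\<close> be even, and read the columns of \<open>A\<close> as vectors \<open>\<Lambda>\<^sub>i \<in> \<complex>\<^sup>m\<close>.  The action of
  \<open>\<complex>\<^sup>m\<close> together with the homotheties is an action of \<open>\<complex>\<^sup>m\<^sup>+\<^sup>1\<close> on \<open>\<complex>\<^sup>n\<close> whose orbits are the cones
  over the leaves.  Along an orbit, the equations of the link are the critical point equations of
  a strictly convex function of the real parts of the parameters.  On \<open>V\<close> this function is
  coercive, so it has one critical point (\<open>balanced_exists\<close>, \<open>balanced_unique\<close>): every orbit in
  \<open>V\<close> meets the link in exactly one circle.  The map \<open>[z] \<mapsto> leaf of z\<close> is therefore a bijection of
  the projective link onto the leaf space.  For \<open>m = 0\<close> the leaf space is projective space, and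
  the same argument applies.

  It remains to compare the structures.  A chart of the leaf space at the leaf of \<open>z\<^sub>0\<close> is given by
  an affine slice: among the nonzero coordinates of \<open>z\<^sub>0\<close> there are \<open>m + 1\<close> for which the vectors
  \<open>(\<Lambda>\<^sub>i, 1)\<close> form a basis of \<open>\<complex>\<^sup>m\<^sup>+\<^sup>1\<close>, and logarithms bring these coordinates to their values at
  \<open>z\<^sub>0\<close>.  Weak hyperbolicity makes the action locally free, so a small slice meets no orbit twice
  (\<open>slice_domain\<close>, \<open>slice_chart\<close>).  The critical point depends smoothly on \<open>z\<close> (\<open>Ck_on_balanced\<close>), since
  its derivative solves a positive definite linear system.  Pushing the slice along the orbits
  to the link thus gives smooth parametrisations of the projective link, and in these charts the
  bijection is the identification of \<open>\<real>\<^sup>2\<^sup>d\<close> with \<open>\<complex>\<^sup>d\<close> (\<open>diffeomorphic_complex_quotient\<close>).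

  The remaining two manifolds reduce to this.  The suspension of \<open>A\<close> has one column and one row
  more, which say that \<open>\<Sum>i<n. \<bar>z\<^sub>i\<bar>\<^sup>2 = \<bar>z\<^sub>n\<bar>\<^sup>2\<close>; it is again admissible.  Normalising \<open>z\<^sub>n\<close> identifies
  its projective link with \<open>X\<^sub>A\<close>, which settles odd \<open>p\<close>.  Its link is a rescaled \<open>X\<^sub>A \<times> S\<^sup>1\<close>, so
  for even \<open>p\<close> the product is covered by the odd case of the suspension.
\<close>

section \<open>Dual bases and positive definite systems\<close>

text \<open>
  Among the subsets of the rows whose common kernel is trivial choose a smallest one, \<open>I\<close>.
  Dropping a row of \<open>I\<close> creates a kernel vector, on which only the dropped row is nonzero;
  normalised, these vectors form the family \<open>v\<close> dual to \<open>I\<close>.  A vector is determined by its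
  pairings with the rows in \<open>I\<close>, so it equals its expansion along \<open>v\<close>.
  The lemma is applied to rows and to columns, over \<open>\<real>\<close> and over \<open>\<complex>\<close>.
\<close>

lemma dual_basis:
  fixes a :: "'i \<Rightarrow> 'j \<Rightarrow> 'f::field_char_0"
  assumes "finite K" "finite D"
    and ker: "\<And>v j. (\<And>i. i \<in> K \<Longrightarrow> (\<Sum>j\<in>D. a i j * v j) = 0) \<Longrightarrow> j \<in> D \<Longrightarrow> v j = 0"
  obtains I v where "I \<subseteq> K" "card I = card D"
    "\<And>i k. i \<in> I \<Longrightarrow> k \<in> I \<Longrightarrow> (\<Sum>j\<in>D. a i j * v k j) = (if i = k then 1 else 0)"
    "\<And>x j. j \<in> D \<Longrightarrow> x j = (\<Sum>i\<in>I. (\<Sum>l\<in>D. a i l * x l) * v i j)"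
proof -
  define T where "T = (\<lambda>I. \<forall>v. (\<forall>i\<in>I. (\<Sum>j\<in>D. a i j * v j) = 0) \<longrightarrow> (\<forall>j\<in>D. v j = 0))"
  have "T K" unfolding T_def using ker by blast
  then obtain I where I: "I \<subseteq> K" "T I" and min: "\<And>I'. I' \<subseteq> K \<Longrightarrow> T I' \<Longrightarrow> card I \<le> card I'"
    using ex_has_least_nat[of "\<lambda>I. I \<subseteq> K \<and> T I" K card] by auto
  have "finite I" using I(1) assms(1) finite_subset by blast
  have "\<exists>w. (\<forall>i\<in>I. (\<Sum>j\<in>D. a i j * w j) = (if i = k then 1 else 0))" if "k \<in> I" for k
  proof -
    have "card (I - {k}) < card I" using that \<open>finite I\<close> by (meson card_Diff1_less)
    then have "\<not> T (I - {k})" using min[of "I - {k}"] I(1) by force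
    then obtain v j where v: "\<forall>i\<in>I - {k}. (\<Sum>j\<in>D. a i j * v j) = 0" "j \<in> D" "v j \<noteq> 0"
      unfolding T_def by blast
    define s where "s = (\<Sum>j\<in>D. a k j * v j)"
    have "s \<noteq> 0"
    proof
      assume "s = 0"
      then have "\<forall>i\<in>I. (\<Sum>j\<in>D. a i j * v j) = 0" using v(1) s_def by auto
      then show False using I(2) v unfolding T_def by blast
    qed
    have "(\<Sum>j\<in>D. a i j * (v j / s)) = (if i = k then 1 else 0)" if "i \<in> I" for i
      using v(1) \<open>s \<noteq> 0\<close> that by (auto simp: s_def sum_divide_distrib[symmetric])
    then show ?thesis by (intro exI[of _ "\<lambda>j. v j / s"]) simp
  qed
  then obtain v where v: "\<And>i k. i \<in> I \<Longrightarrow> k \<in> I \<Longrightarrow> (\<Sum>j\<in>D. a i j * v k j) = (if i = k then 1 else 0)"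
    by metis
  have rep: "x j = (\<Sum>i\<in>I. (\<Sum>l\<in>D. a i l * x l) * v i j)" if "j \<in> D" for x j
  proof -
    define y where "y = (\<lambda>j. x j - (\<Sum>i\<in>I. (\<Sum>l\<in>D. a i l * x l) * v i j))"
    have "(\<Sum>j\<in>D. a k j * y j) = 0" if "k \<in> I" for k
    proof -
      have "(\<Sum>j\<in>D. a k j * (\<Sum>i\<in>I. (\<Sum>l\<in>D. a i l * x l) * v i j))
          = (\<Sum>i\<in>I. (\<Sum>l\<in>D. a i l * x l) * (\<Sum>j\<in>D. a k j * v i j))"
        unfolding sum_distrib_left by (subst sum.swap) (simp add: mult_ac)
      also have "\<dots> = (\<Sum>i\<in>I. (\<Sum>l\<in>D. a i l * x l) * (if k = i then 1 else 0))"
        using v that by simp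
      also have "\<dots> = (\<Sum>l\<in>D. a k l * x l)"
        using that \<open>finite I\<close> by (simp add: if_distrib cong: if_cong)
      finally show ?thesis
        by (simp add: y_def right_diff_distrib sum_subtractf)
    qed
    then have "y j = 0" using I(2) that unfolding T_def by blast
    then show ?thesis by (simp add: y_def)
  qed
  \<comment> \<open>Both sides of the next identity are the trace of the same projection.\<close>
  have "of_nat (card I) = (\<Sum>i\<in>I. \<Sum>j\<in>D. a i j * v i j)" using v by simp
  also have "\<dots> = (\<Sum>j\<in>D. \<Sum>i\<in>I. a i j * v i j)" by (rule sum.swap)
  also have "\<dots> = (\<Sum>j\<in>D. 1)"
  proof (rule sum.cong)
    fix j assume j: "j \<in> D"
    have "(\<Sum>l\<in>D. a i l * (if l = j then 1 else 0)) = a i j" for i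
      using j assms(2) by (simp add: if_distrib cong: if_cong)
    then show "(\<Sum>i\<in>I. a i j * v i j) = 1"
      using rep[OF j, of "\<lambda>l. if l = j then 1 else 0"] by simp
  qed simp
  finally have "card I = card D" by simp
  then show thesis using that I(1) v rep by blast
qed

text \<open>
  Gaussian elimination for a family of linear systems: the pivot is positive, and the Schur
  complement is again positive definite.  Only ring operations and divisions by pivots occur,
  so that the solution stays in every class \<open>F\<close> of functions closed under them.  Below, \<open>F\<close> is
  continuity at a point, or being of class \<open>C\<^sup>k\<close>.
\<close>

lemma pd_solve:
  fixes F :: "('y \<Rightarrow> real) \<Rightarrow> bool" and W :: "'y set" and D :: "'d set"
  assumes diff: "\<And>f g. F f \<Longrightarrow> F g \<Longrightarrow> F (\<lambda>y. f y - g y)"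
    and mult: "\<And>f g. F f \<Longrightarrow> F g \<Longrightarrow> F (\<lambda>y. f y * g y)"
    and div: "\<And>f g. F f \<Longrightarrow> F g \<Longrightarrow> (\<And>y. y \<in> W \<Longrightarrow> g y \<noteq> 0) \<Longrightarrow> F (\<lambda>y. f y / g y)"
    and D: "finite D"
    and H: "\<And>b c. b \<in> D \<Longrightarrow> c \<in> D \<Longrightarrow> F (H b c)" and r: "\<And>b. b \<in> D \<Longrightarrow> F (r b)"
    and sym: "\<And>b c y. b \<in> D \<Longrightarrow> c \<in> D \<Longrightarrow> y \<in> W \<Longrightarrow> H b c y = H c b y"
    and pd: "\<And>v y b. y \<in> W \<Longrightarrow> b \<in> D \<Longrightarrow> v b \<noteq> 0 \<Longrightarrow> (\<Sum>b\<in>D. \<Sum>c\<in>D. v b * H b c y * v c) > 0"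
  shows "\<exists>x. (\<forall>b\<in>D. F (x b)) \<and> (\<forall>y\<in>W. \<forall>b\<in>D. (\<Sum>c\<in>D. H b c y * x c y) = r b y)"
  using D H r sym pd
proof (induction D arbitrary: H r rule: finite_induct)
  case empty
  then show ?case by auto
next
  case (insert a D)
  note H = insert.prems(1) and r = insert.prems(2) and sym = insert.prems(3) and pd = insert.prems(4)
  have expand: "(\<Sum>b\<in>insert a D. \<Sum>c\<in>insert a D. w b * H b c y * w c)
      = w a * H a a y * w a + w a * (\<Sum>c\<in>D. H a c y * w c) + w a * (\<Sum>c\<in>D. w c * H c a y)
        + (\<Sum>b\<in>D. \<Sum>c\<in>D. w b * H b c y * w c)" for w y
  proof -
    have "(\<Sum>c\<in>insert a D. w b * H b c y * w c) = w b * H b a y * w a + (\<Sum>c\<in>D. w b * H b c y * w c)" for b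
      by (simp only: sum.insert[OF insert.hyps])
    then have "(\<Sum>b\<in>insert a D. \<Sum>c\<in>insert a D. w b * H b c y * w c)
      = w a * H a a y * w a + (\<Sum>c\<in>D. w a * H a c y * w c) + ((\<Sum>b\<in>D. w b * H b a y * w a)
        + (\<Sum>b\<in>D. \<Sum>c\<in>D. w b * H b c y * w c))"
      by (simp only: sum.insert[OF insert.hyps] sum.distrib)
    moreover have "(\<Sum>c\<in>D. w a * H a c y * w c) = w a * (\<Sum>c\<in>D. H a c y * w c)"
      by (simp only: sum_distrib_left mult.assoc)
    moreover have "(\<Sum>b\<in>D. w b * H b a y * w a) = w a * (\<Sum>c\<in>D. w c * H c a y)"
      by (simp only: sum_distrib_left mult.commute)
    ultimately show ?thesis by linarith
  qed
  have pos: "H a a y > 0" if y: "y \<in> W" for y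
  proof -
    define w where "w = (\<lambda>b. if b = a then 1 else 0 :: real)"
    have w: "w a = 1" "\<And>c. c \<in> D \<Longrightarrow> w c = 0" using insert.hyps by (auto simp: w_def)
    have "(\<Sum>c\<in>D. H a c y * w c) = 0" "(\<Sum>c\<in>D. w c * H c a y) = 0"
      "(\<Sum>b\<in>D. \<Sum>c\<in>D. w b * H b c y * w c) = 0"
      using w(2) by (auto intro!: sum.neutral)
    then show ?thesis using pd[OF y, of a w] w(1) unfolding expand by simp
  qed
  define H' where "H' = (\<lambda>b c y. H b c y - H b a y * H a c y / H a a y)"
  define r' where "r' = (\<lambda>b y. r b y - H b a y * r a y / H a a y)"
  have "\<exists>x. (\<forall>b\<in>D. F (x b)) \<and> (\<forall>y\<in>W. \<forall>b\<in>D. (\<Sum>c\<in>D. H' b c y * x c y) = r' b y)"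
  proof (rule insert.IH)
    show "F (H' b c)" if "b \<in> D" "c \<in> D" for b c
      unfolding H'_def using that pos by (intro diff mult div H) (auto simp: less_imp_neq[symmetric])
    show "F (r' b)" if "b \<in> D" for b
      unfolding r'_def using that pos by (intro diff mult div H r) (auto simp: less_imp_neq[symmetric])
    show "H' b c y = H' c b y" if "b \<in> D" "c \<in> D" "y \<in> W" for b c y
      using that sym[of b c y] sym[of a b y] sym[of a c y] by (simp add: H'_def mult_ac)
    show "(\<Sum>b\<in>D. \<Sum>c\<in>D. v b * H' b c y * v c) > 0" if y: "y \<in> W" and b: "b \<in> D" "v b \<noteq> 0" for v y b
    proof -
      define S where "S = (\<Sum>c\<in>D. H a c y * v c)"
      define Q where "Q = (\<Sum>b\<in>D. \<Sum>c\<in>D. v b * H b c y * v c)"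
      \<comment> \<open>This value of the new coordinate minimises the form, and leaves the Schur complement.\<close>
      define w where "w = v(a := - S / H a a y)"
      have w: "w c = v c" if "c \<in> D" for c using that insert.hyps by (auto simp: w_def)
      have S': "(\<Sum>c\<in>D. v c * H c a y) = S"
        unfolding S_def using sym y by (intro sum.cong) auto
      have "(\<Sum>b\<in>insert a D. \<Sum>c\<in>insert a D. w b * H b c y * w c)
          = w a * H a a y * w a + w a * S + w a * S + Q"
        unfolding expand Q_def S'[symmetric] using S' w by (simp add: S_def)
      also have "\<dots> = Q - S * S / H a a y"
        using pos[OF y] by (simp add: w_def field_simps)
      finally have "Q - S * S / H a a y > 0"
        using pd[OF y, of b w] b w by auto
      moreover have "(\<Sum>b\<in>D. \<Sum>c\<in>D. v b * H' b c y * v c)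
          = Q - (\<Sum>b\<in>D. \<Sum>c\<in>D. (v b * H b a y) * (H a c y * v c)) / H a a y"
        by (simp add: Q_def H'_def algebra_simps sum_subtractf sum_divide_distrib)
      moreover have "(\<Sum>b\<in>D. \<Sum>c\<in>D. (v b * H b a y) * (H a c y * v c)) = S * S"
        by (simp only: sum_product[symmetric] S' S_def[symmetric])
      ultimately show ?thesis by simp
    qed
  qed
  then obtain x where xF: "\<And>b. b \<in> D \<Longrightarrow> F (x b)"
    and x: "\<And>y b. y \<in> W \<Longrightarrow> b \<in> D \<Longrightarrow> (\<Sum>c\<in>D. H' b c y * x c y) = r' b y" by blast
  have Fsum: "F (\<lambda>y. g y - (\<Sum>c\<in>C. f c y))" if "finite C" "F g" "\<And>c. c \<in> C \<Longrightarrow> F (f c)" for C f g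
    using that
  proof (induction C rule: finite_induct)
    case (insert c C)
    have "F (\<lambda>y. (g y - (\<Sum>c\<in>C. f c y)) - f c y)" by (intro diff insert) (use insert in auto)
    then show ?case using insert.hyps by (simp add: algebra_simps)
  qed simp
  define z where "z = x(a := \<lambda>y. (r a y - (\<Sum>c\<in>D. H a c y * x c y)) / H a a y)"
  have z: "z c = x c" if "c \<in> D" for c using that insert.hyps by (auto simp: z_def)
  show ?case
  proof (intro exI[of _ z] conjI ballI)
    show "F (z b)" if "b \<in> insert a D" for b
    proof (cases "b = a")
      case True
      have "F (\<lambda>y. (r a y - (\<Sum>c\<in>D. H a c y * x c y)) / H a a y)"
        using insert.hyps xF H r pos by (intro div Fsum mult) (auto simp: less_imp_neq[symmetric])
      then show ?thesis by (simp add: True z_def)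
    qed (use that xF z in auto)
    show "(\<Sum>c\<in>insert a D. H b c y * z c y) = r b y" if y: "y \<in> W" and b: "b \<in> insert a D" for y b
    proof -
      define S where "S = (\<Sum>c\<in>D. H a c y * x c y)"
      have za: "z a y = (r a y - S) / H a a y" by (simp add: z_def S_def)
      have sum: "(\<Sum>c\<in>insert a D. H b c y * z c y) = H b a y * z a y + (\<Sum>c\<in>D. H b c y * x c y)"
        using insert.hyps z by simp
      show ?thesis
      proof (cases "b = a")
        case True
        then show ?thesis using sum za pos[OF y] by (simp add: S_def)
      next
        case False
        then have "b \<in> D" using b by blast
        have "(\<Sum>c\<in>D. H' b c y * x c y) = (\<Sum>c\<in>D. H b c y * x c y) - H b a y / H a a y * S"
          by (simp add: H'_def S_def algebra_simps sum_subtractf sum_distrib_left)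
        then have "(\<Sum>c\<in>D. H b c y * x c y) = r b y - H b a y * r a y / H a a y + H b a y / H a a y * S"
          using x[OF y \<open>b \<in> D\<close>] by (simp add: r'_def)
        then show ?thesis using sum za pos[OF y] by (simp add: field_simps)
      qed
    qed
  qed
qed

section \<open>Balancing weights by exponentials\<close>

definition pairing :: "nat \<Rightarrow> (nat \<Rightarrow> nat \<Rightarrow> real) \<Rightarrow> nat \<Rightarrow> (nat \<Rightarrow> real) \<Rightarrow> real" where
  "pairing d B i u = (\<Sum>k\<le>d. B i k * u k)"

text \<open>
  The vectors \<open>B\<^sub>i\<close> with \<open>i \<in> J\<close> span \<open>\<real>\<^sup>d\<^sup>+\<^sup>1\<close>, expressed through the vanishing of their common kernel.
\<close>

definition separating :: "nat \<Rightarrow> (nat \<Rightarrow> nat \<Rightarrow> real) \<Rightarrow> nat set \<Rightarrow> bool" where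
  "separating d B J \<longleftrightarrow> (\<forall>u. (\<forall>i\<in>J. pairing d B i u = 0) \<longrightarrow> (\<forall>k\<le>d. u k = 0))"

text \<open>
  The vector \<open>u\<close> is a critical point of the convex function
  \<open>u \<mapsto> (\<Sum>i<n. a\<^sub>i exp \<langle>B\<^sub>i, u\<rangle>) - u\<^sub>d\<close>.  If \<open>a \<ge> 0\<close> and every vector \<open>B\<^sub>i\<close> ends in \<open>1\<close>, it says
  that the numbers \<open>a\<^sub>i exp \<langle>B\<^sub>i, u\<rangle>\<close> are the coefficients of a vanishing convex combination of the
  vectors \<open>B\<^sub>i\<close> without their last entries.  With \<open>a\<^sub>i = \<bar>z\<^sub>i\<bar>\<^sup>2\<close> this singles out the point of the link on an orbit.
\<close>

definition balanced :: "nat \<Rightarrow> nat \<Rightarrow> (nat \<Rightarrow> nat \<Rightarrow> real) \<Rightarrow> (nat \<Rightarrow> real) \<Rightarrow> (nat \<Rightarrow> real) \<Rightarrow> bool" where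
  "balanced n d B a u \<longleftrightarrow>
     (\<forall>j\<le>d. (\<Sum>i<n. a i * exp (pairing d B i u) * B i j) = (if j = d then 1 else 0))"

lemma pairing_diff: "pairing d B i (\<lambda>k. u k - v k) = pairing d B i u - pairing d B i v"
  by (simp add: pairing_def right_diff_distrib sum_subtractf)

lemma pairing_scale: "pairing d B i (\<lambda>k. t * u k) = t * pairing d B i u"
  by (simp add: pairing_def sum_distrib_left mult_ac)

lemma pairing_zero [simp]: "pairing d B i (\<lambda>k. 0) = 0"
  by (simp add: pairing_def)

lemma separating_mono: "separating d B I \<Longrightarrow> I \<subseteq> J \<Longrightarrow> separating d B J"
  unfolding separating_def by blast

lemma separating_coordinates:
  assumes "separating d B J" "finite J"
  obtains I v where "I \<subseteq> J" "\<And>u k. k \<le> d \<Longrightarrow> u k = (\<Sum>i\<in>I. pairing d B i u * v i k)"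
proof -
  have ker: "u k = 0" if "\<And>i. i \<in> J \<Longrightarrow> (\<Sum>k\<in>{..d}. B i k * u k) = 0" "k \<in> {..d}" for u k
    using assms(1) that unfolding separating_def pairing_def by auto
  show thesis
  proof (rule dual_basis[OF assms(2) finite_atMost[of d], of B])
    fix I v
    assume "I \<subseteq> J" "\<And>x j. j \<in> {..d} \<Longrightarrow> x j = (\<Sum>i\<in>I. (\<Sum>l\<in>{..d}. B i l * x l) * v i j)"
    then show thesis using that[of I v] unfolding pairing_def by simp
  qed (use ker in blast)
qed

lemma balanced_weights:
  assumes "balanced n d B a u"
  shows "(\<Sum>i<n. a i * exp (pairing d B i u) * pairing d B i w) = w d"
proof -
  have "(\<Sum>i<n. a i * exp (pairing d B i u) * pairing d B i w)
      = (\<Sum>k\<le>d. w k * (\<Sum>i<n. a i * exp (pairing d B i u) * B i k))"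
    unfolding pairing_def[of d B _ w] sum_distrib_left by (subst sum.swap) (simp add: mult_ac)
  also have "\<dots> = (\<Sum>k\<le>d. w k * (if k = d then 1 else 0))"
    using assms unfolding balanced_def by (intro sum.cong) auto
  also have "\<dots> = w d" by (simp add: if_distrib cong: if_cong)
  finally show ?thesis .
qed

lemma balanced_sum:
  assumes "balanced n d B a u" "\<And>i. i < n \<Longrightarrow> B i d = 1"
  shows "(\<Sum>i<n. a i * exp (pairing d B i u)) = 1"
proof -
  have "(\<Sum>i<n. a i * exp (pairing d B i u)) = (\<Sum>i<n. a i * exp (pairing d B i u) * B i d)"
    using assms(2) by simp
  then show ?thesis using assms(1) unfolding balanced_def by simp
qed

text \<open>
  The convex function \<open>exp x - 1 - x\<close> lies above its values at \<open>e\<close> and \<open>- e\<close> outside \<open>(- e, e)\<close>,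
  so that it is small only near its zero.
\<close>

lemma exp_remainder_small:
  fixes x e :: real
  assumes "e > 0" "exp x - 1 - x < min (exp e - 1 - e) (exp (-e) - 1 + e)"
  shows "\<bar>x\<bar> < e"
proof (rule ccontr)
  assume "\<not> \<bar>x\<bar> < e"
  then consider "x \<ge> e" | "x \<le> - e" by linarith
  then show False
  proof cases
    case 1
    have "exp e * (1 + (x - e)) \<le> exp e * exp (x - e)"
      using exp_ge_add_one_self[of "x - e"] by simp
    moreover have "1 * (x - e) \<le> exp e * (x - e)"
      using 1 assms(1) by (intro mult_right_mono) auto
    ultimately have "exp e + (x - e) \<le> exp x" by (simp add: exp_diff algebra_simps)
    then show False using assms(2) by simp
  next
    case 2
    have "exp (-e) * (1 + (x + e)) \<le> exp (-e) * exp (x + e)"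
      using exp_ge_add_one_self[of "x + e"] by simp
    moreover have "1 * (x + e) \<le> exp (-e) * (x + e)"
      using 2 assms(1) by (intro mult_right_mono_neg) auto
    ultimately have "exp (-e) + (x + e) \<le> exp x"
      by (simp add: exp_add exp_minus field_simps)
    then show False using assms(2) by simp
  qed
qed

lemma exp_gt_add_one:
  fixes x :: real
  assumes "x \<noteq> 0"
  shows "exp x - 1 - x > 0"
proof (rule ccontr)
  assume "\<not> ?thesis"
  then have eq: "exp x = 1 + x" using exp_ge_add_one_self[of x] by linarith
  have "(1 + x / 2)\<^sup>2 \<le> exp x" if "1 + x / 2 \<ge> 0"
  proof -
    have "(1 + x / 2)\<^sup>2 \<le> (exp (x / 2))\<^sup>2"
      using that exp_ge_add_one_self[of "x / 2"] by (intro power_mono) auto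
    also have "\<dots> = exp x" by (simp add: power2_eq_square flip: exp_add)
    finally show ?thesis .
  qed
  moreover have "1 + x > 0" using eq exp_gt_zero[of x] by linarith
  ultimately have "x\<^sup>2 \<le> 0" using eq by (simp add: power2_eq_square algebra_simps)
  then show False using assms by simp
qed

text \<open>
  The left side is the increase, from \<open>v\<close> to \<open>u\<close>, of the convex function attached to \<open>\<alpha>\<close>, which
  is minimal at \<open>v\<close>.  It is bounded by exchanging \<open>\<alpha>\<close> for \<open>a\<close> at \<open>u\<close>, where the numbers
  \<open>a\<^sub>i exp \<langle>B\<^sub>i, u\<rangle>\<close> sum to \<open>1\<close>, and by the convexity of the function attached to \<open>a\<close>, which is
  minimal at \<open>u\<close>.  Since the right side tends to \<open>0\<close> as \<open>a\<close> tends to \<open>\<alpha>\<close>, this one inequality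
  gives both the uniqueness and the continuity of balancing vectors.
\<close>

lemma bregman_bound:
  assumes B: "\<And>i. i < n \<Longrightarrow> B i d = 1"
    and \<alpha>: "\<And>i. i < n \<Longrightarrow> \<alpha> i \<ge> 0" "balanced n d B \<alpha> v"
    and a: "\<And>i. i < n \<Longrightarrow> a i \<ge> 0" "\<And>i. i < n \<Longrightarrow> \<alpha> i > 0 \<Longrightarrow> a i > 0" "balanced n d B a u"
  defines "g \<equiv> \<lambda>i. pairing d B i u" and "h \<equiv> \<lambda>i. pairing d B i v"
  shows "(\<Sum>i<n. \<alpha> i * exp (h i) * (exp (g i - h i) - 1 - (g i - h i)))
     \<le> (\<Sum>i | i < n \<and> \<alpha> i > 0. \<bar>\<alpha> i / a i - 1\<bar>) + ((\<Sum>i<n. a i * exp (h i)) - 1)"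
proof -
  define x where "x = (\<lambda>i. a i * exp (g i))"
  have x0: "x i \<ge> 0" if "i < n" for i using a that by (simp add: x_def)
  have sx: "(\<Sum>i<n. x i) = 1" using balanced_sum[OF a(3) B] by (simp add: x_def g_def)
  have x1: "x i \<le> 1" if "i < n" for i
    using member_le_sum[of i "{..<n}" x] x0 sx that by auto
  have diffp: "pairing d B i (\<lambda>k. u k - v k) = g i - h i" for i by (simp add: pairing_diff g_def h_def)
  have "(\<Sum>i<n. \<alpha> i * exp (h i) * (exp (g i - h i) - 1 - (g i - h i)))
      = (\<Sum>i<n. \<alpha> i * exp (g i)) - (\<Sum>i<n. \<alpha> i * exp (h i)) - (\<Sum>i<n. \<alpha> i * exp (h i) * (g i - h i))"
    unfolding sum_subtractf[symmetric] by (intro sum.cong) (auto simp: exp_diff field_simps)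
  also have "(\<Sum>i<n. \<alpha> i * exp (h i)) = 1" using balanced_sum[OF \<alpha>(2) B] by (simp add: h_def)
  also have "(\<Sum>i<n. \<alpha> i * exp (h i) * (g i - h i)) = u d - v d"
    using balanced_weights[OF \<alpha>(2), of "\<lambda>k. u k - v k"] by (simp add: diffp h_def)
  finally have 1: "(\<Sum>i<n. \<alpha> i * exp (h i) * (exp (g i - h i) - 1 - (g i - h i)))
      = (\<Sum>i<n. \<alpha> i * exp (g i)) - 1 - (u d - v d)" .
  have "(\<Sum>i<n. \<alpha> i * exp (g i)) = (\<Sum>i | i < n \<and> \<alpha> i > 0. \<alpha> i * exp (g i))"
  proof (rule sum.mono_neutral_right)
    show "\<forall>i\<in>{..<n} - {i. i < n \<and> \<alpha> i > 0}. \<alpha> i * exp (g i) = 0"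
    proof
      fix i assume "i \<in> {..<n} - {i. i < n \<and> \<alpha> i > 0}"
      then have "\<alpha> i = 0" using \<alpha>(1)[of i] by force
      then show "\<alpha> i * exp (g i) = 0" by simp
    qed
  qed auto
  also have "\<dots> \<le> (\<Sum>i | i < n \<and> \<alpha> i > 0. \<bar>\<alpha> i / a i - 1\<bar> + x i)"
  proof (rule sum_mono)
    fix i assume i: "i \<in> {i. i < n \<and> \<alpha> i > 0}"
    then have "\<alpha> i * exp (g i) = (\<alpha> i / a i - 1) * x i + x i"
      using a(2)[of i] by (simp add: x_def field_simps)
    also have "(\<alpha> i / a i - 1) * x i \<le> \<bar>\<alpha> i / a i - 1\<bar> * x i"
      using x0[of i] i by (intro mult_right_mono) auto
    also have "\<dots> \<le> \<bar>\<alpha> i / a i - 1\<bar>"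
      using x1[of i] i by (simp add: mult_left_le)
    finally show "\<alpha> i * exp (g i) \<le> \<bar>\<alpha> i / a i - 1\<bar> + x i" by simp
  qed
  also have "\<dots> \<le> (\<Sum>i | i < n \<and> \<alpha> i > 0. \<bar>\<alpha> i / a i - 1\<bar>) + (\<Sum>i<n. x i)"
    unfolding sum.distrib using x0 by (intro add_left_mono sum_mono2) auto
  finally have 2: "(\<Sum>i<n. \<alpha> i * exp (g i)) \<le> (\<Sum>i | i < n \<and> \<alpha> i > 0. \<bar>\<alpha> i / a i - 1\<bar>) + 1"
    by (simp add: sx)
  have "1 - (u d - v d) = (\<Sum>i<n. x i * (1 - (g i - h i)))"
    using balanced_weights[OF a(3), of "\<lambda>k. u k - v k"] sx
    by (simp add: diffp x_def g_def algebra_simps sum_subtractf sum.distrib)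
  also have "\<dots> \<le> (\<Sum>i<n. a i * exp (h i))"
  proof (rule sum_mono)
    fix i assume "i \<in> {..<n}"
    then have "x i \<ge> 0" by (simp add: x0)
    moreover have "1 - (g i - h i) \<le> exp (h i - g i)"
      using exp_ge_add_one_self[of "h i - g i"] by linarith
    ultimately have "x i * (1 - (g i - h i)) \<le> x i * exp (h i - g i)"
      by (intro mult_left_mono)
    also have "\<dots> = a i * exp (h i)" by (simp add: x_def exp_diff)
    finally show "x i * (1 - (g i - h i)) \<le> a i * exp (h i)" .
  qed
  finally have "1 - (u d - v d) \<le> (\<Sum>i<n. a i * exp (h i))" .
  with 1 2 show ?thesis by linarith
qed

text \<open>
  Each summand on the left of the previous inequality is nonnegative, hence tends to \<open>0\<close>.  So the
  pairings of the vectors \<open>B\<^sub>i\<close> in the support of \<open>\<alpha>\<close> with \<open>u t - v\<close> tend to \<open>0\<close>, and these pairings determine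
  all coordinates.
\<close>

lemma balanced_tendsto:
  assumes B: "\<And>i. i < n \<Longrightarrow> B i d = 1"
    and \<alpha>: "\<And>i. i < n \<Longrightarrow> \<alpha> i \<ge> 0" "balanced n d B \<alpha> v"
    and sep: "separating d B {i. i < n \<and> \<alpha> i > 0}"
    and a: "\<And>i. i < n \<Longrightarrow> ((\<lambda>t. a t i) \<longlongrightarrow> \<alpha> i) F"
    and u: "\<forall>\<^sub>F t in F. (\<forall>i<n. a t i \<ge> 0) \<and> balanced n d B (a t) (u t)"
    and k: "k \<le> d"
  shows "((\<lambda>t. u t k) \<longlongrightarrow> v k) F"
proof -
  define J where "J = {i. i < n \<and> \<alpha> i > 0}"
  have "finite J" by (simp add: J_def)
  define h where "h = (\<lambda>i. pairing d B i v)"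
  define g where "g = (\<lambda>t i. pairing d B i (u t))"
  define \<phi> where "\<phi> = (\<lambda>x::real. exp x - 1 - x)"
  have \<phi>0: "\<phi> x \<ge> 0" for x unfolding \<phi>_def using exp_ge_add_one_self[of x] by linarith
  have ev: "\<forall>\<^sub>F t in F. \<forall>i\<in>J. a t i > 0"
    using a by (intro eventually_ball_finite \<open>finite J\<close> ballI order_tendstoD(1)) (auto simp: J_def)
  define R where "R = (\<lambda>t. (\<Sum>i\<in>J. \<bar>\<alpha> i / a t i - 1\<bar>) + ((\<Sum>i<n. a t i * exp (h i)) - 1))"
  have "((\<lambda>t. R t) \<longlongrightarrow> (\<Sum>i\<in>J. \<bar>\<alpha> i / \<alpha> i - 1\<bar>) + ((\<Sum>i<n. \<alpha> i * exp (h i)) - 1)) F"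
    unfolding R_def by (intro tendsto_intros a) (auto simp: J_def)
  moreover have "(\<Sum>i<n. \<alpha> i * exp (h i)) = 1" using balanced_sum[OF \<alpha>(2) B] by (simp add: h_def)
  moreover have "(\<Sum>i\<in>J. \<bar>\<alpha> i / \<alpha> i - 1\<bar>) = 0" by (auto simp: J_def intro!: sum.neutral)
  ultimately have R0: "(R \<longlongrightarrow> 0) F" by simp
  have bound: "\<forall>\<^sub>F t in F. \<forall>i\<in>J. \<alpha> i * exp (h i) * \<phi> (g t i - h i) \<le> R t"
    using ev u
  proof eventually_elim
    case (elim t)
    have "(\<Sum>i<n. \<alpha> i * exp (h i) * \<phi> (g t i - h i)) \<le> R t"
      using bregman_bound[OF B \<alpha>, of "a t" "u t"] elim
      unfolding R_def J_def h_def g_def \<phi>_def by auto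
    moreover have "\<alpha> i * exp (h i) * \<phi> (g t i - h i) \<le> (\<Sum>i<n. \<alpha> i * exp (h i) * \<phi> (g t i - h i))"
      if "i \<in> J" for i
      using that \<alpha>(1) \<phi>0 by (intro member_le_sum) (auto simp: J_def)
    ultimately show ?case by (meson order_trans)
  qed
  have lim: "((\<lambda>t. g t i - h i) \<longlongrightarrow> 0) F" if i: "i \<in> J" for i
  proof (rule tendstoI)
    fix e :: real assume e: "e > 0"
    define \<delta> where "\<delta> = min (\<phi> e) (\<phi> (-e))"
    have "\<delta> > 0" using exp_gt_add_one[of e] exp_gt_add_one[of "-e"] e by (simp add: \<delta>_def \<phi>_def)
    have p: "\<alpha> i * exp (h i) > 0" using i by (simp add: J_def)
    have "\<forall>\<^sub>F t in F. R t < \<alpha> i * exp (h i) * \<delta>"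
      using R0 p \<open>\<delta> > 0\<close> by (intro order_tendstoD(2)) auto
    then show "\<forall>\<^sub>F t in F. dist (g t i - h i) 0 < e"
      using bound
    proof eventually_elim
      case (elim t)
      then have "\<alpha> i * exp (h i) * \<phi> (g t i - h i) < \<alpha> i * exp (h i) * \<delta>" using i by force
      then have "\<phi> (g t i - h i) < \<delta>" using mult_less_cancel_left_pos[OF p] by blast
      then show ?case using exp_remainder_small[OF e, of "g t i - h i"] by (simp add: \<delta>_def \<phi>_def)
    qed
  qed
  obtain I w where I: "I \<subseteq> J" and w: "\<And>u k. k \<le> d \<Longrightarrow> u k = (\<Sum>i\<in>I. pairing d B i u * w i k)"
    using separating_coordinates[OF sep[folded J_def] \<open>finite J\<close>] by blast
  have "u t k - v k = (\<Sum>i\<in>I. (g t i - h i) * w i k)" for t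
    using w[OF k, of "\<lambda>k. u t k - v k"] by (simp add: pairing_diff g_def h_def)
  moreover have "((\<lambda>t. (\<Sum>i\<in>I. (g t i - h i) * w i k)) \<longlongrightarrow> (\<Sum>i\<in>I. 0 * w i k)) F"
    using I lim by (intro tendsto_intros) auto
  ultimately have "((\<lambda>t. u t k - v k) \<longlongrightarrow> 0) F" by simp
  then show ?thesis by (simp add: LIM_zero_iff)
qed

lemma balanced_unique:
  assumes B: "\<And>i. i < n \<Longrightarrow> B i d = 1"
    and \<alpha>: "\<And>i. i < n \<Longrightarrow> \<alpha> i \<ge> 0" "balanced n d B \<alpha> v" "balanced n d B \<alpha> u"
    and sep: "separating d B {i. i < n \<and> \<alpha> i > 0}"
    and k: "k \<le> d"
  shows "u k = v k"
proof -
  have "((\<lambda>t::nat. u k) \<longlongrightarrow> v k) sequentially"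
    by (rule balanced_tendsto[OF B \<alpha>(1,2) sep _ _ k, where a = "\<lambda>_. \<alpha>" and u = "\<lambda>_. u"])
       (use \<alpha> in auto)
  then show ?thesis by (simp add: LIMSEQ_const_iff)
qed

text \<open>
  The convex function is coercive.  The relation \<open>\<Sum>i\<in>I. c\<^sub>i B\<^sub>i = e\<^sub>d\<close> turns the linear term into
  \<open>\<Sum>i\<in>I. c\<^sub>i \<langle>B\<^sub>i, u\<rangle>\<close>, and each \<open>a\<^sub>i exp g - c\<^sub>i g\<close> grows linearly in \<open>\<bar>g\<bar>\<close>.  Hence a sublevel set
  lies in a cube, and a minimum over that cube is a global one.
\<close>

lemma balanced_exists:
  assumes B: "\<And>i. i < n \<Longrightarrow> B i d = 1"
    and a: "\<And>i. i < n \<Longrightarrow> a i \<ge> 0"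
    and I: "I \<subseteq> {i. i < n \<and> a i > 0}" "separating d B I" "\<And>i. i \<in> I \<Longrightarrow> c i > 0"
    and c: "\<And>j. j \<le> d \<Longrightarrow> (\<Sum>i\<in>I. c i * B i j) = (if j = d then 1 else 0)"
  shows "\<exists>u. balanced n d B a u"
proof -
  define h where "h = (\<lambda>u. (\<Sum>i<n. a i * exp (pairing d B i u)) - u d)"
  have fI: "finite I" by (rule finite_subset[OF I(1)]) simp
  have cd: "(\<Sum>i\<in>I. c i * pairing d B i u) = u d" for u
  proof -
    have "(\<Sum>i\<in>I. c i * pairing d B i u) = (\<Sum>k\<le>d. u k * (\<Sum>i\<in>I. c i * B i k))"
      unfolding pairing_def sum_distrib_left by (subst sum.swap) (simp add: mult_ac)
    also have "\<dots> = (\<Sum>k\<le>d. u k * (if k = d then 1 else 0))"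
      using c by (intro sum.cong) auto
    finally show ?thesis by (simp add: if_distrib cong: if_cong)
  qed
  define K where "K = (\<lambda>i. 2 * c i * \<bar>1 - ln (2 * c i / a i)\<bar>)"
  \<comment> \<open>The tangent line of slope \<open>2 c\<^sub>i\<close> leaves growth \<open>c\<^sub>i g\<close> on the right; positivity of \<open>exp\<close> suffices on the left.\<close>
  have lower: "a i * exp g - c i * g \<ge> c i * \<bar>g\<bar> - K i" if i: "i \<in> I" for i g
  proof -
    have pos: "c i > 0" "a i > 0" using i I by auto
    define g' where "g' = ln (2 * c i / a i)"
    have "exp g' * (1 + (g - g')) \<le> exp g' * exp (g - g')"
      using exp_ge_add_one_self[of "g - g'"] by simp
    then have "exp g' * (1 + (g - g')) \<le> exp g" by (simp add: exp_diff)
    moreover have "exp g' = 2 * c i / a i" using pos by (simp add: g'_def)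
    ultimately have 1: "2 * c i * (1 + (g - g')) \<le> a i * exp g"
      using pos by (simp add: field_simps)
    have "2 * c i * (1 - g') \<ge> 2 * c i * - \<bar>1 - g'\<bar>"
      using pos by (intro mult_left_mono) auto
    then have "2 * c i * (1 - g') \<ge> - K i" by (simp add: K_def g'_def)
    moreover have "K i \<ge> 0" using pos by (simp add: K_def)
    moreover have "a i * exp g > 0" using pos by simp
    moreover have "2 * c i * (1 + (g - g')) = 2 * c i * (1 - g') + 2 * (c i * g)"
      by (simp add: algebra_simps)
    moreover have "c i * \<bar>g\<bar> = (if g \<ge> 0 then c i * g else - (c i * g))" by simp
    ultimately show ?thesis using 1 by (auto split: if_splits)
  qed
  obtain I' v where I': "I' \<subseteq> I" and v: "\<And>u k. k \<le> d \<Longrightarrow> u k = (\<Sum>i\<in>I'. pairing d B i u * v i k)"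
    using separating_coordinates[OF I(2) fI] by blast
  define M where "M = h (\<lambda>_. 0) + (\<Sum>i\<in>I. K i)"
  define R where "R = (\<Sum>k\<le>d. \<Sum>i\<in>I'. \<bar>M\<bar> / c i * \<bar>v i k\<bar>)"
  have bounded: "\<bar>u k\<bar> \<le> R" if hu: "h u \<le> h (\<lambda>_. 0)" and k: "k \<le> d" for u k
  proof -
    have "(\<Sum>i\<in>I. c i * \<bar>pairing d B i u\<bar> - K i) \<le> (\<Sum>i\<in>I. a i * exp (pairing d B i u) - c i * pairing d B i u)"
      using lower by (intro sum_mono) auto
    also have "\<dots> = (\<Sum>i\<in>I. a i * exp (pairing d B i u)) - u d"
      by (simp add: sum_subtractf cd)
    also have "\<dots> \<le> h u"
      unfolding h_def using I(1) a by (intro diff_right_mono sum_mono2) auto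
    finally have s: "(\<Sum>i\<in>I. c i * \<bar>pairing d B i u\<bar>) \<le> M" using hu by (simp add: sum_subtractf M_def)
    have g: "\<bar>pairing d B i u\<bar> \<le> \<bar>M\<bar> / c i" if i: "i \<in> I" for i
    proof -
      have "c i * \<bar>pairing d B i u\<bar> \<le> (\<Sum>i\<in>I. c i * \<bar>pairing d B i u\<bar>)"
        using i fI I(3) by (intro member_le_sum) (auto simp: less_imp_le)
      then have "c i * \<bar>pairing d B i u\<bar> \<le> \<bar>M\<bar>" using s by linarith
      then show ?thesis using I(3)[OF i] by (simp add: field_simps)
    qed
    have "\<bar>u k\<bar> \<le> (\<Sum>i\<in>I'. \<bar>pairing d B i u * v i k\<bar>)"
      using v[OF k, of u] sum_abs by metis
    also have "\<dots> \<le> (\<Sum>i\<in>I'. \<bar>M\<bar> / c i * \<bar>v i k\<bar>)"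
      unfolding abs_mult using g I' by (intro sum_mono mult_right_mono) auto
    also have "\<dots> \<le> R"
      unfolding R_def using k I' I(3)
      by (intro member_le_sum[of k "{..d}" "\<lambda>k. \<Sum>i\<in>I'. \<bar>M\<bar> / c i * \<bar>v i k\<bar>"] sum_nonneg)
         (auto simp: less_imp_le subset_iff intro!: mult_nonneg_nonneg divide_nonneg_pos)
    finally show ?thesis .
  qed
  define Q where "Q = PiE UNIV (\<lambda>j. if j \<le> d then {-R..R} else {0})"
  have "compactin (product_topology (\<lambda>_. euclidean) UNIV) Q"
    unfolding Q_def by (simp add: compactin_PiE)
  then have "compact Q" by (simp add: euclidean_product_topology)
  have cont: "continuous_on UNIV h"
    unfolding h_def pairing_def by (intro continuous_intros continuous_on_product_coordinates)
  have "R \<ge> 0" using bounded[of "\<lambda>_. 0" 0] by simp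
  have Q_iff: "w \<in> Q \<longleftrightarrow> (\<forall>j. if j \<le> d then \<bar>w j\<bar> \<le> R else w j = 0)" for w
  proof -
    have "w j \<in> (if j \<le> d then {-R..R} else {0}) \<longleftrightarrow> (if j \<le> d then \<bar>w j\<bar> \<le> R else w j = 0)" for j
      by (simp add: abs_le_iff) linarith
    then show ?thesis by (simp only: Q_def PiE_UNIV_domain Pi_iff ball_UNIV)
  qed
  then have Q0: "(\<lambda>_. 0) \<in> Q" using \<open>R \<ge> 0\<close> by simp
  have "\<exists>u\<in>Q. \<forall>w\<in>Q. h u \<le> h w"
    by (rule continuous_attains_inf[OF \<open>compact Q\<close> _ continuous_on_subset[OF cont]]) (use Q0 in auto)
  then obtain u where u: "u \<in> Q" and "\<forall>w\<in>Q. h u \<le> h w" by (elim bexE)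
  then have min: "h u \<le> h w" if "w \<in> Q" for w using that by (elim bspec)
  have glob: "h u \<le> h w" if w: "\<And>k. k > d \<Longrightarrow> w k = 0" for w
  proof (cases "h w \<le> h (\<lambda>_. 0)")
    case True
    have "w \<in> Q" using bounded[OF True] w by (simp add: Q_iff)
    then show ?thesis by (rule min)
  next
    case False
    then show ?thesis using min[OF Q0] by simp
  qed
  have u0: "u k = 0" if "k > d" for k using u[unfolded Q_iff, rule_format, of k] that by simp
  have "(\<Sum>i<n. a i * exp (pairing d B i u) * B i j) = (if j = d then 1 else 0)" if j: "j \<le> d" for j
  proof -
    have pj: "pairing d B i (u(j := u j + t)) = pairing d B i u + B i j * t" for i t
    proof -
      have "pairing d B i (u(j := u j + t)) = (\<Sum>k\<le>d. B i k * u k + (if k = j then B i k * t else 0))"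
        unfolding pairing_def by (intro sum.cong) (auto simp: algebra_simps)
      then show ?thesis using j by (simp add: sum.distrib pairing_def)
    qed
    define f where "f = (\<lambda>t. (\<Sum>i<n. a i * exp (pairing d B i u + B i j * t)) - (u d + (if j = d then t else 0)))"
    have f: "f t = h (u(j := u j + t))" for t unfolding f_def h_def pj by auto
    have "DERIV f 0 :> (\<Sum>i<n. a i * (exp (pairing d B i u) * B i j)) - (if j = d then 1 else 0)"
      unfolding f_def by (auto intro!: derivative_eq_intros sum.cong)
    then have "(\<Sum>i<n. a i * (exp (pairing d B i u) * B i j)) - (if j = d then 1 else 0) = 0"
    proof (rule DERIV_local_min[OF _ zero_less_one])
      show "\<forall>t. \<bar>0 - t\<bar> < 1 \<longrightarrow> f 0 \<le> f t"
        unfolding f using glob u0 j by simp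
    qed
    then show ?thesis by (simp add: mult.assoc)
  qed
  then show ?thesis unfolding balanced_def by blast
qed

text \<open>
  The quadratic form of the matrix is \<open>\<Sum>i<n. w\<^sub>i \<langle>B\<^sub>i, v\<rangle>\<^sup>2\<close>.
\<close>

lemma gram_positive:
  assumes "separating d B {i. i < n \<and> w i > 0}" "\<And>i. i < n \<Longrightarrow> w i \<ge> 0" "b \<le> d" "v b \<noteq> 0"
  shows "(\<Sum>b\<le>d. \<Sum>c\<le>d. v b * (\<Sum>i<n. w i * B i b * B i c) * v c) > 0"
proof -
  have expand: "(\<Sum>b\<le>d. \<Sum>c\<le>d. v b * (\<Sum>i<n. w i * B i b * B i c) * v c)
      = (\<Sum>i<n. w i * (pairing d B i v * pairing d B i v))"
  proof -
    have "(\<Sum>b\<le>d. \<Sum>c\<le>d. v b * (\<Sum>i<n. w i * B i b * B i c) * v c)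
        = (\<Sum>b\<le>d. \<Sum>i<n. \<Sum>c\<le>d. w i * ((B i b * v b) * (B i c * v c)))"
      unfolding sum_distrib_left sum_distrib_right
      by (intro sum.cong refl trans[OF sum.swap]) (simp add: mult_ac)
    also have "\<dots> = (\<Sum>i<n. \<Sum>b\<le>d. \<Sum>c\<le>d. w i * ((B i b * v b) * (B i c * v c)))"
      by (rule sum.swap)
    also have "\<dots> = (\<Sum>i<n. w i * (pairing d B i v * pairing d B i v))"
      by (simp only: pairing_def sum_distrib_left[symmetric] sum_distrib_right[symmetric])
    finally show ?thesis .
  qed
  obtain i where i: "i < n" "w i > 0" "pairing d B i v \<noteq> 0"
    using assms unfolding separating_def by blast
  have "(\<Sum>i<n. w i * (pairing d B i v * pairing d B i v)) > 0"
  proof (rule sum_pos2)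
    show "w i * (pairing d B i v * pairing d B i v) > 0"
      using i by (intro mult_pos_pos[OF i(2)]) (simp add: zero_less_mult_iff linorder_neq_iff disj_commute)
    show "w k * (pairing d B k v * pairing d B k v) \<ge> 0" if "k \<in> {..<n}" for k
      using that assms(2) by simp
  qed (use i in auto)
  then show ?thesis using expand by simp
qed

lemma gram_solve:
  fixes F :: "('y \<Rightarrow> real) \<Rightarrow> bool" and W :: "'y set"
  assumes cl: "\<And>f g. F f \<Longrightarrow> F g \<Longrightarrow> F (\<lambda>y. f y - g y)" "\<And>f g. F f \<Longrightarrow> F g \<Longrightarrow> F (\<lambda>y. f y * g y)"
      "\<And>f g. F f \<Longrightarrow> F g \<Longrightarrow> (\<And>y. y \<in> W \<Longrightarrow> g y \<noteq> 0) \<Longrightarrow> F (\<lambda>y. f y / g y)"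
    and H: "\<And>b c. b \<le> d \<Longrightarrow> c \<le> d \<Longrightarrow> F (\<lambda>y. \<Sum>i<n. w y i * B i b * B i c)"
    and r: "\<And>b. b \<le> d \<Longrightarrow> F (r b)"
    and sep: "\<And>y. y \<in> W \<Longrightarrow> separating d B {i. i < n \<and> w y i > 0}"
    and w: "\<And>y i. y \<in> W \<Longrightarrow> i < n \<Longrightarrow> w y i \<ge> 0"
  obtains x where "\<And>b. b \<le> d \<Longrightarrow> F (x b)"
    "\<And>y b. y \<in> W \<Longrightarrow> b \<le> d \<Longrightarrow> (\<Sum>c\<le>d. (\<Sum>i<n. w y i * B i b * B i c) * x c y) = r b y"
proof -
  have "\<exists>x. (\<forall>b\<in>{..d}. F (x b)) \<and>
    (\<forall>y\<in>W. \<forall>b\<in>{..d}. (\<Sum>c\<in>{..d}. (\<Sum>i<n. w y i * B i b * B i c) * x c y) = r b y)"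
  proof (rule pd_solve[where H = "\<lambda>b c y. \<Sum>i<n. w y i * B i b * B i c", OF cl])
    show "(\<Sum>b\<le>d. \<Sum>c\<le>d. v b * (\<Sum>i<n. w y i * B i b * B i c) * v c) > 0"
      if "y \<in> W" "b \<in> {..d}" "v b \<noteq> 0" for v y b
      using gram_positive[OF sep w, of y b v] that by simp
  qed (use H r in \<open>auto simp: mult_ac\<close>)
  then show thesis using that by auto
qed

lemma gram_unique:
  assumes "separating d B {i. i < n \<and> w i > 0}" "\<And>i. i < n \<Longrightarrow> w i \<ge> 0"
    and "\<And>b. b \<le> d \<Longrightarrow> (\<Sum>c\<le>d. (\<Sum>i<n. w i * B i b * B i c) * x c)
      = (\<Sum>c\<le>d. (\<Sum>i<n. w i * B i b * B i c) * y c)"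
    and "k \<le> d"
  shows "x k = y k"
proof (rule ccontr)
  assume "x k \<noteq> y k"
  define v where "v = (\<lambda>c. x c - y c)"
  have "(\<Sum>c\<le>d. v b * (\<Sum>i<n. w i * B i b * B i c) * v c) = 0" if "b \<le> d" for b
  proof -
    have lin: "(\<Sum>c\<le>d. s * G c * v c) = s * ((\<Sum>c\<le>d. G c * x c) - (\<Sum>c\<le>d. G c * y c))" for s G
    proof -
      have "s * ((\<Sum>c\<le>d. G c * x c) - (\<Sum>c\<le>d. G c * y c)) = s * (\<Sum>c\<le>d. G c * v c)"
        by (simp only: v_def right_diff_distrib sum_subtractf)
      then show ?thesis by (simp only: sum_distrib_left mult.assoc)
    qed
    show ?thesis unfolding lin using assms(3)[OF that] by simp
  qed
  then have "(\<Sum>b\<le>d. \<Sum>c\<le>d. v b * (\<Sum>i<n. w i * B i b * B i c) * v c) = 0" by simp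
  then show False using gram_positive[OF assms(1,2,4), of v] \<open>x k \<noteq> y k\<close> by (simp add: v_def)
qed


text \<open>
  The difference quotient of \<open>u\<close> solves a linear system exactly: write the increments of \<open>a\<^sub>i\<close> and of
  \<open>exp\<close> with their Caratheodory slopes.  The slopes of \<open>exp\<close> are positive, so the matrix is a
  Gram matrix for every \<open>t\<close>; it is continuous at \<open>0\<close>, hence so is the solution, whose value at
  \<open>0\<close> is the derivative \<open>X\<close>.
\<close>

lemma balanced_has_derivative:
  fixes a u :: "real \<Rightarrow> nat \<Rightarrow> real"
  assumes a0: "\<And>i. i < n \<Longrightarrow> a 0 i \<ge> 0" and sep: "separating d B {i. i < n \<and> a 0 i > 0}"
    and a': "\<And>i. i < n \<Longrightarrow> DERIV (\<lambda>t. a t i) 0 :> a' i"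
    and bal: "\<forall>\<^sub>F t in nhds 0. balanced n d B (a t) (u t)"
    and cont: "\<And>k. k \<le> d \<Longrightarrow> isCont (\<lambda>t. u t k) 0"
    and X: "\<And>b. b \<le> d \<Longrightarrow>
      (\<Sum>c\<le>d. (\<Sum>i<n. (a 0 i * exp (pairing d B i (u 0))) * B i b * B i c) * X c)
      = - (\<Sum>i<n. B i b * exp (pairing d B i (u 0)) * a' i)"
    and k: "k \<le> d"
  shows "DERIV (\<lambda>t. u t k) 0 :> X k"
proof -
  define g where "g = (\<lambda>t i. pairing d B i (u t))"
  have gcont: "isCont (\<lambda>t. g t i) 0" for i
    unfolding g_def pairing_def by (intro continuous_sum continuous_mult continuous_const cont) simp
  have "\<forall>i\<in>{..<n}. \<exists>q. (\<forall>t. a t i - a 0 i = q t * t) \<and> isCont q 0 \<and> q 0 = a' i"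
  proof
    fix i assume "i \<in> {..<n}"
    then have "DERIV (\<lambda>t. a t i) 0 :> a' i" using a' by simp
    then show "\<exists>q. (\<forall>t. a t i - a 0 i = q t * t) \<and> isCont q 0 \<and> q 0 = a' i"
      unfolding CARAT_DERIV by simp
  qed
  from bchoice[OF this] obtain q where "\<forall>i\<in>{..<n}. (\<forall>t. a t i - a 0 i = q i t * t) \<and> isCont (q i) 0 \<and> q i 0 = a' i" ..
  then have q: "\<And>i t. i < n \<Longrightarrow> a t i - a 0 i = q i t * t" "\<And>i. i < n \<Longrightarrow> isCont (q i) 0"
    "\<And>i. i < n \<Longrightarrow> q i 0 = a' i" by simp_all
  have "\<forall>x::real. \<exists>e. (\<forall>z. exp z - exp x = e z * (z - x)) \<and> isCont e x \<and> e x = exp x"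
    using DERIV_exp unfolding CARAT_DERIV ..
  from choice[OF this] obtain e :: "real \<Rightarrow> real \<Rightarrow> real"
    where "\<forall>x. (\<forall>z. exp z - exp x = e x z * (z - x)) \<and> isCont (e x) x \<and> e x x = exp x" ..
  then have e: "\<And>x z. exp z - exp x = e x z * (z - x)"
    "\<And>x. isCont (e x) x" "\<And>x. e x x = exp x" by simp_all
  have epos: "e x z > 0" for x z
  proof (cases "z = x")
    case False
    have "(exp z - exp x) / (z - x) > 0"
      using False by (cases "z < x") (auto simp: divide_neg_neg)
    then show ?thesis using e(1)[of z x] False by simp
  qed (simp add: e(3))
  define w where "w = (\<lambda>t i. a 0 i * e (g 0 i) (g t i))"
  have wcont: "isCont (\<lambda>t. w t i) 0" for i
    unfolding w_def by (intro continuous_mult continuous_const isCont_o2[OF gcont[of i], of "e (g 0 i)"] e(2))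
  define r where "r = (\<lambda>b t. - (\<Sum>i<n. B i b * exp (g t i) * q i t))"
  have rcont: "isCont (r b) 0" for b
    unfolding r_def
    by (intro continuous_minus continuous_sum continuous_mult continuous_const isCont_exp' gcont q(2)) simp
  have "w t i > 0 \<longleftrightarrow> a 0 i > 0" for t i
    unfolding w_def by (metis epos zero_less_mult_pos2 mult_pos_pos)
  then have wsep: "separating d B {i. i < n \<and> w t i > 0}" for t
    using sep by simp
  have wnn: "i < n \<Longrightarrow> w t i \<ge> 0" for t i
    using a0 epos by (simp add: w_def less_imp_le)
  obtain x where xc: "\<And>b. b \<le> d \<Longrightarrow> isCont (x b) 0"
    and x: "\<And>t b. t \<in> UNIV \<Longrightarrow> b \<le> d \<Longrightarrow> (\<Sum>c\<le>d. (\<Sum>i<n. w t i * B i b * B i c) * x c t) = r b t"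
  proof (rule gram_solve[where F = "\<lambda>f. isCont f 0" and W = UNIV and w = w and B = B and r = r and n = n and d = d,
        OF _ _ _ _ rcont wsep wnn])
    show "isCont (\<lambda>y. f y - g y) 0" if "isCont f 0" "isCont g 0" for f g :: "real \<Rightarrow> real"
      using that by (rule continuous_diff)
    show "isCont (\<lambda>y. f y * g y) 0" if "isCont f 0" "isCont g 0" for f g :: "real \<Rightarrow> real"
      using that by (rule continuous_mult)
    show "isCont (\<lambda>y. f y / g y) 0" if "isCont f 0" "isCont g 0" "\<And>y. y \<in> UNIV \<Longrightarrow> g y \<noteq> 0"
      for f g :: "real \<Rightarrow> real"
      using that by (intro isCont_divide) auto
    show "isCont (\<lambda>t. \<Sum>i<n. w t i * B i b * B i c) 0" for b c
      by (intro continuous_sum continuous_mult continuous_const wcont)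
    fix x
    assume "\<And>b. b \<le> d \<Longrightarrow> isCont (x b) 0"
      "\<And>t b. t \<in> UNIV \<Longrightarrow> b \<le> d \<Longrightarrow> (\<Sum>c\<le>d. (\<Sum>i<n. w t i * B i b * B i c) * x c t) = r b t"
    then show thesis by (rule that)
  qed
  have inc: "\<forall>\<^sub>F t in nhds 0. u t k - u 0 k = t * x k t"
    using bal
  proof eventually_elim
    case (elim t)
    have bal0: "balanced n d B (a 0) (u 0)" using bal by (rule eventually_nhds_x_imp_x)
    show ?case
    proof (rule gram_unique[OF wsep wnn _ k, where x = "\<lambda>k. u t k - u 0 k" and y = "\<lambda>k. t * x k t"])
      fix b assume b: "b \<le> d"
      have "(\<Sum>c\<le>d. (\<Sum>i<n. w t i * B i b * B i c) * (u t c - u 0 c))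
          = (\<Sum>i<n. w t i * B i b * (g t i - g 0 i))"
        unfolding g_def pairing_diff[symmetric] unfolding pairing_def sum_distrib_left sum_distrib_right
        by (subst sum.swap) (simp add: mult_ac)
      also have "\<dots> = (\<Sum>i<n. a 0 i * (exp (g t i) - exp (g 0 i)) * B i b)"
        by (intro sum.cong) (auto simp: w_def e(1))
      also have "\<dots> = (\<Sum>i<n. a t i * exp (g t i) * B i b - a 0 i * exp (g 0 i) * B i b
            - (a t i - a 0 i) * exp (g t i) * B i b)"
        by (simp add: algebra_simps)
      also have "\<dots> = - (\<Sum>i<n. (a t i - a 0 i) * exp (g t i) * B i b)"
        using elim bal0 b unfolding balanced_def sum_subtractf g_def by simp
      also have "\<dots> = t * r b t"
        by (simp add: r_def q(1) sum_distrib_left mult_ac)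
      also have "\<dots> = (\<Sum>c\<le>d. (\<Sum>i<n. w t i * B i b * B i c) * (t * x c t))"
        using x[OF UNIV_I b, of t] by (simp add: sum_distrib_left[symmetric] mult.left_commute[of _ t])
      finally show "(\<Sum>c\<le>d. (\<Sum>i<n. w t i * B i b * B i c) * (u t c - u 0 c))
          = (\<Sum>c\<le>d. (\<Sum>i<n. w t i * B i b * B i c) * (t * x c t))" .
    qed
  qed
  have "x k 0 = X k"
  proof (rule gram_unique[OF wsep[of 0] wnn _ k, where x = "\<lambda>k. x k 0" and y = X])
    show "(\<Sum>c\<le>d. (\<Sum>i<n. w 0 i * B i b * B i c) * x c 0) = (\<Sum>c\<le>d. (\<Sum>i<n. w 0 i * B i b * B i c) * X c)"
      if "b \<le> d" for b
      using x[OF UNIV_I that, of 0] X[OF that] q(3)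
      by (simp add: w_def e(3) g_def r_def)
  qed
  have "DERIV (\<lambda>t. u 0 k + t * x k t) 0 :> X k"
    unfolding CARAT_DERIV using xc[OF k] \<open>x k 0 = X k\<close> by (intro exI[of _ "x k"]) (auto simp: mult.commute)
  then show ?thesis
    by (rule DERIV_cong_ev[THEN iffD2, rotated -1]) (use inc in \<open>auto elim: eventually_mono\<close>)
qed

section \<open>Calculus of differentiable functions in coordinates\<close>

lemma continuous_on_line:
  fixes x :: "nat \<Rightarrow> 'a::euclidean_space"
  shows "continuous_on UNIV (\<lambda>t::real. x(i := x i + t *\<^sub>R b))"
proof (rule continuous_on_coordinatewise_then_product)
  show "continuous_on UNIV (\<lambda>t::real. (x(i := x i + t *\<^sub>R b)) k)" for k
    by (cases "k = i") (auto intro!: continuous_intros)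
qed

lemma line_stays_in:
  fixes x :: "nat \<Rightarrow> 'a::euclidean_space"
  assumes "open_in_space n W" "x \<in> W" "i < n"
  shows "\<forall>\<^sub>F t::real in nhds 0. x(i := x i + t *\<^sub>R b) \<in> W"
proof -
  obtain T where T: "open T" "W = coord_space n \<inter> T" using assms(1) unfolding openin_open by blast
  have "open ((\<lambda>t::real. x(i := x i + t *\<^sub>R b)) -` T)"
    using T(1) continuous_on_line by (rule open_vimage)
  moreover have "0 \<in> (\<lambda>t::real. x(i := x i + t *\<^sub>R b)) -` T" using assms(2) T(2) by simp
  ultimately have "\<forall>\<^sub>F t in nhds 0. t \<in> (\<lambda>t::real. x(i := x i + t *\<^sub>R b)) -` T"
    by (rule eventually_nhds_in_open)
  then show ?thesis
  proof (rule eventually_mono)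
    fix t :: real assume "t \<in> (\<lambda>t::real. x(i := x i + t *\<^sub>R b)) -` T"
    moreover have "x(i := x i + t *\<^sub>R b) \<in> coord_space n"
      using assms(2,3) T(2) by (auto simp: coord_space_def)
    ultimately show "x(i := x i + t *\<^sub>R b) \<in> W" using T(2) by simp
  qed
qed

lemma line_derivative_cong:
  fixes x :: "nat \<Rightarrow> 'a::euclidean_space"
  assumes "open_in_space n W" "x \<in> W" "i < n" "\<And>y. y \<in> W \<Longrightarrow> f y = g y"
  shows "((\<lambda>t::real. f (x(i := x i + t *\<^sub>R b))) has_vector_derivative D) (at 0) \<longleftrightarrow>
    ((\<lambda>t::real. g (x(i := x i + t *\<^sub>R b))) has_vector_derivative D) (at 0)"
  using line_stays_in[OF assms(1-3), of b] assms(2,4)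
  by (intro has_vector_derivative_cong_ev) (auto elim!: eventually_mono)

lemma Ck_on_SucD:
  assumes "Ck_on (Suc k) n W f"
  shows "continuous_on W f"
    and "i < n \<Longrightarrow> b \<in> Basis \<Longrightarrow> x \<in> W \<Longrightarrow>
      ((\<lambda>t. f (x(i := x i + t *\<^sub>R b))) has_vector_derivative partial i b f x) (at 0)"
    and "i < n \<Longrightarrow> b \<in> Basis \<Longrightarrow> Ck_on k n W (partial i b f)"
  using assms by (auto simp: partial_def simp flip: vector_derivative_works)

lemma Ck_on_cong:
  fixes f g :: "(nat \<Rightarrow> 'a::euclidean_space) \<Rightarrow> 'c::real_normed_vector"
  assumes W: "open_in_space n W" and "\<And>y. y \<in> W \<Longrightarrow> f y = g y" "Ck_on k n W f"
  shows "Ck_on k n W g"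
  using assms(2,3)
proof (induction k arbitrary: f g)
  case 0
  then show ?case by (simp cong: continuous_on_cong)
next
  case (Suc k)
  note D = Ck_on_SucD[OF Suc.prems(2)]
  have d: "((\<lambda>t. g (x(i := x i + t *\<^sub>R b))) has_vector_derivative partial i b f x) (at 0)"
    if "i < n" "b \<in> Basis" "x \<in> W" for i b x
    using line_derivative_cong[OF W that(3,1), where f = f and g = g and b = b] Suc.prems(1) D(2)[OF that]
    by blast
  have p: "partial i b g x = partial i b f x" if "i < n" "b \<in> Basis" "x \<in> W" for i b x
    using vector_derivative_at[OF d[OF that]] by (simp add: partial_def)
  have "continuous_on W g" using D(1) Suc.prems(1) by (simp cong: continuous_on_cong)
  moreover have "Ck_on k n W (partial i b g)" if "i < n" "b \<in> Basis" for i b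
    by (rule Suc.IH[OF _ D(3)[OF that]]) (use p that in auto)
  moreover have "(\<lambda>t. g (x(i := x i + t *\<^sub>R b))) differentiable (at 0)" if "i < n" "b \<in> Basis" "x \<in> W" for i b x
    using d[OF that] by (rule differentiableI_vector)
  ultimately show ?case by simp
qed

text \<open>
  The introduction rule for all that follows: any function \<open>D\<close> that is the derivative on the open
  set may replace \<open>partial\<close>.
\<close>

lemma Ck_on_SucI:
  fixes f :: "(nat \<Rightarrow> 'a::euclidean_space) \<Rightarrow> 'c::real_normed_vector"
  assumes W: "open_in_space n W" and f: "continuous_on W f"
    and D: "\<And>i b. i < n \<Longrightarrow> b \<in> Basis \<Longrightarrow> \<exists>D. Ck_on k n W D \<and>
      (\<forall>x\<in>W. ((\<lambda>t. f (x(i := x i + t *\<^sub>R b))) has_vector_derivative D x) (at 0))"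
  shows "Ck_on (Suc k) n W f"
proof -
  have "(\<forall>x\<in>W. (\<lambda>t. f (x(i := x i + t *\<^sub>R b))) differentiable (at 0)) \<and> Ck_on k n W (partial i b f)"
    if ib: "i < n" "b \<in> Basis" for i b
  proof -
    obtain D where D: "Ck_on k n W D"
      "\<And>x. x \<in> W \<Longrightarrow> ((\<lambda>t. f (x(i := x i + t *\<^sub>R b))) has_vector_derivative D x) (at 0)"
      using D[OF ib] by blast
    have "Ck_on k n W (partial i b f)"
      by (rule Ck_on_cong[OF W _ D(1)]) (simp add: partial_def vector_derivative_at[OF D(2)])
    then show ?thesis using D(2) differentiableI_vector by blast
  qed
  then show ?thesis using f by simp
qed

lemma Ck_on_Suc_imp:
  "Ck_on (Suc k) n W f \<Longrightarrow> Ck_on k n W f"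
  by (induction k arbitrary: f) auto

lemma Ck_on_imp_continuous: "Ck_on k n W f \<Longrightarrow> continuous_on W f"
  by (cases k) auto

context
  fixes n :: nat and W :: "(nat \<Rightarrow> 'a::euclidean_space) set"
  assumes W: "open_in_space n W"
begin

lemma Ck_on_const: "Ck_on k n W (\<lambda>_. c)"
proof (induction k arbitrary: c)
  case (Suc k)
  show ?case
    by (rule Ck_on_SucI[OF W]) (auto intro!: continuous_intros exI[of _ "\<lambda>_. 0"] Suc)
qed (auto intro: continuous_intros)

lemma Ck_on_coord: "Ck_on k n W (\<lambda>x. x j)"
proof -
  have c: "continuous_on W (\<lambda>x. x j)"
    by (rule continuous_on_subset[OF continuous_on_product_coordinates]) simp
  show ?thesis
  proof (cases k)
    case (Suc l)
    have "((\<lambda>t. (x(i := x i + t *\<^sub>R b)) j) has_vector_derivative (if i = j then b else 0)) (at 0)"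
      for i b and x :: "nat \<Rightarrow> 'a"
      by (cases "i = j") (auto intro!: derivative_eq_intros simp: has_vector_derivative_def)
    moreover have "Ck_on l n W (\<lambda>_. if i = j then b else 0)" for i and b :: 'a
      by (rule Ck_on_const)
    ultimately show ?thesis unfolding Suc by (intro Ck_on_SucI[OF W c]) blast
  qed (use c in simp)
qed

lemma Ck_on_add: "Ck_on k n W f \<Longrightarrow> Ck_on k n W g \<Longrightarrow> Ck_on k n W (\<lambda>x. f x + g x)"
proof (induction k arbitrary: f g)
  case (Suc k)
  note f = Ck_on_SucD[OF Suc.prems(1)] and g = Ck_on_SucD[OF Suc.prems(2)]
  show ?case
  proof (rule Ck_on_SucI[OF W])
    fix i and b :: 'a assume ib: "i < n" "b \<in> Basis"
    show "\<exists>D. Ck_on k n W D \<and> (\<forall>x\<in>W. ((\<lambda>t. f (x(i := x i + t *\<^sub>R b)) + g (x(i := x i + t *\<^sub>R b)))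
        has_vector_derivative D x) (at 0))"
      using Suc.IH[OF f(3)[OF ib] g(3)[OF ib]] has_vector_derivative_add[OF f(2)[OF ib] g(2)[OF ib]]
      by (intro exI[of _ "\<lambda>x. partial i b f x + partial i b g x"]) blast
  qed (use f(1) g(1) in \<open>intro continuous_intros\<close>)
qed (auto intro: continuous_intros)

lemma Ck_on_linear:
  assumes h: "bounded_linear h"
  shows "Ck_on k n W f \<Longrightarrow> Ck_on k n W (\<lambda>x. h (f x))"
proof (induction k arbitrary: f)
  case 0
  then show ?case by (auto intro: bounded_linear.continuous_on[OF h])
next
  case (Suc k)
  note f = Ck_on_SucD[OF Suc.prems(1)]
  show ?case
  proof (rule Ck_on_SucI[OF W])
    fix i and b :: 'a assume ib: "i < n" "b \<in> Basis"
    show "\<exists>D. Ck_on k n W D \<and> (\<forall>x\<in>W. ((\<lambda>t. h (f (x(i := x i + t *\<^sub>R b)))) has_vector_derivative D x) (at 0))"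
      using Suc.IH[OF f(3)[OF ib]] bounded_linear.has_vector_derivative[OF h f(2)[OF ib]]
      by (intro exI[of _ "\<lambda>x. h (partial i b f x)"]) blast
  qed (use f(1) in \<open>rule bounded_linear.continuous_on[OF h]\<close>)
qed

lemma Ck_on_mult:
  fixes f g :: "(nat \<Rightarrow> 'a) \<Rightarrow> 'c::real_normed_algebra"
  shows "Ck_on k n W f \<Longrightarrow> Ck_on k n W g \<Longrightarrow> Ck_on k n W (\<lambda>x. f x * g x)"
proof (induction k arbitrary: f g)
  case (Suc k)
  note f = Ck_on_SucD[OF Suc.prems(1)] and g = Ck_on_SucD[OF Suc.prems(2)]
  show ?case
  proof (rule Ck_on_SucI[OF W])
    fix i and b :: 'a assume ib: "i < n" "b \<in> Basis"
    have "Ck_on k n W (\<lambda>x. f x * partial i b g x + partial i b f x * g x)"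
      by (intro Ck_on_add Suc.IH f(3)[OF ib] g(3)[OF ib] Suc.prems[THEN Ck_on_Suc_imp])
    moreover have "((\<lambda>t. f (x(i := x i + t *\<^sub>R b)) * g (x(i := x i + t *\<^sub>R b)))
        has_vector_derivative f x * partial i b g x + partial i b f x * g x) (at 0)" if "x \<in> W" for x
    proof -
      define p where "p = (\<lambda>t. x(i := x i + t *\<^sub>R b))"
      have "((\<lambda>t. f (p t) * g (p t)) has_vector_derivative
          f (p 0) * partial i b g x + partial i b f x * g (p 0)) (at 0)"
        unfolding p_def by (rule has_vector_derivative_mult[OF f(2)[OF ib that] g(2)[OF ib that]])
      moreover have "p 0 = x" by (simp add: p_def)
      ultimately show ?thesis by (simp only: p_def)
    qed
    ultimately show "\<exists>D. Ck_on k n W D \<and> (\<forall>x\<in>W. ((\<lambda>t. f (x(i := x i + t *\<^sub>R b)) * g (x(i := x i + t *\<^sub>R b)))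
        has_vector_derivative D x) (at 0))" by blast
  qed (use f(1) g(1) in \<open>intro continuous_intros\<close>)
qed (auto intro: continuous_intros)

lemma Ck_on_minus: "Ck_on k n W f \<Longrightarrow> Ck_on k n W (\<lambda>x. - f x)"
  by (rule Ck_on_linear[OF bounded_linear_minus[OF bounded_linear_ident]])

lemma Ck_on_diff: "Ck_on k n W f \<Longrightarrow> Ck_on k n W g \<Longrightarrow> Ck_on k n W (\<lambda>x. f x - g x)"
  using Ck_on_add[OF _ Ck_on_minus, of k f g] by simp

lemma Ck_on_sum:
  "(\<And>i. i \<in> I \<Longrightarrow> Ck_on k n W (f i)) \<Longrightarrow> Ck_on k n W (\<lambda>x. \<Sum>i\<in>I. f i x)"
  by (induction I rule: infinite_finite_induct) (auto intro: Ck_on_add Ck_on_const)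

lemma Ck_on_chain:
  fixes f :: "(nat \<Rightarrow> 'a) \<Rightarrow> 'c::real_normed_field"
  assumes f: "Ck_on (Suc k) n W f" and h: "\<And>x. x \<in> W \<Longrightarrow> (h has_field_derivative h' (f x)) (at (f x))"
    and h': "Ck_on k n W (\<lambda>x. h' (f x))"
  shows "Ck_on (Suc k) n W (\<lambda>x. h (f x))"
proof (rule Ck_on_SucI[OF W])
  have "continuous_on (f ` W) h"
    using h by (auto intro!: continuous_at_imp_continuous_on DERIV_isCont)
  then show "continuous_on W (\<lambda>x. h (f x))"
    using Ck_on_imp_continuous[OF f] by (rule continuous_on_compose2) simp
  fix i and b :: 'a assume ib: "i < n" "b \<in> Basis"
  have "((\<lambda>t. h (f (x(i := x i + t *\<^sub>R b)))) has_vector_derivative partial i b f x * h' (f x)) (at 0)"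
    if "x \<in> W" for x
    using field_vector_diff_chain_at[OF Ck_on_SucD(2)[OF f ib that], of h "h' (f x)"] h[OF that]
    by (simp add: o_def)
  moreover have "Ck_on k n W (\<lambda>x. partial i b f x * h' (f x))"
    by (intro Ck_on_mult h' Ck_on_SucD(3)[OF f ib])
  ultimately show "\<exists>D. Ck_on k n W D \<and> (\<forall>x\<in>W. ((\<lambda>t. h (f (x(i := x i + t *\<^sub>R b)))) has_vector_derivative D x) (at 0))"
    by blast
qed

lemma Ck_on_exp:
  fixes f :: "(nat \<Rightarrow> 'a) \<Rightarrow> 'c::{real_normed_field,banach}"
  shows "Ck_on k n W f \<Longrightarrow> Ck_on k n W (\<lambda>x. exp (f x))"
proof (induction k)
  case (Suc k)
  have "Ck_on k n W (\<lambda>x. exp (f x))"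
    by (rule Suc.IH[OF Ck_on_Suc_imp[OF Suc.prems]])
  with Suc.prems DERIV_exp show ?case by (rule Ck_on_chain)
qed (auto intro: continuous_intros)

lemma Ck_on_inverse:
  fixes f :: "(nat \<Rightarrow> 'a) \<Rightarrow> 'c::real_normed_field"
  assumes "\<And>x. x \<in> W \<Longrightarrow> f x \<noteq> 0"
  shows "Ck_on k n W f \<Longrightarrow> Ck_on k n W (\<lambda>x. inverse (f x))"
proof (induction k)
  case (Suc k)
  have "Ck_on k n W (\<lambda>x. - (inverse (f x) * inverse (f x)))"
    by (intro Ck_on_minus Ck_on_mult Suc.IH Ck_on_Suc_imp[OF Suc.prems])
  moreover have "(inverse has_field_derivative - (inverse (f x) * inverse (f x))) (at (f x))" if "x \<in> W" for x
    using DERIV_inverse[OF assms[OF that], of UNIV] by (simp add: power2_eq_square)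
  ultimately show ?case by (intro Ck_on_chain[OF Suc.prems, where h' = "\<lambda>y. - (inverse y * inverse y)"])
qed (use assms in \<open>auto intro: continuous_intros\<close>)

lemma Ck_on_divide:
  fixes f :: "(nat \<Rightarrow> 'a) \<Rightarrow> 'c::real_normed_field"
  assumes "\<And>x. x \<in> W \<Longrightarrow> g x \<noteq> 0" "Ck_on k n W f" "Ck_on k n W g"
  shows "Ck_on k n W (\<lambda>x. f x / g x)"
  unfolding divide_inverse by (intro Ck_on_mult Ck_on_inverse assms)

lemma Ck_on_Ln:
  assumes "\<And>x. x \<in> W \<Longrightarrow> f x \<notin> \<real>\<^sub>\<le>\<^sub>0" "Ck_on k n W f"
  shows "Ck_on k n W (\<lambda>x. Ln (f x))"
proof (cases k)
  case 0
  then show ?thesis using assms by (auto intro!: continuous_intros)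
next
  case (Suc l)
  have f: "Ck_on (Suc l) n W f" using assms(2) Suc by simp
  have "f x \<noteq> 0" if "x \<in> W" for x using assms(1)[OF that] by auto
  then have "Ck_on l n W (\<lambda>x. inverse (f x))" using Ck_on_Suc_imp[OF f] by (rule Ck_on_inverse)
  with f has_field_derivative_Ln[OF assms(1)] show ?thesis unfolding Suc by (rule Ck_on_chain)
qed

text \<open>
  The vector that balances smooth weights is smooth.  By induction on \<open>k\<close>: its derivative along a
  coordinate solves the Gram system of the previous section, the coefficients of which involve
  \<open>u\<close> itself and are therefore of class \<open>C\<^sup>k\<close>.
\<close>

lemma Ck_on_balanced:
  fixes a u :: "(nat \<Rightarrow> 'a) \<Rightarrow> nat \<Rightarrow> real"
  assumes B: "\<And>i. i < r \<Longrightarrow> B i d = 1"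
    and a: "\<And>i k. i < r \<Longrightarrow> Ck_on k n W (\<lambda>y. a y i)" "\<And>i y. i < r \<Longrightarrow> y \<in> W \<Longrightarrow> a y i \<ge> 0"
    and sep: "\<And>y. y \<in> W \<Longrightarrow> separating d B {i. i < r \<and> a y i > 0}"
    and bal: "\<And>y. y \<in> W \<Longrightarrow> balanced r d B (a y) (u y)"
  shows "j \<le> d \<Longrightarrow> Ck_on k n W (\<lambda>y. u y j)"
proof -
  have cont: "continuous_on W (\<lambda>y. u y j)" if j: "j \<le> d" for j
    unfolding continuous_on_def
  proof
    fix y assume y: "y \<in> W"
    show "((\<lambda>z. u z j) \<longlongrightarrow> u y j) (at y within W)"
    proof (rule balanced_tendsto[OF B a(2)[OF _ y] bal[OF y] sep[OF y] _ _ j])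
      show "((\<lambda>z. a z i) \<longlongrightarrow> a y i) (at y within W)" if "i < r" for i
        using Ck_on_imp_continuous[OF a(1)[OF that, of 0]] y by (simp add: continuous_on_def)
      show "\<forall>\<^sub>F t in at y within W. (\<forall>i<r. 0 \<le> a t i) \<and> balanced r d B (a t) (u t)"
        unfolding eventually_at_topological using a(2) bal by blast
    qed
  qed
  show "Ck_on k n W (\<lambda>y. u y j)" if "j \<le> d" for j
    using that
  proof (induction k arbitrary: j)
    case 0
    then show ?case using cont by simp
  next
    case (Suc k)
    have Cexp: "Ck_on k n W (\<lambda>y. exp (pairing d B l (u y)))" for l
      unfolding pairing_def by (intro Ck_on_exp Ck_on_sum Ck_on_mult Ck_on_const Suc.IH) simp
    show ?case
    proof (rule Ck_on_SucI[OF W cont[OF Suc.prems]])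
      fix i and b :: 'a assume ib: "i < n" "b \<in> Basis"
      define w where "w = (\<lambda>y l. a y l * exp (pairing d B l (u y)))"
      define R where "R = (\<lambda>c y. - (\<Sum>l<r. B l c * exp (pairing d B l (u y)) * partial i b (\<lambda>y. a y l) y))"
      have wsep: "separating d B {l. l < r \<and> w y l > 0}" if "y \<in> W" for y
        using sep[OF that] by (simp add: w_def zero_less_mult_iff)
      have wnn: "w y l \<ge> 0" if "y \<in> W" "l < r" for y l
        using a(2) that by (simp add: w_def)
      obtain x where xc: "\<And>c. c \<le> d \<Longrightarrow> Ck_on k n W (x c)"
        and x: "\<And>y c. y \<in> W \<Longrightarrow> c \<le> d \<Longrightarrow> (\<Sum>e\<le>d. (\<Sum>l<r. w y l * B l c * B l e) * x e y) = R c y"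
      proof (rule gram_solve[where F = "Ck_on k n W" and W = W and w = w and B = B and r = R and n = r and d = d,
            OF Ck_on_diff Ck_on_mult Ck_on_divide _ _ wsep wnn])
        show "Ck_on k n W (\<lambda>y. \<Sum>l<r. w y l * B l c * B l e)" for c e
          unfolding w_def by (intro Ck_on_sum Ck_on_mult Ck_on_const Cexp a(1)) simp
        show "Ck_on k n W (R c)" for c
          unfolding R_def
          by (intro Ck_on_minus Ck_on_sum Ck_on_mult Ck_on_const Cexp Ck_on_SucD(3)[OF a(1) ib]) simp
        fix x
        assume "\<And>c. c \<le> d \<Longrightarrow> Ck_on k n W (x c)"
          "\<And>y c. y \<in> W \<Longrightarrow> c \<le> d \<Longrightarrow> (\<Sum>e\<le>d. (\<Sum>l<r. w y l * B l c * B l e) * x e y) = R c y"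
        then show thesis by (rule that)
      qed
      have "((\<lambda>t. u (y(i := y i + t *\<^sub>R b)) j) has_vector_derivative x j y) (at 0)" if y: "y \<in> W" for y
      proof -
        define p where "p = (\<lambda>t::real. y(i := y i + t *\<^sub>R b))"
        have p0: "p 0 = y" by (simp add: p_def)
        have pW: "\<forall>\<^sub>F t in nhds 0. p t \<in> W"
          unfolding p_def by (rule line_stays_in[OF W y ib(1)])
        have pc: "p \<midarrow>0\<rightarrow> y"
        proof -
          have "isCont p 0"
            using continuous_on_line[of y i b] by (simp add: continuous_on_eq_continuous_at p_def)
          then show ?thesis by (simp add: isCont_def p0)
        qed
        have "DERIV (\<lambda>t. u (p t) j) 0 :> x j y"
        proof (rule balanced_has_derivative[where a = "\<lambda>t. a (p t)" and n = r and B = B and d = d and X = "\<lambda>c. x c y"])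
          show "a (p 0) l \<ge> 0" if "l < r" for l using a(2)[OF that y] by (simp add: p0)
          show "separating d B {l. l < r \<and> a (p 0) l > 0}" using sep[OF y] by (simp add: p0)
          show "DERIV (\<lambda>t. a (p t) l) 0 :> partial i b (\<lambda>y. a y l) y" if "l < r" for l
            using Ck_on_SucD(2)[OF a(1)[OF that] ib y] unfolding p_def
            by (simp add: has_real_derivative_iff_has_vector_derivative)
          show "\<forall>\<^sub>F t in nhds 0. balanced r d B (a (p t)) (u (p t))"
            using pW bal by (auto elim: eventually_mono)
          show "isCont (\<lambda>t. u (p t) c) 0" if "c \<le> d" for c
          proof -
            have "((\<lambda>z. u z c) \<longlongrightarrow> u y c) (at y within W)"
              using cont[OF that] y by (simp add: continuous_on_def)
            then have "((\<lambda>z. u z c) \<longlongrightarrow> u y c) (inf (nhds y) (principal W))"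
              by (rule tendsto_at_within_iff_tendsto_nhds[of "\<lambda>z. u z c" y W, THEN iffD1])
            moreover have "filterlim p (inf (nhds y) (principal W)) (at 0)"
              unfolding filterlim_inf filterlim_principal using pc pW
              by (auto simp: eventually_at_filter elim: eventually_mono)
            ultimately have "((\<lambda>t. u (p t) c) \<longlongrightarrow> u y c) (at 0)"
              by (rule filterlim_compose)
            then show ?thesis by (simp add: isCont_def p0)
          qed
          show "(\<Sum>e\<le>d. (\<Sum>l<r. a (p 0) l * exp (pairing d B l (u (p 0))) * B l c * B l e) * x e y)
              = - (\<Sum>l<r. B l c * exp (pairing d B l (u (p 0))) * partial i b (\<lambda>y. a y l) y)" if "c \<le> d" for c
            using x[OF y that] by (simp add: p0 w_def R_def)
        qed fact
        then show ?thesis by (simp add: p_def has_real_derivative_iff_has_vector_derivative)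
      qed
      then show "\<exists>D. Ck_on k n W D \<and> (\<forall>y\<in>W. ((\<lambda>t. u (y(i := y i + t *\<^sub>R b)) j) has_vector_derivative D y) (at 0))"
        using xc[OF Suc.prems] by blast
    qed
  qed
qed

end

section \<open>Configurations over the real and the complex numbers\<close>

text \<open>
  The identification of \<open>\<complex>\<^sup>d\<close> with \<open>\<real>\<^sup>2\<^sup>d\<close>, for all \<open>d\<close> at once.
\<close>

definition realify :: "(nat \<Rightarrow> complex) \<Rightarrow> nat \<Rightarrow> real" where
  "realify w j = (if even j then Re (w (j div 2)) else Im (w (j div 2)))"

definition complexify :: "(nat \<Rightarrow> real) \<Rightarrow> nat \<Rightarrow> complex" where
  "complexify y l = Complex (y (2 * l)) (y (2 * l + 1))"

lemma realify_complexify [simp]: "realify (complexify y) = y"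
  by (rule ext) (auto simp: realify_def complexify_def elim: oddE)

lemma complexify_realify [simp]: "complexify (realify w) = w"
  by (rule ext) (simp add: realify_def complexify_def)

lemma complexify_coord_space [simp]: "complexify y \<in> coord_space d \<longleftrightarrow> y \<in> coord_space (2 * d)"
proof
  assume *: "complexify y \<in> coord_space d"
  show "y \<in> coord_space (2 * d)"
    unfolding coord_space_def
  proof (intro CollectI allI impI)
    fix i assume "2 * d \<le> i"
    then have "complexify y (i div 2) = 0" using * by (simp add: coord_space_def)
    then have "realify (complexify y) i = 0" by (simp only: realify_def) simp
    then show "y i = 0" by simp
  qed
next
  assume "y \<in> coord_space (2 * d)"
  then show "complexify y \<in> coord_space d"
    by (simp add: coord_space_def complexify_def complex_eq_iff)
qed

lemma realify_coord_space [simp]: "realify w \<in> coord_space (2 * d) \<longleftrightarrow> w \<in> coord_space d"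
  using complexify_coord_space[of "realify w" d] by simp

text \<open>
  The additional last entry \<open>1\<close> turns affine conditions on the vectors \<open>A\<^sub>i\<close> into linear ones.
\<close>

definition with_ones :: "nat \<Rightarrow> (nat \<Rightarrow> nat \<Rightarrow> 'a::one) \<Rightarrow> nat \<Rightarrow> nat \<Rightarrow> 'a" where
  "with_ones d A i j = (if j < d then A i j else 1)"

lemma sum_pairs: "(\<Sum>j<2 * m. f j) = (\<Sum>j<m. f (2 * j) + f (2 * j + 1 :: nat) :: real)"
  by (induction m) (simp_all add: algebra_simps)

lemma sum_with_ones: "(\<Sum>j\<le>d. with_ones d A i j * x j) = (\<Sum>j<d. A i j * x j) + (x d :: 'a::comm_semiring_1)"
  by (simp add: with_ones_def lessThan_Suc_atMost[symmetric])

text \<open>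
  The real parts of the exponents of the action are real linear forms: the conjugation makes up
  for the sign in the real part of a product.
\<close>

lemma pairing_realify:
  "pairing (2 * m) (with_ones (2 * m) (\<lambda>i. realify (\<Lambda> i))) i u
     = Re (\<Sum>j\<le>m. with_ones m \<Lambda> i j * cnj (complexify u j))"
  unfolding pairing_def sum_with_ones sum_pairs
  by (simp add: realify_def complexify_def)

text \<open>
  Coefficients of zero as a convex combination; for \<open>B = with_ones d A\<close> the equation for \<open>j = d\<close>
  says that they sum to \<open>1\<close>.
\<close>

definition conv_zero :: "nat \<Rightarrow> (nat \<Rightarrow> nat \<Rightarrow> real) \<Rightarrow> nat set \<Rightarrow> (nat \<Rightarrow> real) \<Rightarrow> bool" where
  "conv_zero d B I c \<longleftrightarrow> (\<forall>i\<in>I. c i \<ge> 0) \<and> (\<forall>j\<le>d. (\<Sum>i\<in>I. c i * B i j) = (if j = d then 1 else 0))"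

lemma conv_zero_with_ones:
  "conv_zero d (with_ones d A) I c \<longleftrightarrow> (\<forall>i\<in>I. c i \<ge> 0) \<and> sum c I = 1 \<and> (\<forall>j<d. (\<Sum>i\<in>I. c i * A i j) = 0)"
proof -
  have "(\<forall>j\<le>d. (\<Sum>i\<in>I. c i * with_ones d A i j) = (if j = d then 1 else 0)) \<longleftrightarrow>
      (\<Sum>i\<in>I. c i * with_ones d A i d) = 1 \<and> (\<forall>j<d. (\<Sum>i\<in>I. c i * with_ones d A i j) = 0)"
    by (auto simp: le_less)
  then show ?thesis unfolding conv_zero_def by (simp add: with_ones_def)
qed

lemma zero_in_conv_realify:
  "zero_in_conv m \<Lambda> I \<longleftrightarrow> (\<exists>c. conv_zero (2 * m) (with_ones (2 * m) (\<lambda>i. realify (\<Lambda> i))) I c)"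
proof -
  have "(\<forall>j<2 * m. (\<Sum>i\<in>I. c i * realify (\<Lambda> i) j) = 0) \<longleftrightarrow> (\<forall>j<m. (\<Sum>i\<in>I. c i *\<^sub>R \<Lambda> i j) = 0)" for c
  proof
    assume *: "\<forall>j<2 * m. (\<Sum>i\<in>I. c i * realify (\<Lambda> i) j) = 0"
    show "\<forall>j<m. (\<Sum>i\<in>I. c i *\<^sub>R \<Lambda> i j) = 0"
    proof (intro allI impI)
      fix j assume "j < m"
      then show "(\<Sum>i\<in>I. c i *\<^sub>R \<Lambda> i j) = 0"
        using *[rule_format, of "2 * j"] *[rule_format, of "2 * j + 1"]
        by (simp add: realify_def complex_eq_iff)
    qed
  next
    assume *: "\<forall>j<m. (\<Sum>i\<in>I. c i *\<^sub>R \<Lambda> i j) = 0"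
    show "\<forall>j<2 * m. (\<Sum>i\<in>I. c i * realify (\<Lambda> i) j) = 0"
    proof (intro allI impI)
      fix j assume "j < 2 * m"
      then have "(\<Sum>i\<in>I. c i *\<^sub>R \<Lambda> i (j div 2)) = 0" using * by auto
      then show "(\<Sum>i\<in>I. c i * realify (\<Lambda> i) j) = 0"
        by (cases "even j") (simp_all add: realify_def complex_eq_iff)
    qed
  qed
  then show ?thesis unfolding zero_in_conv_def conv_zero_with_ones by simp
qed

text \<open>
  Caratheodory's argument.  In a smallest index set \<open>I\<close> that carries a combination, all
  coefficients are positive and the vectors \<open>B\<^sub>i\<close> are independent, because moving along a relation until
  the first coefficient vanishes would give a smaller set.  There are more than \<open>d\<close> of them,
  hence they span.
\<close>

lemma conv_zero_separating_support:
  assumes ones: "\<And>i. i < n \<Longrightarrow> B i d = 1"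
    and hyp: "\<And>I c. I \<subseteq> {..<n} \<Longrightarrow> conv_zero d B I c \<Longrightarrow> card I > d"
    and J: "J \<subseteq> {..<n}" "conv_zero d B J c0"
  obtains I c where "I \<subseteq> J" "conv_zero d B I c" "\<And>i. i \<in> I \<Longrightarrow> c i > 0" "separating d B I"
proof -
  obtain I where I: "I \<subseteq> J" "\<exists>c. conv_zero d B I c"
    and min: "\<And>I'. I' \<subseteq> J \<Longrightarrow> \<exists>c. conv_zero d B I' c \<Longrightarrow> card I \<le> card I'"
    using ex_has_least_nat[of "\<lambda>I. I \<subseteq> J \<and> (\<exists>c. conv_zero d B I c)" J card] J(2) by blast
  obtain c where c: "conv_zero d B I c" using I(2) ..
  have In: "I \<subseteq> {..<n}" using I(1) J(1) by blast
  then have fI: "finite I" using finite_subset by blast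
  have drop: False if "i \<in> I" "conv_zero d B I c'" "c' i = 0" for i c'
  proof -
    have "(\<Sum>l\<in>I - {i}. c' l * B l j) = (\<Sum>l\<in>I. c' l * B l j)" for j
      using that(3) by (intro sum.mono_neutral_left[OF fI]) auto
    then have "conv_zero d B (I - {i}) c'" using that(2) by (simp add: conv_zero_def)
    then have "card I \<le> card (I - {i})" using min[of "I - {i}"] I(1) by blast
    then show False using that(1) fI by (metis card_Diff1_less linorder_not_less)
  qed
  have pos: "c i > 0" if "i \<in> I" for i
    using drop[OF that c] c that unfolding conv_zero_def by (metis order_less_le)
  have indep: "\<mu> i = 0" if rel: "\<And>j. j \<le> d \<Longrightarrow> (\<Sum>i\<in>I. B i j * \<mu> i) = 0" and i: "i \<in> I" for \<mu> i
  proof (rule ccontr)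
    assume nz: "\<mu> i \<noteq> 0"
    have s0: "(\<Sum>i\<in>I. \<mu> i) = 0"
      using rel[of d] ones In by (simp add: subset_iff cong: sum.cong)
    have "\<exists>k\<in>I. \<mu> k > 0"
    proof (rule ccontr)
      assume "\<not> ?thesis"
      then have "\<forall>k\<in>I. - \<mu> k \<ge> 0" by force
      then have "\<forall>k\<in>I. - \<mu> k = 0"
        using s0 sum_nonneg_eq_0_iff[OF fI, of "\<lambda>k. - \<mu> k"] by (simp add: sum_negf)
      then show False using i nz by simp
    qed
    define P where "P = {k\<in>I. \<mu> k > 0}"
    have P: "finite P" "P \<noteq> {}" using fI \<open>\<exists>k\<in>I. \<mu> k > 0\<close> by (auto simp: P_def)
    define t where "t = Min ((\<lambda>k. c k / \<mu> k) ` P)"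
    have "t \<in> (\<lambda>k. c k / \<mu> k) ` P" unfolding t_def using P by (intro Min_in) auto
    then obtain k where k: "k \<in> I" "\<mu> k > 0" "t = c k / \<mu> k" by (auto simp: P_def)
    have "t > 0" using k pos by simp
    have "c l - t * \<mu> l \<ge> 0" if l: "l \<in> I" for l
    proof (cases "\<mu> l > 0")
      case True
      then have "t \<le> c l / \<mu> l" unfolding t_def using P l by (intro Min_le) (auto simp: P_def)
      then show ?thesis using True by (simp add: field_simps)
    next
      case False
      then have "t * \<mu> l \<le> 0" using \<open>t > 0\<close> by (simp add: mult_le_0_iff)
      then show ?thesis using pos[OF l] by linarith
    qed
    moreover have "(\<Sum>l\<in>I. (c l - t * \<mu> l) * B l j) = (if j = d then 1 else 0)" if "j \<le> d" for j
    proof -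
      have "(\<Sum>l\<in>I. (c l - t * \<mu> l) * B l j) = (\<Sum>l\<in>I. c l * B l j) - t * (\<Sum>l\<in>I. B l j * \<mu> l)"
        unfolding sum_distrib_left sum_subtractf[symmetric] by (intro sum.cong) (simp_all add: algebra_simps)
      then show ?thesis using rel[OF that] c that by (simp add: conv_zero_def)
    qed
    ultimately have "conv_zero d B I (\<lambda>l. c l - t * \<mu> l)" by (simp add: conv_zero_def)
    then show False by (rule drop[OF k(1)]) (use k in simp)
  qed
  have ker: "\<mu> i = 0" if "\<And>j. j \<in> {..d} \<Longrightarrow> (\<Sum>i\<in>I. B i j * \<mu> i) = 0" "i \<in> I" for \<mu> i
    using indep that by simp
  have "separating d B I"
  proof (rule dual_basis[OF finite_atMost[of d] fI, of "\<lambda>j i. B i j"])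
    fix D v
    assume D: "D \<subseteq> {..d}" "card D = card I"
      and v: "\<And>j k. j \<in> D \<Longrightarrow> k \<in> D \<Longrightarrow> (\<Sum>i\<in>I. B i j * v k i) = (if j = k then 1 else 0)"
    have "card I > d" using hyp[OF In c] .
    then have D_eq: "D = {..d}" using D card_mono[OF _ D(1)] by (intro card_subset_eq) auto
    show "separating d B I"
      unfolding separating_def
    proof (intro allI impI)
      fix u k assume u: "\<forall>i\<in>I. pairing d B i u = 0" and k: "k \<le> d"
      have "0 = (\<Sum>i\<in>I. v k i * pairing d B i u)" using u by simp
      also have "\<dots> = (\<Sum>j\<le>d. u j * (\<Sum>i\<in>I. B i j * v k i))"
        unfolding pairing_def sum_distrib_left by (subst sum.swap) (simp add: mult_ac)
      also have "\<dots> = (\<Sum>j\<le>d. u j * (if j = k then 1 else 0))"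
        using v k by (intro sum.cong) (auto simp: D_eq)
      also have "\<dots> = u k" using k by (simp add: if_distrib cong: if_cong)
      finally show "u k = 0" by simp
    qed
  qed (use ker in blast)
  then show thesis using that I(1) c pos by blast
qed

section \<open>The action and its orbits\<close>

definition support :: "nat \<Rightarrow> (nat \<Rightarrow> complex) \<Rightarrow> nat set" where
  "support n z = {i. i < n \<and> z i \<noteq> 0}"

lemma finite_support [simp]: "finite (support n z)" by (simp add: support_def)

lemma cone_V_iff: "z \<in> cone_V n m \<Lambda> \<longleftrightarrow> z \<in> coord_space n \<and> zero_in_conv m \<Lambda> (support n z)"
  by (simp add: cone_V_def support_def)

lemma zero_in_conv_mono:
  assumes "zero_in_conv m \<Lambda> I" "I \<subseteq> J" "finite J"
  shows "zero_in_conv m \<Lambda> J"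
proof -
  obtain c where c: "\<forall>i\<in>I. 0 \<le> c i" "sum c I = 1" "\<And>j. j < m \<Longrightarrow> (\<Sum>i\<in>I. c i *\<^sub>R \<Lambda> i j) = 0"
    using assms(1) unfolding zero_in_conv_def by blast
  define c' where "c' = (\<lambda>i. if i \<in> I then c i else 0)"
  have "sum c' J = sum c I"
    unfolding c'_def using assms(2,3) by (simp add: sum.If_cases inf.absorb2)
  moreover have "(\<Sum>i\<in>J. c' i *\<^sub>R \<Lambda> i j) = (\<Sum>i\<in>I. c i *\<^sub>R \<Lambda> i j)" for j
    using assms(2,3) by (intro sum.mono_neutral_cong_right) (auto simp: c'_def)
  ultimately show ?thesis
    unfolding zero_in_conv_def using c by (intro exI[of _ c']) (auto simp: c'_def)
qed

lemma cone_V_mono: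
  assumes "z \<in> cone_V n m \<Lambda>" "w \<in> coord_space n" "support n z \<subseteq> support n w"
  shows "w \<in> cone_V n m \<Lambda>"
  using assms zero_in_conv_mono unfolding cone_V_iff by (metis finite_support)

lemma open_in_space_cone_V: "open_in_space n (cone_V n m \<Lambda>)"
proof (subst openin_subopen, intro ballI)
  fix z assume z: "z \<in> cone_V n m \<Lambda>"
  define T where "T = (\<Inter>i\<in>support n z. {w::nat \<Rightarrow> complex. w i \<noteq> 0})"
  have "open {w::nat \<Rightarrow> complex. w i \<noteq> 0}" for i
  proof -
    have "open ((\<lambda>w::nat \<Rightarrow> complex. w i) -` (- {0}))"
      by (intro open_vimage continuous_on_product_coordinates) auto
    then show ?thesis by (simp add: vimage_def)
  qed
  then have "open T" unfolding T_def by (intro open_INT) auto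
  moreover have "coord_space n \<inter> T \<subseteq> cone_V n m \<Lambda>"
    using cone_V_mono[OF z] by (auto simp: T_def support_def)
  moreover have "z \<in> coord_space n \<inter> T"
    using z by (auto simp: T_def support_def cone_V_iff)
  ultimately show "\<exists>T. open_in_space n T \<and> z \<in> T \<and> T \<subseteq> cone_V n m \<Lambda>"
    using openin_open_Int by blast
qed

text \<open>
  The parameter \<open>T\<^sub>m\<close> acts by the homothety \<open>exp T\<^sub>m\<close>, the others along the foliation.  The orbits
  in \<open>\<complex>\<^sup>n\<close> are therefore the cones over the leaves in projective space.
\<close>

definition act :: "nat \<Rightarrow> (nat \<Rightarrow> nat \<Rightarrow> complex) \<Rightarrow> (nat \<Rightarrow> complex) \<Rightarrow> (nat \<Rightarrow> complex) \<Rightarrow> (nat \<Rightarrow> complex)" where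
  "act m \<Lambda> T z = (\<lambda>i. exp (\<Sum>j\<le>m. with_ones m \<Lambda> i j * T j) * z i)"

definition same_orbit :: "nat \<Rightarrow> (nat \<Rightarrow> nat \<Rightarrow> complex) \<Rightarrow> (nat \<Rightarrow> complex) \<Rightarrow> (nat \<Rightarrow> complex) \<Rightarrow> bool" where
  "same_orbit m \<Lambda> z w \<longleftrightarrow> (\<exists>T. w = act m \<Lambda> T z)"

lemma act_zero [simp]: "act m \<Lambda> (\<lambda>_. 0) z = z" by (simp add: act_def)

lemma act_act: "act m \<Lambda> S (act m \<Lambda> T z) = act m \<Lambda> (\<lambda>j. S j + T j) z"
  by (simp add: act_def distrib_left sum.distrib exp_add mult.assoc)

lemma same_orbit_act: "same_orbit m \<Lambda> z (act m \<Lambda> T z)" unfolding same_orbit_def by blast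

lemma same_orbit_refl: "same_orbit m \<Lambda> z z" using same_orbit_act[of m \<Lambda> z "\<lambda>_. 0"] by simp

lemma same_orbit_sym: "same_orbit m \<Lambda> z w \<Longrightarrow> same_orbit m \<Lambda> w z"
proof -
  assume "same_orbit m \<Lambda> z w"
  then obtain T where "w = act m \<Lambda> T z" unfolding same_orbit_def ..
  then have "z = act m \<Lambda> (\<lambda>j. - T j) w" by (simp add: act_act)
  then show ?thesis unfolding same_orbit_def by (intro exI[of _ "\<lambda>j. - T j"])
qed

lemma same_orbit_trans: "same_orbit m \<Lambda> z w \<Longrightarrow> same_orbit m \<Lambda> w x \<Longrightarrow> same_orbit m \<Lambda> z x"
  unfolding same_orbit_def by (metis act_act)

lemma support_act [simp]: "support n (act m \<Lambda> T z) = support n z"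
  by (simp add: support_def act_def)

lemma act_coord_space: "z \<in> coord_space n \<Longrightarrow> act m \<Lambda> T z \<in> coord_space n"
  by (simp add: act_def coord_space_def)

lemma norm_act: "(norm (act m \<Lambda> T z i))\<^sup>2
    = (norm (z i))\<^sup>2 * exp (pairing (2 * m) (with_ones (2 * m) (\<lambda>i. realify (\<Lambda> i))) i
        (\<lambda>k. 2 * realify (\<lambda>j. cnj (T j)) k))"
proof -
  have "cnj (complexify (realify (\<lambda>j. cnj (T j))) j) = T j" for j by simp
  then have "pairing (2 * m) (with_ones (2 * m) (\<lambda>i. realify (\<Lambda> i))) i (realify (\<lambda>j. cnj (T j)))
      = Re (\<Sum>j\<le>m. with_ones m \<Lambda> i j * T j)"
    unfolding pairing_realify by simp
  then show ?thesis
    by (simp add: act_def norm_mult pairing_scale power_mult_distrib exp_double mult.commute)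
qed

locale lvm =
  fixes n m :: nat and \<Lambda> :: "nat \<Rightarrow> nat \<Rightarrow> complex"
  assumes hyperbolic: "weakly_hyperbolic n m \<Lambda>"
begin

abbreviation "V \<equiv> cone_V n m \<Lambda>"

abbreviation "B \<equiv> with_ones (2 * m) (\<lambda>i. realify (\<Lambda> i))"

lemma B_last [simp]: "B i (2 * m) = 1" by (simp add: with_ones_def)

text \<open>
  At a point of \<open>V\<close> weak hyperbolicity gives coordinates, all nonzero, at which the configuration is
  affinely spanning.  Existence of the link point, freeness of the action and the charts all rest
  on them.
\<close>

lemma cone_V_support:
  assumes "z \<in> V"
  obtains I c where "I \<subseteq> support n z" "conv_zero (2 * m) B I c" "\<And>i. i \<in> I \<Longrightarrow> c i > 0" "separating (2 * m) B I"
proof -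
  obtain c where "conv_zero (2 * m) B (support n z) c"
    using assms unfolding cone_V_iff zero_in_conv_realify by blast
  then show thesis
  proof (rule conv_zero_separating_support[rotated 3])
    show "card I > 2 * m" if "I \<subseteq> {..<n}" "conv_zero (2 * m) B I c" for I c
      using hyperbolic that unfolding weakly_hyperbolic_def zero_in_conv_realify by blast
  qed (use that in \<open>auto simp: support_def\<close>)
qed

lemma separating_support:
  assumes "z \<in> V" shows "separating (2 * m) B (support n z)"
  using cone_V_support[OF assms] separating_mono by metis

lemma positive_support: "{i. i < n \<and> (norm (z i))\<^sup>2 > 0} = support n z"
  by (auto simp: support_def)

lemma balanced_solution:
  assumes "z \<in> V"
  shows "\<exists>u. balanced n (2 * m) B (\<lambda>i. (norm (z i))\<^sup>2) u"
proof -
  obtain I c where "I \<subseteq> support n z" "conv_zero (2 * m) B I c" "\<And>i. i \<in> I \<Longrightarrow> c i > 0" "separating (2 * m) B I"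
    using cone_V_support[OF assms] by blast
  then show ?thesis
    by (intro balanced_exists[where I = I and c = c])
       (auto simp: conv_zero_def positive_support, auto simp: support_def)
qed

text \<open>
  Only the coordinates up to \<open>2 m\<close> of a balancing vector are determined; the others are set to
  \<open>0\<close>, so that every coordinate depends smoothly on \<open>z\<close>.
\<close>

definition potential :: "(nat \<Rightarrow> complex) \<Rightarrow> nat \<Rightarrow> real" where
  "potential z k = (if k \<le> 2 * m then (SOME u. balanced n (2 * m) B (\<lambda>i. (norm (z i))\<^sup>2) u) k else 0)"

lemma balanced_potential: "z \<in> V \<Longrightarrow> balanced n (2 * m) B (\<lambda>i. (norm (z i))\<^sup>2) (potential z)"
proof -
  assume "z \<in> V"
  then have "balanced n (2 * m) B (\<lambda>i. (norm (z i))\<^sup>2) (SOME u. balanced n (2 * m) B (\<lambda>i. (norm (z i))\<^sup>2) u)"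
    by (rule someI_ex[OF balanced_solution])
  moreover have "pairing (2 * m) B i (potential z)
      = pairing (2 * m) B i (SOME u. balanced n (2 * m) B (\<lambda>i. (norm (z i))\<^sup>2) u)" for i
    unfolding pairing_def by (intro sum.cong) (auto simp: potential_def)
  ultimately show ?thesis by (simp add: balanced_def)
qed

text \<open>
  The retraction of \<open>V\<close> onto the link along the orbits.  The weights of the link are \<open>\<bar>z\<^sub>i\<bar>\<^sup>2\<close>, whence
  the factor \<open>1 / 2\<close>.
\<close>

definition to_link :: "(nat \<Rightarrow> complex) \<Rightarrow> nat \<Rightarrow> complex" where
  "to_link z = act m \<Lambda> (\<lambda>j. cnj (complexify (\<lambda>k. potential z k / 2) j)) z"

lemma to_link_same_orbit: "same_orbit m \<Lambda> z (to_link z)"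
  unfolding to_link_def by (rule same_orbit_act)

lemma link_set_iff:
  "z \<in> link_set n (2 * m) (\<lambda>i. realify (\<Lambda> i)) \<longleftrightarrow> z \<in> coord_space n \<and>
     balanced n (2 * m) B (\<lambda>i. (norm (z i))\<^sup>2) (\<lambda>_. 0)"
proof -
  have "(\<forall>j\<le>2 * m. (\<Sum>i<n. (norm (z i))\<^sup>2 * B i j) = (if j = 2 * m then 1 else 0)) \<longleftrightarrow>
     (\<Sum>i<n. (norm (z i))\<^sup>2 * B i (2 * m)) = 1 \<and> (\<forall>j<2 * m. (\<Sum>i<n. (norm (z i))\<^sup>2 * B i j) = 0)"
    by (auto simp: le_less)
  then show ?thesis
    unfolding link_set_def balanced_def by (auto simp: with_ones_def mult.commute)
qed

lemma to_link: "z \<in> V \<Longrightarrow> to_link z \<in> link_set n (2 * m) (\<lambda>i. realify (\<Lambda> i))"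
proof -
  assume z: "z \<in> V"
  have "(norm (to_link z i))\<^sup>2 = (norm (z i))\<^sup>2 * exp (pairing (2 * m) B i (potential z))" for i
    unfolding to_link_def norm_act by simp
  then show ?thesis
    using balanced_potential[OF z] z
    unfolding link_set_iff by (auto simp: balanced_def to_link_def cone_V_iff intro: act_coord_space)
qed

lemma balanced_in_cone_V: "z \<in> coord_space n \<Longrightarrow> balanced n (2 * m) B (\<lambda>i. (norm (z i))\<^sup>2) u \<Longrightarrow> z \<in> V"
proof -
  assume z: "z \<in> coord_space n" and bal: "balanced n (2 * m) B (\<lambda>i. (norm (z i))\<^sup>2) u"
  define c where "c = (\<lambda>i. (norm (z i))\<^sup>2 * exp (pairing (2 * m) B i u))"
  have "(\<Sum>i\<in>support n z. c i * B i j) = (\<Sum>i<n. c i * B i j)" for j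
    by (rule sum.mono_neutral_left) (auto simp: support_def c_def)
  then have "conv_zero (2 * m) B (support n z) c"
    using bal by (auto simp: conv_zero_def balanced_def c_def)
  then show ?thesis using z unfolding cone_V_iff zero_in_conv_realify by blast
qed

text \<open>
  Two points of an orbit that are balanced by the same \<open>u\<close> differ by a factor of modulus one:
  besides \<open>u\<close>, also \<open>u\<close> plus twice the real form of \<open>T\<close> balances \<open>z\<close>, and balancing vectors are
  unique.  For \<open>u = 0\<close> the points lie on the link itself; other \<open>u\<close> serve for rescaled links.
\<close>

lemma act_between_balanced:
  assumes z: "z \<in> coord_space n" "balanced n (2 * m) B (\<lambda>i. (norm (z i))\<^sup>2) u"
    and w: "balanced n (2 * m) B (\<lambda>i. (norm (act m \<Lambda> T z i))\<^sup>2) u"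
  shows "j < m \<Longrightarrow> T j = 0" "Re (T m) = 0"
proof -
  define v where "v = (\<lambda>k. 2 * realify (\<lambda>j. cnj (T j)) k)"
  have "pairing (2 * m) B i (\<lambda>k. v k + u k) = pairing (2 * m) B i v + pairing (2 * m) B i u" for i
    by (simp add: pairing_def distrib_left sum.distrib)
  then have "balanced n (2 * m) B (\<lambda>i. (norm (z i))\<^sup>2) (\<lambda>k. v k + u k)"
    using w unfolding norm_act v_def[symmetric] by (simp add: balanced_def exp_add mult_ac)
  note bal = this
  have *: "v k + u k = u k" if "k \<le> 2 * m" for k
  proof (rule balanced_unique[OF _ _ z(2) bal])
    show "separating (2 * m) B {i. i < n \<and> (norm (z i))\<^sup>2 > 0}"
      unfolding positive_support using balanced_in_cone_V[OF z] by (rule separating_support)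
  qed (use that in auto)
  have v0: "v k = 0" if "k \<le> 2 * m" for k using *[OF that] by simp
  show "T j = 0" if "j < m"
    using v0[of "2 * j"] v0[of "2 * j + 1"] that
    by (simp add: v_def realify_def complex_eq_iff)
  show "Re (T m) = 0" using v0[of "2 * m"] by (simp add: v_def realify_def)
qed

lemma Ck_on_to_link:
  fixes z :: "(nat \<Rightarrow> 'a::euclidean_space) \<Rightarrow> nat \<Rightarrow> complex"
  assumes W: "open_in_space N W" and z: "\<And>i k. Ck_on k N W (\<lambda>y. z y i)" and V: "\<And>y. y \<in> W \<Longrightarrow> z y \<in> V"
  shows "Ck_on k N W (\<lambda>y. to_link (z y) i)"
proof -
  have nrm: "Ck_on k N W (\<lambda>y. (norm (z y i))\<^sup>2)" for i k
  proof -
    have "Ck_on k N W (\<lambda>y. Re (z y i) * Re (z y i) + Im (z y i) * Im (z y i))"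
      by (intro Ck_on_add Ck_on_mult Ck_on_linear[OF W bounded_linear_Re] Ck_on_linear[OF W bounded_linear_Im] z W)
    then show ?thesis unfolding cmod_power2 by (simp only: power2_eq_square)
  qed
  have u: "Ck_on k N W (\<lambda>y. potential (z y) j)" if "j \<le> 2 * m" for j
  proof (rule Ck_on_balanced[OF W, where a = "\<lambda>y i. (norm (z y i))\<^sup>2" and r = n and B = B and d = "2 * m"])
    show "separating (2 * m) B {i. i < n \<and> (norm (z y i))\<^sup>2 > 0}" if "y \<in> W" for y
      unfolding positive_support using V[OF that] by (rule separating_support)
    show "balanced n (2 * m) B (\<lambda>i. (norm (z y i))\<^sup>2) (potential (z y))" if "y \<in> W" for y
      using V[OF that] by (rule balanced_potential)
  qed (use that nrm in auto)
  have u': "Ck_on k N W (\<lambda>y. potential (z y) j)" for j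
  proof (cases "j \<le> 2 * m")
    case False
    have "Ck_on k N W (\<lambda>_. 0 :: real)" by (rule Ck_on_const[OF W])
    moreover have "(\<lambda>y. potential (z y) j) = (\<lambda>_. 0)" using False by (simp add: potential_def)
    ultimately show ?thesis by simp
  qed (rule u)
  have T: "Ck_on k N W (\<lambda>y. cnj (complexify (\<lambda>k. potential (z y) k / 2) j))" for j
  proof -
    have "Ck_on k N W (\<lambda>y. of_real (potential (z y) (2 * j) / 2) - \<i> * of_real (potential (z y) (2 * j + 1) / 2))"
      by (intro Ck_on_diff[OF W] Ck_on_mult[OF W] Ck_on_const[OF W] Ck_on_linear[OF W bounded_linear_of_real]
          Ck_on_divide[OF W] u') auto
    moreover have "cnj (Complex a b) = of_real a - \<i> * of_real b" for a b
      by (simp add: complex_eq_iff)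
    ultimately show ?thesis unfolding complexify_def by simp
  qed
  show ?thesis
    unfolding to_link_def act_def
    by (intro Ck_on_mult[OF W] Ck_on_exp[OF W] Ck_on_sum[OF W] Ck_on_const[OF W] T z)
qed

end

section \<open>Holomorphic functions of several variables\<close>

definition holomorphic_fn :: "nat \<Rightarrow> (nat \<Rightarrow> complex) set \<Rightarrow> ((nat \<Rightarrow> complex) \<Rightarrow> complex) \<Rightarrow> bool" where
  "holomorphic_fn n W f \<longleftrightarrow> continuous_on W f \<and>
     (\<forall>z\<in>W. \<forall>i<n. (\<lambda>t. f (z(i := t))) field_differentiable (at (z i)))"

lemma holomorphic_map_on_iff: "holomorphic_map_on n W f \<longleftrightarrow> (\<forall>l. holomorphic_fn n W (\<lambda>z. f z l))"
  unfolding holomorphic_map_on_def holomorphic_fn_def ..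

lemma holomorphic_fn_const: "holomorphic_fn n W (\<lambda>_. c)"
  unfolding holomorphic_fn_def by simp

lemma holomorphic_fn_coord: "holomorphic_fn n W (\<lambda>z. z j)"
proof -
  have "continuous_on W (\<lambda>z::nat \<Rightarrow> complex. z j)"
    by (rule continuous_on_subset[OF continuous_on_product_coordinates]) simp
  moreover have "(\<lambda>t. (z(i := t)) j) field_differentiable (at (z i))" for z :: "nat \<Rightarrow> complex" and i
    by (cases "i = j") (simp_all add: field_differentiable_ident)
  ultimately show ?thesis unfolding holomorphic_fn_def by blast
qed

lemma holomorphic_fn_mult: "holomorphic_fn n W f \<Longrightarrow> holomorphic_fn n W g \<Longrightarrow> holomorphic_fn n W (\<lambda>z. f z * g z)"
  unfolding holomorphic_fn_def by (auto intro!: continuous_intros field_differentiable_mult)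

lemma holomorphic_fn_add: "holomorphic_fn n W f \<Longrightarrow> holomorphic_fn n W g \<Longrightarrow> holomorphic_fn n W (\<lambda>z. f z + g z)"
  unfolding holomorphic_fn_def by (auto intro!: continuous_intros field_differentiable_add)

lemma holomorphic_fn_sum: "(\<And>i. i \<in> I \<Longrightarrow> holomorphic_fn n W (f i)) \<Longrightarrow> holomorphic_fn n W (\<lambda>z. \<Sum>i\<in>I. f i z)"
  by (induction I rule: infinite_finite_induct) (auto intro: holomorphic_fn_add holomorphic_fn_const)

lemma holomorphic_fn_compose:
  assumes f: "holomorphic_fn n W f" and h: "\<And>z. z \<in> W \<Longrightarrow> h field_differentiable (at (f z))"
  shows "holomorphic_fn n W (\<lambda>z. h (f z))"
  unfolding holomorphic_fn_def
proof (intro conjI ballI allI impI)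
  have "continuous_on (f ` W) h"
    using h by (auto intro!: continuous_at_imp_continuous_on field_differentiable_imp_continuous_at)
  moreover have "continuous_on W f" using f unfolding holomorphic_fn_def by blast
  ultimately show "continuous_on W (\<lambda>z. h (f z))" by (rule continuous_on_compose2) simp
  fix z i assume z: "z \<in> W" "i < n"
  have "(\<lambda>t. f (z(i := t))) field_differentiable (at (z i))" using f z unfolding holomorphic_fn_def by blast
  moreover have "h field_differentiable (at (f (z(i := z i))))" using h[OF z(1)] by simp
  ultimately show "(\<lambda>t. h (f (z(i := t)))) field_differentiable (at (z i))"
    using field_differentiable_compose[of "\<lambda>t. f (z(i := t))" "z i" h] by (simp add: o_def)
qed

lemma coordinate_line_stays_in:
  fixes z :: "nat \<Rightarrow> complex"
  assumes "open_in_space n W" "z \<in> W" "i < n"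
  shows "\<forall>\<^sub>F t in nhds (z i). z(i := t) \<in> W"
proof -
  obtain T where T: "open T" "W = coord_space n \<inter> T" using assms(1) unfolding openin_open by blast
  have "continuous_on UNIV (\<lambda>t. z(i := t))"
  proof (rule continuous_on_coordinatewise_then_product)
    show "continuous_on UNIV (\<lambda>t. (z(i := t)) k)" for k
      by (cases "k = i") auto
  qed
  with T(1) have "open ((\<lambda>t. z(i := t)) -` T)" by (rule open_vimage)
  moreover have "z i \<in> (\<lambda>t. z(i := t)) -` T" using assms(2) T(2) by simp
  ultimately have "\<forall>\<^sub>F t in nhds (z i). t \<in> (\<lambda>t. z(i := t)) -` T" by (rule eventually_nhds_in_open)
  then show ?thesis
  proof (rule eventually_mono)
    fix t assume "t \<in> (\<lambda>t. z(i := t)) -` T"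
    moreover have "z(i := t) \<in> coord_space n"
      using assms(2,3) T(2) by (auto simp: coord_space_def)
    ultimately show "z(i := t) \<in> W" using T(2) by simp
  qed
qed

lemma holomorphic_fn_local:
  assumes E: "E \<subseteq> coord_space n"
    and loc: "\<And>z. z \<in> E \<Longrightarrow> \<exists>Z g. open_in_space n Z \<and> z \<in> Z \<and> Z \<subseteq> E \<and> holomorphic_fn n Z g \<and> (\<forall>w\<in>Z. f w = g w)"
  shows "holomorphic_fn n E f"
proof -
  have "(f \<longlongrightarrow> f z) (at z within E) \<and> (\<forall>i<n. (\<lambda>t. f (z(i := t))) field_differentiable (at (z i)))"
    if z: "z \<in> E" for z
  proof -
    obtain Z g where Z: "open_in_space n Z" "z \<in> Z" "Z \<subseteq> E" and g: "holomorphic_fn n Z g"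
      and eq: "\<And>w. w \<in> Z \<Longrightarrow> f w = g w" using loc[OF z] by blast
    obtain T where T: "open T" "Z = coord_space n \<inter> T" using Z(1) unfolding openin_open by blast
    have "at z within E = at z within Z"
      using Z T E by (intro at_within_nhd[of z T]) auto
    moreover have "continuous_on Z f"
      using g eq unfolding holomorphic_fn_def by (simp cong: continuous_on_cong)
    ultimately have "(f \<longlongrightarrow> f z) (at z within E)" using Z(2) by (simp add: continuous_on_def)
    moreover have "(\<lambda>t. f (z(i := t))) field_differentiable (at (z i))" if i: "i < n" for i
    proof -
      obtain D where "((\<lambda>t. g (z(i := t))) has_field_derivative D) (at (z i))"
        using g Z(2) i unfolding holomorphic_fn_def field_differentiable_def by blast
      moreover have "\<forall>\<^sub>F t in nhds (z i). f (z(i := t)) = g (z(i := t))"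
        using coordinate_line_stays_in[OF Z(1,2) i] eq by (auto elim: eventually_mono)
      ultimately have "((\<lambda>t. f (z(i := t))) has_field_derivative D) (at (z i))"
        using DERIV_cong_ev[of "z i" "z i" "\<lambda>t. f (z(i := t))" "\<lambda>t. g (z(i := t))" D D] by simp
      then show ?thesis unfolding field_differentiable_def ..
    qed
    ultimately show ?thesis by blast
  qed
  then show ?thesis unfolding holomorphic_fn_def continuous_on_def by blast
qed

context lvm
begin

abbreviation "L \<equiv> with_ones m \<Lambda>"

lemma L_last [simp]: "L i m = 1" by (simp add: with_ones_def)

lemma pairing_B: "pairing (2 * m) B i (realify (\<lambda>j. cnj (T j))) = Re (\<Sum>j\<le>m. L i j * T j)"
  unfolding pairing_realify by simp

section \<open>Slices of the action\<close>

text \<open>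
  The vectors \<open>(\<Lambda>\<^sub>i, 1)\<close> at the nonzero coordinates span \<open>\<complex>\<^sup>m\<^sup>+\<^sup>1\<close>: if all of them annihilate \<open>T\<close>, they
  annihilate \<open>\<i> T\<close> as well, and the real parts determine both.
\<close>

lemma action_kernel:
  assumes z: "z \<in> V" and T: "\<And>i. i \<in> support n z \<Longrightarrow> (\<Sum>j\<le>m. L i j * T j) = 0" and j: "j \<le> m"
  shows "T j = 0"
proof -
  have re: "Re (S j) = 0" if "\<And>i. i \<in> support n z \<Longrightarrow> (\<Sum>j\<le>m. L i j * S j) = 0" for S
  proof -
    have "\<forall>i\<in>support n z. pairing (2 * m) B i (realify (\<lambda>j. cnj (S j))) = 0"
      using that by (simp add: pairing_B)
    then have "\<forall>k\<le>2 * m. realify (\<lambda>j. cnj (S j)) k = 0"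
      using separating_support[OF z] unfolding separating_def by blast
    then have "realify (\<lambda>j. cnj (S j)) (2 * j) = 0" using j by simp
    then show ?thesis by (simp add: realify_def)
  qed
  have "(\<Sum>j\<le>m. L i j * (\<i> * T j)) = \<i> * (\<Sum>j\<le>m. L i j * T j)" for i
    by (simp add: sum_distrib_left mult_ac)
  then have "Re (\<i> * T j) = 0" using T by (intro re[of "\<lambda>j. \<i> * T j"]) simp
  then show ?thesis using re[OF T] by (simp add: complex_eq_iff)
qed

text \<open>
  This local freeness of the action makes nearby points of a slice lie on different orbits.
  If all exponents on the support have small real part, then \<open>T\<^sub>j\<close> is small for \<open>j < m\<close>, since the
  real parts span.  On \<open>I\<close> the exponents are multiples of \<open>2 \<pi> \<i>\<close>, and their differences involve
  only these \<open>T\<^sub>j\<close>, so they all agree.  Then \<open>T\<close> is concentrated in the last coordinate, and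
  acts by \<open>1\<close> everywhere.
\<close>

lemma small_stabiliser:
  assumes z: "z \<in> V" and I: "finite I" "I \<noteq> {}"
    and v: "\<And>x j. j \<le> m \<Longrightarrow> x j = (\<Sum>i\<in>I. (\<Sum>l\<le>m. L i l * x l) * v i j)"
  obtains e :: real where "e > 0"
    "\<And>T k. (\<And>i. i \<in> support n z \<Longrightarrow> \<bar>Re (\<Sum>j\<le>m. L i j * T j)\<bar> < e) \<Longrightarrow>
       (\<And>i. i \<in> I \<Longrightarrow> exp (\<Sum>j\<le>m. L i j * T j) = 1) \<Longrightarrow> exp (\<Sum>j\<le>m. L k j * T j) = 1"
proof -
  obtain I' w where I': "I' \<subseteq> support n z"
    and w: "\<And>u k. k \<le> 2 * m \<Longrightarrow> u k = (\<Sum>i\<in>I'. pairing (2 * m) B i u * w i k)"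
    using separating_coordinates[OF separating_support[OF z]] by auto
  obtain i0 where i0: "i0 \<in> I" using I(2) by blast
  define C where "C = (\<Sum>k\<le>2 * m. \<Sum>i\<in>I'. \<bar>w i k\<bar>)"
  define M where "M = (\<Sum>i\<in>I. \<Sum>j<m. norm (\<Lambda> i j - \<Lambda> i0 j))"
  have C0: "C \<ge> 0" and M0: "M \<ge> 0" by (auto simp: C_def M_def intro!: sum_nonneg)
  \<comment> \<open>The differences of exponents are at most \<open>2 e C M \<le> 2 < 2 \<pi>\<close>.\<close>
  define e where "e = 1 / (C * M + 1)"
  have "C * M \<ge> 0" using C0 M0 by simp
  then have e: "e > 0" "e * (C * M) \<le> 1" unfolding e_def by simp_all
  show thesis
  proof (rule that[OF e(1)])
    fix T k
    assume re: "\<And>i. i \<in> support n z \<Longrightarrow> \<bar>Re (\<Sum>j\<le>m. L i j * T j)\<bar> < e"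
      and ex: "\<And>i. i \<in> I \<Longrightarrow> exp (\<Sum>j\<le>m. L i j * T j) = 1"
    define u where "u = realify (\<lambda>j. cnj (T j))"
    define X where "X = (\<lambda>i. \<Sum>j\<le>m. L i j * T j)"
    have uk: "\<bar>u k\<bar> \<le> e * C" if "k \<le> 2 * m" for k
    proof -
      have "\<bar>u k\<bar> \<le> (\<Sum>i\<in>I'. \<bar>pairing (2 * m) B i u * w i k\<bar>)"
        using w[OF that, of u] sum_abs[of "\<lambda>i. pairing (2 * m) B i u * w i k" I'] by simp
      also have "\<dots> \<le> (\<Sum>i\<in>I'. e * \<bar>w i k\<bar>)"
        unfolding abs_mult using re I'
        by (intro sum_mono mult_right_mono) (auto simp: u_def pairing_B subset_iff less_imp_le)
      also have "\<dots> = e * (\<Sum>i\<in>I'. \<bar>w i k\<bar>)" by (rule sum_distrib_left[symmetric])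
      also have "\<dots> \<le> e * C"
        unfolding C_def using e(1) that
        by (intro mult_left_mono member_le_sum[of k "{..2*m}" "\<lambda>k. \<Sum>i\<in>I'. \<bar>w i k\<bar>"] sum_nonneg) auto
      finally show ?thesis .
    qed
    have Tj: "norm (T j) \<le> 2 * (e * C)" if "j < m" for j
      using uk[of "2 * j"] uk[of "2 * j + 1"] cmod_le[of "T j"] that by (simp add: u_def realify_def)
    have XX: "X i = X i0" if i: "i \<in> I" for i
    proof -
      have "X i - X i0 = (\<Sum>j<m. (\<Lambda> i j - \<Lambda> i0 j) * T j)"
        unfolding X_def sum_with_ones by (simp add: left_diff_distrib sum_subtractf)
      also have "norm \<dots> \<le> (\<Sum>j<m. norm (\<Lambda> i j - \<Lambda> i0 j) * (2 * (e * C)))"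
        using Tj by (intro order_trans[OF norm_sum] sum_mono) (auto simp: norm_mult intro: mult_left_mono)
      also have "\<dots> = (\<Sum>j<m. norm (\<Lambda> i j - \<Lambda> i0 j)) * (2 * (e * C))"
        by (rule sum_distrib_right[symmetric])
      also have "\<dots> \<le> M * (2 * (e * C))"
        unfolding M_def using i I(1) e(1) C0
        by (intro mult_right_mono member_le_sum[of i I "\<lambda>i. \<Sum>j<m. norm (\<Lambda> i j - \<Lambda> i0 j)"] sum_nonneg) auto
      also have "\<dots> \<le> 2" using e(2) by (simp add: mult_ac)
      finally have small: "norm (X i - X i0) \<le> 2" .
      have "exp (X i - X i0) = 1" using ex[OF i] ex[OF i0] by (simp add: X_def exp_diff)
      then obtain k :: int where k: "Re (X i - X i0) = 0" "Im (X i - X i0) = of_int (2 * k) * pi"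
        unfolding exp_eq_1 by blast
      have "\<bar>of_int (2 * k) * pi\<bar> \<le> 2" using small abs_Im_le_cmod[of "X i - X i0"] k(2) by linarith
      then have "\<bar>of_int k\<bar> * pi \<le> 1" by (simp add: abs_mult)
      moreover have "\<bar>real_of_int k\<bar> * pi \<ge> 1 * 2" if "k \<noteq> 0"
        using that pi_ge_two by (intro mult_mono) auto
      ultimately have "k = 0" by fastforce
      then show ?thesis using k by (simp add: complex_eq_iff)
    qed
    have vs: "(\<Sum>i\<in>I. v i j) = (if j = m then 1 else 0)" if "j \<le> m" for j
    proof -
      have "(\<Sum>l\<le>m. L i l * (if l = m then 1 else 0)) = 1" for i
        by (simp add: if_distrib cong: if_cong)
      then show ?thesis using v[OF that, of "\<lambda>l. if l = m then 1 else 0"] by simp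
    qed
    have T0: "T j = (if j = m then X i0 else 0)" if "j \<le> m" for j
    proof -
      have "T j = (\<Sum>i\<in>I. X i * v i j)" using v[OF that, of T] by (simp add: X_def)
      also have "\<dots> = (\<Sum>i\<in>I. X i0 * v i j)" using XX by simp
      also have "\<dots> = X i0 * (\<Sum>i\<in>I. v i j)" by (rule sum_distrib_left[symmetric])
      finally show ?thesis using vs[OF that] by simp
    qed
    have "(\<Sum>j\<le>m. L k j * T j) = X i0"
      using T0 by (simp add: sum_with_ones)
    then show "exp (\<Sum>j\<le>m. L k j * T j) = 1" using ex[OF i0] by (simp add: X_def)
  qed
qed

end

text \<open>
  A point of \<open>V\<close>, with \<open>m + 1\<close> nonzero coordinates at which the vectors \<open>(\<Lambda>\<^sub>i, 1)\<close> form a basis of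
  \<open>\<complex>\<^sup>m\<^sup>+\<^sup>1\<close>, and the dual basis \<open>v\<close>.  The slice consists of the points that agree with \<open>z\<^sub>0\<close> on \<open>I\<close>;
  the bijection \<open>\<beta>\<close> numbers the free coordinates.
\<close>

locale lvm_slice = lvm +
  fixes z\<^sub>0 :: "nat \<Rightarrow> complex" and I :: "nat set" and v :: "nat \<Rightarrow> nat \<Rightarrow> complex"
    and \<beta> :: "nat \<Rightarrow> nat" and d :: nat
  assumes base: "z\<^sub>0 \<in> V" and I_sub: "I \<subseteq> support n z\<^sub>0" and card_I: "card I = m + 1"
    and dual: "\<And>i k. i \<in> I \<Longrightarrow> k \<in> I \<Longrightarrow> (\<Sum>j\<le>m. L i j * v k j) = (if i = k then 1 else 0)"
    and frame: "\<And>x j. j \<le> m \<Longrightarrow> x j = (\<Sum>i\<in>I. (\<Sum>l\<le>m. L i l * x l) * v i j)"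
    and bij: "bij_betw \<beta> {..<d} ({..<n} - I)"
begin

definition slice_point :: "(nat \<Rightarrow> complex) \<Rightarrow> nat \<Rightarrow> complex" where
  "slice_point y i = (if i \<in> I then z\<^sub>0 i else if i < n then y (inv_into {..<d} \<beta> i) else 0)"

text \<open>
  Near \<open>z\<^sub>0\<close>, principal logarithms of the quotients \<open>x\<^sub>i / z\<^sub>0\<^sub>i\<close>, \<open>i \<in> I\<close>, give the parameter that moves
  \<open>x\<close> into the slice; these are the free coordinates of the result.
\<close>

definition slice_coord :: "(nat \<Rightarrow> complex) \<Rightarrow> nat \<Rightarrow> complex" where
  "slice_coord x l = (if l < d then x (\<beta> l) *
     exp (\<Sum>i\<in>I. (- (\<Sum>j\<le>m. L (\<beta> l) j * v i j)) * Ln (x i * inverse (z\<^sub>0 i))) else 0)"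

definition near_slice :: "(nat \<Rightarrow> complex) \<Rightarrow> bool" where
  "near_slice x \<longleftrightarrow> (\<forall>i\<in>I. x i * inverse (z\<^sub>0 i) \<notin> \<real>\<^sub>\<le>\<^sub>0)"

lemma finite_I: "finite I" by (rule finite_subset[OF I_sub finite_support])

lemma I_bound: "i \<in> I \<Longrightarrow> i < n \<and> z\<^sub>0 i \<noteq> 0" using I_sub by (auto simp: support_def)

lemma \<beta>: "l < d \<Longrightarrow> \<beta> l < n \<and> \<beta> l \<notin> I" "l < d \<Longrightarrow> inv_into {..<d} \<beta> (\<beta> l) = l"
  using bij by (auto simp: bij_betw_def)

lemma \<beta>_onto: assumes "i < n" "i \<notin> I" obtains l where "l < d" "i = \<beta> l"
  using bij assms by (auto simp: bij_betw_def)

lemma slice_point_in: "i \<in> I \<Longrightarrow> slice_point y i = z\<^sub>0 i"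
  by (simp add: slice_point_def)

lemma slice_point_\<beta>: "l < d \<Longrightarrow> slice_point y (\<beta> l) = y l"
  using \<beta> by (simp add: slice_point_def)

lemma slice_point_coord_space: "slice_point y \<in> coord_space n"
  by (auto simp: slice_point_def coord_space_def dest: I_bound)

lemma slice_coord_coord_space: "slice_coord y \<in> coord_space d"
  by (simp add: slice_coord_def coord_space_def)

lemma straighten:
  assumes x: "x \<in> coord_space n" "near_slice x"
  shows "same_orbit m \<Lambda> x (slice_point (slice_coord x))"
proof -
  define T where "T = (\<lambda>j. \<Sum>i\<in>I. (- Ln (x i * inverse (z\<^sub>0 i))) * v i j)"
  have LT: "(\<Sum>j\<le>m. L k j * T j) = (\<Sum>i\<in>I. (- (\<Sum>j\<le>m. L k j * v i j)) * Ln (x i * inverse (z\<^sub>0 i)))" for k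
  proof -
    have "(\<Sum>j\<le>m. L k j * T j) = (\<Sum>i\<in>I. \<Sum>j\<le>m. L k j * v i j * (- Ln (x i * inverse (z\<^sub>0 i))))"
      unfolding T_def sum_distrib_left by (subst sum.swap) (simp only: mult_ac)
    then show ?thesis by (simp only: sum_distrib_right[symmetric] minus_mult_commute)
  qed
  have "slice_point (slice_coord x) k = act m \<Lambda> T x k" for k
  proof (cases "k \<in> I")
    case True
    have "(\<Sum>j\<le>m. L k j * T j) = (\<Sum>i\<in>I. (- (if k = i then 1 else 0)) * Ln (x i * inverse (z\<^sub>0 i)))"
      unfolding LT using dual True by (intro sum.cong) auto
    also have "\<dots> = - Ln (x k * inverse (z\<^sub>0 k))"
      using True finite_I by (simp add: if_distrib if_distribR sum_negf cong: if_cong)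
    finally have "act m \<Lambda> T x k = inverse (exp (Ln (x k * inverse (z\<^sub>0 k)))) * x k"
      by (simp add: act_def exp_minus)
    moreover have "x k * inverse (z\<^sub>0 k) \<noteq> 0" using x(2) True unfolding near_slice_def by force
    ultimately show ?thesis using True I_bound by (simp add: slice_point_in)
  next
    case notI: False
    show ?thesis
    proof (cases "k < n")
      case True
      then obtain l where "l < d" "k = \<beta> l" using \<beta>_onto notI by blast
      then have "slice_point (slice_coord x) k = x k * exp (\<Sum>j\<le>m. L k j * T j)"
        unfolding LT by (simp add: slice_point_\<beta> slice_coord_def)
      then show ?thesis by (simp only: act_def mult.commute)
    next
      case False
      then show ?thesis using x(1) notI by (simp add: slice_point_def act_def coord_space_def)
    qed
  qed
  then show ?thesis unfolding same_orbit_def by blast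
qed

lemma near_slice_point: "near_slice (slice_point y)"
  using I_bound by (simp add: near_slice_def slice_point_in)

lemma slice_coord_point: "y \<in> coord_space d \<Longrightarrow> slice_coord (slice_point y) = y"
  using I_bound by (intro ext) (auto simp: slice_coord_def slice_point_\<beta> slice_point_in coord_space_def)

lemma slice_point_base: "slice_point (slice_coord z\<^sub>0) = z\<^sub>0"
proof
  fix i
  have "slice_coord z\<^sub>0 l = z\<^sub>0 (\<beta> l)" if "l < d" for l
    using that I_bound by (simp add: slice_coord_def)
  note coord = this
  show "slice_point (slice_coord z\<^sub>0) i = z\<^sub>0 i"
  proof (cases "i \<in> I \<or> i \<ge> n")
    case True
    then show ?thesis using base by (auto simp: slice_point_def cone_V_iff coord_space_def)
  next
    case False
    then obtain l where "l < d" "i = \<beta> l" using \<beta>_onto[of i] by auto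
    then show ?thesis by (simp add: slice_point_\<beta> coord)
  qed
qed

text \<open>
  On a neighbourhood of \<open>z\<^sub>0\<close> in the slice, no two points lie on the same orbit.  The moduli of the
  coordinates that are nonzero at \<open>z\<^sub>0\<close> are kept within a factor \<open>exp (\<plusminus> e / 2)\<close>, so that the
  exponents that relate two points have real parts below \<open>e\<close>, as the local freeness requires.
\<close>

lemma slice_domain:
  obtains W where "open_in_space d W" "slice_coord z\<^sub>0 \<in> W" "\<And>y. y \<in> W \<Longrightarrow> slice_point y \<in> V"
    "\<And>y y'. y \<in> W \<Longrightarrow> y' \<in> W \<Longrightarrow> same_orbit m \<Lambda> (slice_point y) (slice_point y') \<Longrightarrow> y = y'"
proof -
  have "I \<noteq> {}" using card_I by auto
  obtain e :: real where e: "e > 0"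
    "\<And>T k. (\<And>i. i \<in> support n z\<^sub>0 \<Longrightarrow> \<bar>Re (\<Sum>j\<le>m. L i j * T j)\<bar> < e) \<Longrightarrow>
       (\<And>i. i \<in> I \<Longrightarrow> exp (\<Sum>j\<le>m. L i j * T j) = 1) \<Longrightarrow> exp (\<Sum>j\<le>m. L k j * T j) = 1"
    using small_stabiliser[OF base finite_I \<open>I \<noteq> {}\<close> frame] by blast
  define S where "S = {l. l < d \<and> z\<^sub>0 (\<beta> l) \<noteq> 0}"
  define O' where "O' = (\<lambda>l. {t :: complex. norm (z\<^sub>0 (\<beta> l)) * exp (- (e / 2)) < norm t \<and> norm t < norm (z\<^sub>0 (\<beta> l)) * exp (e / 2)})"
  define W where "W = coord_space d \<inter> (\<Inter>l\<in>S. (\<lambda>y::nat \<Rightarrow> complex. y l) -` O' l)"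
  have "open (O' l)" for l
    unfolding O'_def by (intro open_Collect_conj open_Collect_less continuous_intros)
  then have "open (\<Inter>l\<in>S. (\<lambda>y::nat \<Rightarrow> complex. y l) -` O' l)"
    by (intro open_INT ballI open_vimage continuous_on_product_coordinates) (simp_all add: S_def)
  then have W_open: "open_in_space d W" unfolding W_def by (rule openin_open_Int)
  have base_coord: "slice_coord z\<^sub>0 l = z\<^sub>0 (\<beta> l)" if "l < d" for l
    using slice_point_\<beta>[OF that, of "slice_coord z\<^sub>0"] by (simp add: slice_point_base)
  have exps: "exp (- (e / 2)) < 1" "1 < exp (e / 2)" using e(1) by auto
  have base_W: "slice_coord z\<^sub>0 \<in> W"
    unfolding W_def
  proof (intro IntI slice_coord_coord_space INT_I)
    fix l assume "l \<in> S"
    then have l: "slice_coord z\<^sub>0 l = z\<^sub>0 (\<beta> l)" "norm (z\<^sub>0 (\<beta> l)) > 0"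
      using base_coord by (auto simp: S_def)
    have "norm (z\<^sub>0 (\<beta> l)) * exp (- (e / 2)) < norm (z\<^sub>0 (\<beta> l)) * 1"
      "norm (z\<^sub>0 (\<beta> l)) * 1 < norm (z\<^sub>0 (\<beta> l)) * exp (e / 2)"
      using l(2) exps by (intro mult_strict_left_mono; simp)+
    then show "slice_coord z\<^sub>0 \<in> (\<lambda>y. y l) -` O' l" using l(1) by (simp add: O'_def)
  qed
  have Wnz: "y l \<noteq> 0" if "y \<in> W" "l \<in> S" for y l
  proof -
    have "norm (z\<^sub>0 (\<beta> l)) * exp (- (e / 2)) < norm (y l)" using that by (auto simp: W_def O'_def)
    moreover have "norm (z\<^sub>0 (\<beta> l)) * exp (- (e / 2)) \<ge> 0" by simp
    ultimately have "norm (y l) > 0" by linarith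
    then show ?thesis by simp
  qed
  have W_V: "slice_point y \<in> V" if y: "y \<in> W" for y
  proof (rule cone_V_mono[OF base slice_point_coord_space], rule)
    fix i assume "i \<in> support n z\<^sub>0"
    then have i: "i < n" "z\<^sub>0 i \<noteq> 0" by (auto simp: support_def)
    show "i \<in> support n (slice_point y)"
    proof (cases "i \<in> I")
      case True
      then show ?thesis using i by (simp add: support_def slice_point_in)
    next
      case False
      then obtain l where l: "l < d" "i = \<beta> l" using \<beta>_onto i by blast
      then show ?thesis using i Wnz[OF y, of l] by (simp add: support_def slice_point_\<beta> S_def)
    qed
  qed
  have W_inj: "y = y'" if y: "y \<in> W" and y': "y' \<in> W"
    and orb: "same_orbit m \<Lambda> (slice_point y) (slice_point y')" for y y'
  proof -
    obtain T where T: "slice_point y' = act m \<Lambda> T (slice_point y)"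
      using orb unfolding same_orbit_def by blast
    define X where "X = (\<lambda>i. \<Sum>j\<le>m. L i j * T j)"
    have act: "slice_point y' i = exp (X i) * slice_point y i" for i by (simp add: T act_def X_def)
    have XI: "exp (X i) = 1" if "i \<in> I" for i
      using act[of i] that I_bound by (simp add: slice_point_in)
    have "\<bar>Re (X i)\<bar> < e" if i: "i \<in> support n z\<^sub>0" for i
    proof (cases "i \<in> I")
      case True
      then have "exp (Re (X i)) = 1" using XI norm_exp_eq_Re[of "X i"] by simp
      then show ?thesis using e(1) by simp
    next
      case False
      have i': "i < n" "z\<^sub>0 i \<noteq> 0" using i by (auto simp: support_def)
      then obtain l where l: "l < d" "i = \<beta> l" using \<beta>_onto False by blast
      then have lS: "l \<in> S" using i' by (simp add: S_def)
      define r where "r = norm (z\<^sub>0 i)"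
      have r: "r > 0" using i' by (simp add: r_def)
      have eq: "norm (y' l) = exp (Re (X i)) * norm (y l)"
        using act[of i] l by (simp add: slice_point_\<beta> norm_mult)
      have b: "r * exp (- (e / 2)) < norm (y l)" "norm (y l) < r * exp (e / 2)"
        "r * exp (- (e / 2)) < norm (y' l)" "norm (y' l) < r * exp (e / 2)"
        using y y' lS l by (auto simp: W_def O'_def r_def)
      have "exp (Re (X i)) * (r * exp (- (e / 2))) < r * exp (e / 2)"
        using b(4) unfolding eq by (rule order.strict_trans[OF mult_strict_left_mono[OF b(1) exp_gt_zero]])
      then have "exp (Re (X i) + - (e / 2)) < exp (e / 2)" using r by (simp only: exp_add) (simp add: mult.left_commute)
      then have 1: "Re (X i) < e" by simp
      have "r * exp (- (e / 2)) < exp (Re (X i)) * (r * exp (e / 2))"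
        using b(3) mult_strict_left_mono[OF b(2) exp_gt_zero] unfolding eq by (rule order.strict_trans)
      then have "exp (- (e / 2)) < exp (Re (X i) + e / 2)" using r by (simp only: exp_add) (simp add: mult.left_commute)
      then have "Re (X i) > - e" by simp
      with 1 show ?thesis by simp
    qed
    then have "exp (X k) = 1" for k using e(2)[of T k] XI by (simp add: X_def)
    then have "slice_point y' i = slice_point y i" for i using act by simp
    then have "slice_point y' = slice_point y" ..
    then show ?thesis using slice_coord_point[of y] slice_coord_point[of y'] y y' by (simp add: W_def)
  qed
  show thesis using that W_open base_W W_V W_inj by blast
qed

lemma open_near_slice: "open_in_space n {x \<in> V. near_slice (act m \<Lambda> T x)}"
proof -
  have "open ((\<lambda>x::nat \<Rightarrow> complex. act m \<Lambda> T x i * inverse (z\<^sub>0 i)) -` (- \<real>\<^sub>\<le>\<^sub>0))" for i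
    unfolding act_def
    by (intro open_vimage continuous_intros continuous_on_product_coordinates) (simp add: open_Compl)
  then have "open (\<Inter>i\<in>I. (\<lambda>x::nat \<Rightarrow> complex. act m \<Lambda> T x i * inverse (z\<^sub>0 i)) -` (- \<real>\<^sub>\<le>\<^sub>0))"
    using finite_I by (intro open_INT) auto
  with open_in_space_cone_V have "open_in_space n (V \<inter> (\<Inter>i\<in>I. (\<lambda>x. act m \<Lambda> T x i * inverse (z\<^sub>0 i)) -` (- \<real>\<^sub>\<le>\<^sub>0)))"
    by (rule openin_Int_open)
  moreover have "V \<inter> (\<Inter>i\<in>I. (\<lambda>x. act m \<Lambda> T x i * inverse (z\<^sub>0 i)) -` (- \<real>\<^sub>\<le>\<^sub>0)) = {x \<in> V. near_slice (act m \<Lambda> T x)}"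
    by (auto simp: near_slice_def)
  ultimately show ?thesis by simp
qed

lemma holomorphic_slice_coord:
  assumes "\<And>x. x \<in> Z \<Longrightarrow> near_slice (act m \<Lambda> T x)"
  shows "holomorphic_fn n Z (\<lambda>x. slice_coord (act m \<Lambda> T x) l)"
proof (cases "l < d")
  case True
  have "holomorphic_fn n Z (\<lambda>x. act m \<Lambda> T x i)" for i
    unfolding act_def by (intro holomorphic_fn_mult holomorphic_fn_const holomorphic_fn_coord)
  moreover from this have "holomorphic_fn n Z (\<lambda>x. Ln (act m \<Lambda> T x i * inverse (z\<^sub>0 i)))" if "i \<in> I" for i
    using assms that
    by (intro holomorphic_fn_compose[where h = Ln] holomorphic_fn_mult holomorphic_fn_const field_differentiable_at_Ln)
       (auto simp: near_slice_def)
  ultimately have "holomorphic_fn n Z (\<lambda>x. act m \<Lambda> T x (\<beta> l) *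
     exp (\<Sum>i\<in>I. (- (\<Sum>j\<le>m. L (\<beta> l) j * v i j)) * Ln (act m \<Lambda> T x i * inverse (z\<^sub>0 i))))"
    by (intro holomorphic_fn_mult holomorphic_fn_compose[where h = exp] holomorphic_fn_sum holomorphic_fn_const
        field_differentiable_within_exp)
  then show ?thesis using True by (simp add: slice_coord_def)
qed (simp add: slice_coord_def holomorphic_fn_const)

lemma Ck_on_slice_coord:
  fixes \<zeta> :: "(nat \<Rightarrow> 'a::euclidean_space) \<Rightarrow> nat \<Rightarrow> complex"
  assumes W: "open_in_space N W" and \<zeta>: "\<And>i. Ck_on k N W (\<lambda>y. \<zeta> y i)"
    and near: "\<And>y. y \<in> W \<Longrightarrow> near_slice (act m \<Lambda> T (\<zeta> y))"
  shows "Ck_on k N W (\<lambda>y. slice_coord (act m \<Lambda> T (\<zeta> y)) l)"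
proof (cases "l < d")
  case True
  have a: "Ck_on k N W (\<lambda>y. act m \<Lambda> T (\<zeta> y) i)" for i
    unfolding act_def by (intro Ck_on_mult[OF W] Ck_on_const[OF W] \<zeta>)
  have "Ck_on k N W (\<lambda>y. Ln (act m \<Lambda> T (\<zeta> y) i * inverse (z\<^sub>0 i)))" if "i \<in> I" for i
    using near that by (intro Ck_on_Ln[OF W] Ck_on_mult[OF W] Ck_on_const[OF W] a) (auto simp: near_slice_def)
  then have "Ck_on k N W (\<lambda>y. act m \<Lambda> T (\<zeta> y) (\<beta> l) *
     exp (\<Sum>i\<in>I. (- (\<Sum>j\<le>m. L (\<beta> l) j * v i j)) * Ln (act m \<Lambda> T (\<zeta> y) i * inverse (z\<^sub>0 i))))"
    by (intro Ck_on_mult[OF W] Ck_on_exp[OF W] Ck_on_sum[OF W] Ck_on_const[OF W] a)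
  then show ?thesis using True by (simp add: slice_coord_def del: Ck_on.simps)
next
  case False
  have "Ck_on k N W (\<lambda>_. 0 :: complex)" by (rule Ck_on_const[OF W])
  then show ?thesis using False by (simp add: slice_coord_def del: Ck_on.simps)
qed

end

section \<open>Charts of the leaf space\<close>

lemma quotient_manifold_chartI:
  assumes "U \<subseteq> q ` E" "openin (top_of_set E) {z\<in>E. q z \<in> U}" "inj_on \<phi> U" "open_in_space d (\<phi> ` U)"
    and "R {z\<in>E. q z \<in> U} (\<phi> \<circ> q)" "R' (\<phi> ` U) s"
    and "\<And>y. y \<in> \<phi> ` U \<Longrightarrow> s y \<in> E \<and> q (s y) \<in> U \<and> \<phi> (q (s y)) = y"
  shows "(U, \<phi>) \<in> charts (quotient_manifold R R' E q d)"
proof -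
  have "\<forall>w\<in>\<phi> ` U. \<exists>W s. open_in_space d W \<and> w \<in> W \<and> R' W s \<and>
      (\<forall>y\<in>W. s y \<in> E \<and> q (s y) \<in> U \<and> \<phi> (q (s y)) = y)"
  proof
    fix w assume "w \<in> \<phi> ` U"
    then show "\<exists>W s. open_in_space d W \<and> w \<in> W \<and> R' W s \<and>
        (\<forall>y\<in>W. s y \<in> E \<and> q (s y) \<in> U \<and> \<phi> (q (s y)) = y)"
      using assms(4,6,7) by (intro exI[of _ "\<phi> ` U"] exI[of _ s] conjI ballI) simp_all
  qed
  then show ?thesis unfolding quotient_manifold_def using assms(1-5) by simp
qed

context lvm_slice
begin

text \<open>
  The slice is a chart of the leaf space.  An orbit that meets the neighbourhood of \<open>z\<^sub>0\<close> may run far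
  away from it, therefore a point is first moved near the slice by the linear map that a fixed \<open>T\<close> induces,
  and then straightened.  This local formula shows that the chart is holomorphic; it is also a
  conclusion of the lemma, because the comparison with real charts needs the smoothness of the
  composites of the chart with smooth maps.
\<close>

lemma slice_chart:
  assumes q: "\<And>z w. q z = q w \<longleftrightarrow> same_orbit m \<Lambda> z w"
  obtains U \<phi> where "(U, \<phi>) \<in> charts (complex_quotient n V q d)" "q z\<^sub>0 \<in> U"
    "\<And>y. y \<in> \<phi> ` U \<Longrightarrow> slice_point y \<in> V \<and> q (slice_point y) \<in> U \<and> \<phi> (q (slice_point y)) = y"
    "\<And>z. z \<in> V \<Longrightarrow> q z \<in> U \<Longrightarrow> \<exists>T Z. open_in_space n Z \<and> z \<in> Z \<and> Z \<subseteq> V \<and>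
      (\<forall>x\<in>Z. near_slice (act m \<Lambda> T x) \<and> q x \<in> U \<and> \<phi> (q x) = slice_coord (act m \<Lambda> T x))"
proof -
  obtain W where W: "open_in_space d W" "slice_coord z\<^sub>0 \<in> W" "\<And>y. y \<in> W \<Longrightarrow> slice_point y \<in> V"
    and W_inj: "\<And>y y'. y \<in> W \<Longrightarrow> y' \<in> W \<Longrightarrow> same_orbit m \<Lambda> (slice_point y) (slice_point y') \<Longrightarrow> y = y'"
    using slice_domain by blast
  define U where "U = (\<lambda>y. q (slice_point y)) ` W"
  define \<phi> where "\<phi> = inv_into W (\<lambda>y. q (slice_point y))"
  have inj: "inj_on (\<lambda>y. q (slice_point y)) W"
    by (intro inj_onI W_inj) (simp_all only: q)
  have \<phi>: "\<phi> (q (slice_point y)) = y" if "y \<in> W" for y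
    unfolding \<phi>_def by (rule inv_into_f_f[OF inj that])
  have \<phi>U: "\<phi> ` U = W"
    using \<phi> by (force simp: U_def image_iff)
  have W_sub: "W \<subseteq> coord_space d" using W(1) openin_imp_subset by blast
  define Z where "Z = (\<lambda>T. {x \<in> {x \<in> V. near_slice (act m \<Lambda> T x)}. slice_coord (act m \<Lambda> T x) \<in> W})"
  have Z_open: "open_in_space n (Z T)" for T
  proof -
    let ?D = "{x \<in> V. near_slice (act m \<Lambda> T x)}"
    have "continuous_on ?D (\<lambda>x. slice_coord (act m \<Lambda> T x) l)" for l
      using holomorphic_slice_coord[of ?D T l] unfolding holomorphic_fn_def by blast
    then have "continuous_on ?D (\<lambda>x. slice_coord (act m \<Lambda> T x))"
      by (rule continuous_on_coordinatewise_then_product)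
    then have "openin (top_of_set ?D) (?D \<inter> (\<lambda>x. slice_coord (act m \<Lambda> T x)) -` W)"
      by (rule continuous_openin_preimage[OF _ _ W(1)]) (simp add: slice_coord_coord_space)
    moreover have "?D \<inter> (\<lambda>x. slice_coord (act m \<Lambda> T x)) -` W = Z T" by (auto simp: Z_def)
    ultimately have "openin (top_of_set ?D) (Z T)" by simp
    then show ?thesis using open_near_slice by (rule openin_trans)
  qed
  have Z: "near_slice (act m \<Lambda> T x) \<and> q x \<in> U \<and> \<phi> (q x) = slice_coord (act m \<Lambda> T x)" if x: "x \<in> Z T" for x T
  proof -
    have xV: "x \<in> V" and near: "near_slice (act m \<Lambda> T x)" and y: "slice_coord (act m \<Lambda> T x) \<in> W"
      using x by (auto simp: Z_def)
    have "act m \<Lambda> T x \<in> coord_space n" using xV by (simp add: cone_V_iff act_coord_space)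
    then have "same_orbit m \<Lambda> x (slice_point (slice_coord (act m \<Lambda> T x)))"
      by (rule same_orbit_trans[OF same_orbit_act straighten[OF _ near]])
    then have "q x = q (slice_point (slice_coord (act m \<Lambda> T x)))" by (simp only: q)
    then show ?thesis using near y \<phi>[OF y] by (simp add: U_def)
  qed
  have ex: "\<exists>T. z \<in> Z T" if z: "z \<in> V" "q z \<in> U" for z
  proof -
    obtain y where y: "y \<in> W" "q z = q (slice_point y)" using z(2) by (auto simp: U_def)
    then have "same_orbit m \<Lambda> z (slice_point y)" by (simp only: q)
    then obtain T where T: "slice_point y = act m \<Lambda> T z" unfolding same_orbit_def by blast
    have "y \<in> coord_space d" using y(1) W_sub by blast
    then have "z \<in> Z T"
      using z(1) y(1) near_slice_point[of y] slice_coord_point[of y] by (simp add: Z_def T[symmetric])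
    then show ?thesis by blast
  qed
  have U_V: "U \<subseteq> q ` V" using W(3) by (auto simp: U_def)
  have ZV: "Z T \<subseteq> V" for T by (auto simp: Z_def)
  have pre_eq: "{z \<in> V. q z \<in> U} = (\<Union>T. Z T)"
  proof (intro equalityI subsetI)
    fix z assume "z \<in> {z \<in> V. q z \<in> U}"
    then show "z \<in> (\<Union>T. Z T)" using ex[of z] by simp
  next
    fix z assume "z \<in> (\<Union>T. Z T)"
    then obtain T where "z \<in> Z T" by blast
    then show "z \<in> {z \<in> V. q z \<in> U}" using Z[of z T] ZV by blast
  qed
  have "open_in_space n (\<Union>T. Z T)" using Z_open by (intro openin_Union) auto
  moreover have "(\<Union>T. Z T) \<subseteq> V" using ZV by (rule UN_least)
  moreover have V_sub: "V \<subseteq> coord_space n" by (rule openin_imp_subset[OF open_in_space_cone_V])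
  ultimately have pre: "openin (top_of_set V) {z \<in> V. q z \<in> U}"
    unfolding pre_eq by (rule openin_subset_trans)
  have "holomorphic_map_on n {z \<in> V. q z \<in> U} (\<phi> \<circ> q)"
    unfolding holomorphic_map_on_iff
  proof (intro allI holomorphic_fn_local)
    show "{z \<in> V. q z \<in> U} \<subseteq> coord_space n" using V_sub by blast
    fix l z assume "z \<in> {z \<in> V. q z \<in> U}"
    then obtain T where "z \<in> Z T" using ex[of z] by auto
    moreover have "holomorphic_fn n (Z T) (\<lambda>x. slice_coord (act m \<Lambda> T x) l)"
      by (rule holomorphic_slice_coord) (simp add: Z_def)
    moreover have "Z T \<subseteq> {z \<in> V. q z \<in> U}" unfolding pre_eq by blast
    ultimately show "\<exists>Z g. open_in_space n Z \<and> z \<in> Z \<and> Z \<subseteq> {z \<in> V. q z \<in> U} \<and> holomorphic_fn n Z g \<and>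
        (\<forall>w\<in>Z. (\<phi> \<circ> q) w l = g w)"
      using Z_open Z by (intro exI[of _ "Z T"] exI[of _ "\<lambda>x. slice_coord (act m \<Lambda> T x) l"]) auto
  qed
  moreover have "holomorphic_map_on d W slice_point"
    unfolding holomorphic_map_on_iff slice_point_def
  proof
    fix l
    show "holomorphic_fn d W (\<lambda>y. if l \<in> I then z\<^sub>0 l else if l < n then y (inv_into {..<d} \<beta> l) else 0)"
      by (cases "l \<in> I"; cases "l < n") (simp_all add: holomorphic_fn_const holomorphic_fn_coord)
  qed
  moreover have "inj_on \<phi> U"
    unfolding \<phi>_def U_def by (rule inj_on_inv_into) simp
  moreover have sec: "slice_point y \<in> V \<and> q (slice_point y) \<in> U \<and> \<phi> (q (slice_point y)) = y" if "y \<in> \<phi> ` U" for y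
    using that W(3) \<phi> unfolding \<phi>U by (simp add: U_def)
  ultimately have "(U, \<phi>) \<in> charts (complex_quotient n V q d)"
    unfolding complex_quotient_def
    by (intro quotient_manifold_chartI[where s = slice_point] U_V pre) (simp_all add: \<phi>U W(1))
  moreover have "q z\<^sub>0 \<in> U"
    unfolding U_def using W(2) by (intro image_eqI[of _ _ "slice_coord z\<^sub>0"]) (simp_all add: slice_point_base)
  moreover note sec
  moreover have "\<exists>T Z. open_in_space n Z \<and> z \<in> Z \<and> Z \<subseteq> V \<and>
      (\<forall>x\<in>Z. near_slice (act m \<Lambda> T x) \<and> q x \<in> U \<and> \<phi> (q x) = slice_coord (act m \<Lambda> T x))"
    if z: "z \<in> V" "q z \<in> U" for z
  proof -
    obtain T where T: "z \<in> Z T" using ex[OF z] by blast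
    show ?thesis
      by (rule exI[of _ T], rule exI[of _ "Z T"]) (use T Z_open Z ZV in auto)
  qed
  ultimately show thesis by (rule that)
qed

end

lemma (in lvm) lvm_slice_exists:
  assumes "z\<^sub>0 \<in> V"
  obtains I v \<beta> where "lvm_slice n m \<Lambda> z\<^sub>0 I v \<beta> (n - m - 1)"
proof (rule dual_basis[OF finite_support finite_atMost[of m], of n z\<^sub>0 L])
  show "T j = 0" if "\<And>i. i \<in> support n z\<^sub>0 \<Longrightarrow> (\<Sum>j\<le>m. L i j * T j) = 0" "j \<in> {..m}" for T j
    using action_kernel[OF assms] that by simp
next
  fix I v
  assume I: "I \<subseteq> support n z\<^sub>0" "card I = card {..m}"
    and v: "\<And>i k. i \<in> I \<Longrightarrow> k \<in> I \<Longrightarrow> (\<Sum>j\<le>m. L i j * v k j) = (if i = k then 1 else 0)"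
      "\<And>x j. j \<in> {..m} \<Longrightarrow> x j = (\<Sum>i\<in>I. (\<Sum>l\<le>m. L i l * x l) * v i j)"
  have "I \<subseteq> {..<n}" using I(1) by (auto simp: support_def)
  then have "card ({..<n} - I) = card {..<n - m - 1}"
    using I(2) by (simp add: card_Diff_subset finite_subset)
  then obtain \<beta> where "bij_betw \<beta> {..<n - m - 1} ({..<n} - I)"
    using finite_same_card_bij[of "{..<n - m - 1}" "{..<n} - I"] by auto
  then have "lvm_slice n m \<Lambda> z\<^sub>0 I v \<beta> (n - m - 1)"
    using assms I v by unfold_locales auto
  then show thesis by (rule that)
qed

lemma smooth_map_onI:
  assumes "open_in_space n W" "\<And>l k. Ck_on k n W (\<lambda>y. g y l)" "\<And>y. y \<in> W \<Longrightarrow> f y = g y"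
  shows "smooth_map_on n W f"
  unfolding smooth_map_on_def using assms by fastforce

lemma Ck_on_realify:
  assumes "open_in_space n W" "\<And>l. Ck_on k n W (\<lambda>y. f y l)"
  shows "Ck_on k n W (\<lambda>y. realify (f y) l)"
proof (cases "even l")
  case True
  then show ?thesis
    using Ck_on_linear[OF assms(1) bounded_linear_Re assms(2)] by (simp add: realify_def del: Ck_on.simps)
next
  case False
  then show ?thesis
    using Ck_on_linear[OF assms(1) bounded_linear_Im assms(2)] by (simp add: realify_def del: Ck_on.simps)
qed

lemma Ck_on_complexify:
  assumes "open_in_space n W"
  shows "Ck_on k n W (\<lambda>y. complexify y l)"
proof -
  have "Ck_on k n W (\<lambda>y. of_real (y (2 * l)) + \<i> * of_real (y (2 * l + 1)))"
    by (intro Ck_on_add[OF assms] Ck_on_mult[OF assms] Ck_on_const[OF assms] Ck_on_coord[OF assms]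
        Ck_on_linear[OF assms bounded_linear_of_real])
  moreover have "(\<lambda>y. of_real (y (2 * l)) + \<i> * of_real (y (2 * l + 1))) = (\<lambda>y. complexify y l)"
    by (auto simp: complexify_def complex_eq_iff)
  ultimately show ?thesis by simp
qed

lemma open_in_space_realify:
  assumes "open_in_space d W"
  shows "open_in_space (2 * d) (realify ` W)"
proof -
  have "continuous_on (coord_space (2 * d)) complexify"
    unfolding complexify_def Complex_eq
    by (intro continuous_on_coordinatewise_then_product continuous_intros continuous_on_subset[OF continuous_on_product_coordinates])
       simp_all
  then have "open_in_space (2 * d) (coord_space (2 * d) \<inter> complexify -` W)"
    by (rule continuous_openin_preimage[OF _ _ assms]) simp
  moreover have "coord_space (2 * d) \<inter> complexify -` W = realify ` W"
  proof -
    have "W \<subseteq> coord_space d" using assms openin_imp_subset by blast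
    then show ?thesis by (force simp: image_iff)
  qed
  ultimately show ?thesis by simp
qed

section \<open>Comparison of the real quotient with the leaf space\<close>

text \<open>
  Let \<open>\<iota>\<close> map \<open>E\<close> into \<open>V\<close> such that the fibres of \<open>p\<close> correspond to orbits, and let \<open>\<rho>\<close> be a smooth map
  \<open>V \<rightarrow> E\<close> inverse to it up to the action.  The induced bijection \<open>f\<close> of the quotients is a
  diffeomorphism: for a slice chart \<open>\<phi>\<close>, the composite \<open>realify \<circ> \<phi> \<circ> f\<close> is a chart of the real
  quotient, with local sections obtained by applying \<open>\<rho>\<close> to the slice.  In these two charts \<open>f\<close> is
  the identification of \<open>\<real>\<^sup>2\<^sup>d\<close> with \<open>\<complex>\<^sup>d\<close>.
\<close>

lemma (in lvm) diffeomorphic_complex_quotient: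
  fixes E :: "(nat \<Rightarrow> complex) set" and p :: "(nat \<Rightarrow> complex) \<Rightarrow> 'b"
    and q :: "(nat \<Rightarrow> complex) \<Rightarrow> 'c"
  assumes q: "\<And>z w. q z = q w \<longleftrightarrow> same_orbit m \<Lambda> z w"
    and E: "E \<subseteq> coord_space N"
    and \<iota>: "\<And>k W i. open_in_space N W \<Longrightarrow> Ck_on k N W (\<lambda>y. \<iota> y i)"
      "\<And>z. z \<in> coord_space N \<Longrightarrow> \<iota> z \<in> coord_space n" "\<And>z. z \<in> E \<Longrightarrow> \<iota> z \<in> V"
    and p: "\<And>z w. z \<in> E \<Longrightarrow> w \<in> E \<Longrightarrow> p z = p w \<longleftrightarrow> same_orbit m \<Lambda> (\<iota> z) (\<iota> w)"
    and \<rho>: "\<And>z. z \<in> V \<Longrightarrow> \<rho> z \<in> E" "\<And>z. z \<in> V \<Longrightarrow> same_orbit m \<Lambda> z (\<iota> (\<rho> z))"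
    and \<rho>_smooth: "\<And>D W (\<zeta> :: (nat \<Rightarrow> real) \<Rightarrow> nat \<Rightarrow> complex) k i. open_in_space D W \<Longrightarrow>
        (\<And>i k. Ck_on k D W (\<lambda>y. \<zeta> y i)) \<Longrightarrow> (\<And>y. y \<in> W \<Longrightarrow> \<zeta> y \<in> V) \<Longrightarrow> Ck_on k D W (\<lambda>y. \<rho> (\<zeta> y) i)"
  shows "diffeomorphic (smooth_quotient N E p (2 * (n - m - 1))) (complex_quotient n V q (n - m - 1))"
proof -
  define d where "d = n - m - 1"
  define M where "M = smooth_quotient N E p (2 * d)"
  define M' where "M' = complex_quotient n V q d"
  have pts: "points M = p ` E" "points M' = q ` V" "mdim M = 2 * d" "mdim M' = d"
    by (auto simp: M_def M'_def smooth_quotient_def complex_quotient_def quotient_manifold_def)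
  define f where "f = (\<lambda>x. q (\<iota> (inv_into E p x)))"
  have f: "f (p z) = q (\<iota> z)" if "z \<in> E" for z
    unfolding f_def using p[of "inv_into E p (p z)" z] that q
    by (metis f_inv_into_f imageI inv_into_into)
  have f_surj: "f (p (\<rho> z)) = q z" if "z \<in> V" for z
    using f[OF \<rho>(1)[OF that]] \<rho>(2)[OF that] q by metis
  have bij: "bij_betw f (p ` E) (q ` V)"
    unfolding bij_betw_def
  proof
    show "inj_on f (p ` E)"
      using f p q by (auto intro!: inj_onI)
    show "f ` p ` E = q ` V"
      using f \<iota>(3) f_surj \<rho>(1) by (auto simp: image_iff) metis
  qed
  note f_img = bij[unfolded bij_betw_def, THEN conjunct2] and f_inj = bij[unfolded bij_betw_def, THEN conjunct1]
  define g where "g = inv_into (p ` E) f"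
  have g: "g u \<in> p ` E" "f (g u) = u" if "u \<in> q ` V" for u
    using bij that unfolding g_def bij_betw_def by (auto intro: inv_into_into f_inv_into_f)
  have chart: "\<exists>U \<phi> U' \<phi>'. (U, \<phi>) \<in> charts M' \<and> (U', \<phi>') \<in> charts M \<and> q z \<in> U \<and> g (q z) \<in> U' \<and>
      f ` U' \<subseteq> U \<and> g ` U \<subseteq> U' \<and> smooth_map_on (2 * d) (\<phi>' ` U') (\<phi> \<circ> f \<circ> inv_into U' \<phi>') \<and>
      smooth_map_on d (\<phi> ` U) (\<phi>' \<circ> g \<circ> inv_into U \<phi>)" if z: "z \<in> V" for z
  proof -
    obtain I v \<beta> where "lvm_slice n m \<Lambda> z I v \<beta> (n - m - 1)" using lvm_slice_exists[OF z] .
    then interpret S: lvm_slice n m \<Lambda> z I v \<beta> d unfolding d_def .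
    obtain U \<phi> where U: "(U, \<phi>) \<in> charts M'" and zU: "q z \<in> U"
      and sec: "\<And>y. y \<in> \<phi> ` U \<Longrightarrow> S.slice_point y \<in> V \<and> q (S.slice_point y) \<in> U \<and> \<phi> (q (S.slice_point y)) = y"
      and loc: "\<And>z. z \<in> V \<Longrightarrow> q z \<in> U \<Longrightarrow> \<exists>T Z. open_in_space n Z \<and> z \<in> Z \<and> Z \<subseteq> V \<and>
        (\<forall>x\<in>Z. S.near_slice (act m \<Lambda> T x) \<and> q x \<in> U \<and> \<phi> (q x) = S.slice_coord (act m \<Lambda> T x))"
      using S.slice_chart[OF q] unfolding M'_def by blast
    have U_facts: "U \<subseteq> q ` V" "openin (top_of_set V) {z \<in> V. q z \<in> U}" "inj_on \<phi> U" "open_in_space d (\<phi> ` U)"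
      using U unfolding M'_def complex_quotient_def quotient_manifold_def by auto
    define U' where "U' = {x \<in> p ` E. f x \<in> U}"
    define \<phi>' where "\<phi>' = realify \<circ> \<phi> \<circ> f"
    have fU': "f ` U' = U"
    proof (intro equalityI subsetI)
      fix u assume u: "u \<in> U"
      then have "u \<in> f ` p ` E" unfolding f_img using U_facts(1) by (rule subsetD[rotated])
      then obtain x where "u = f x" "x \<in> p ` E" by (rule imageE)
      then show "u \<in> f ` U'" using u unfolding U'_def by simp
    next
      fix u assume "u \<in> f ` U'"
      then obtain x where "u = f x" "x \<in> U'" by (rule imageE)
      then show "u \<in> U" by (simp add: U'_def)
    qed
    have gU: "g u \<in> U'" "f (g u) = u" if "u \<in> U" for u
      using g[OF subsetD[OF U_facts(1) that]] that by (simp_all add: U'_def)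
    have \<phi>U': "\<phi>' ` U' = realify ` \<phi> ` U"
      unfolding \<phi>'_def image_comp[symmetric] fU' ..
    have open': "open_in_space (2 * d) (\<phi>' ` U')"
      unfolding \<phi>U' by (rule open_in_space_realify[OF U_facts(4)])
    have cplx: "complexify y \<in> \<phi> ` U" if "y \<in> \<phi>' ` U'" for y
      using that unfolding \<phi>U' by auto
    have inj_realify: "inj realify" by (metis complexify_realify injI)
    have inj': "inj_on \<phi>' U'"
      unfolding \<phi>'_def
    proof (intro comp_inj_on)
      show "inj_on f U'" using f_inj by (rule inj_on_subset) (simp add: U'_def)
      show "inj_on \<phi> (f ` U')" unfolding fU' by (rule U_facts(3))
      show "inj_on realify (\<phi> ` f ` U')" using inj_realify by (rule inj_on_subset) simp
    qed
    have \<iota>_cont: "continuous_on (coord_space N) \<iota>"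
    proof (rule continuous_on_coordinatewise_then_product)
      show "continuous_on (coord_space N) (\<lambda>y. \<iota> y i)" for i
        by (rule Ck_on_imp_continuous[OF \<iota>(1)[of "coord_space N" 0]]) simp
    qed
    have pre_eq: "{z \<in> E. p z \<in> U'} = {z \<in> E. q (\<iota> z) \<in> U}"
    proof -
      have "p z \<in> U' \<longleftrightarrow> q (\<iota> z) \<in> U" if "z \<in> E" for z
        unfolding f[OF that, symmetric] using that by (simp add: U'_def)
      then show ?thesis by (rule Collect_cong[OF conj_cong[OF refl]])
    qed
    have "openin (top_of_set E) (E \<inter> \<iota> -` {z \<in> V. q z \<in> U})"
      by (rule continuous_openin_preimage[OF continuous_on_subset[OF \<iota>_cont E] _ U_facts(2)]) (use \<iota>(3) in auto)
    moreover have "E \<inter> \<iota> -` {z \<in> V. q z \<in> U} = {z \<in> E. p z \<in> U'}"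
      unfolding pre_eq using \<iota>(3) by auto
    ultimately have pre': "openin (top_of_set E) {z \<in> E. p z \<in> U'}" by simp
    have smooth': "smooth_map_on N {z \<in> E. p z \<in> U'} (\<phi>' \<circ> p)"
      unfolding smooth_map_on_def
    proof
      fix x assume "x \<in> {z \<in> E. p z \<in> U'}"
      then have x: "x \<in> E" "q (\<iota> x) \<in> U" unfolding pre_eq by auto
      obtain T Z where Z: "open_in_space n Z" "\<iota> x \<in> Z" "Z \<subseteq> V"
        "\<And>w. w \<in> Z \<Longrightarrow> S.near_slice (act m \<Lambda> T w) \<and> q w \<in> U \<and> \<phi> (q w) = S.slice_coord (act m \<Lambda> T w)"
        using loc[OF \<iota>(3)[OF x(1)] x(2)] by blast
      define W where "W = coord_space N \<inter> \<iota> -` Z"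
      have W: "open_in_space N W"
        unfolding W_def by (rule continuous_openin_preimage[OF \<iota>_cont _ Z(1)]) (use \<iota>(2) in auto)
      define h where "h = (\<lambda>y. realify (S.slice_coord (act m \<Lambda> T (\<iota> y))))"
      have "Ck_on k N W (\<lambda>y. h y l)" for k l
        unfolding h_def using Z(4)
        by (intro Ck_on_realify[OF W] S.Ck_on_slice_coord[OF W] \<iota>(1)[OF W]) (auto simp: W_def)
      moreover have "x \<in> W" using x(1) E Z(2) by (auto simp: W_def)
      moreover have "h y = (\<phi>' \<circ> p) y" if "y \<in> {z \<in> E. p z \<in> U'} \<inter> W" for y
        using that f Z(4)[of "\<iota> y"] by (simp add: h_def \<phi>'_def W_def)
      ultimately show "\<exists>W g. open_in_space N W \<and> x \<in> W \<and> (\<forall>l k. Ck_on k N W (\<lambda>y. g y l)) \<and>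
          (\<forall>y\<in>{z \<in> E. p z \<in> U'} \<inter> W. g y = (\<phi>' \<circ> p) y)"
        using W by blast
    qed
    define s where "s = (\<lambda>y. \<rho> (S.slice_point (complexify y)))"
    have s_smooth: "smooth_map_on (2 * d) (\<phi>' ` U') s"
    proof (rule smooth_map_onI[OF open' _ refl])
      have "Ck_on k (2 * d) (\<phi>' ` U') (\<lambda>y. S.slice_point (complexify y) i)" for i k
      proof -
        consider c where "\<And>y. S.slice_point y i = c" | j where "\<And>y. S.slice_point y i = y j"
          unfolding S.slice_point_def by (cases "i \<in> I"; cases "i < n") auto
        then show ?thesis
          by cases (simp_all add: Ck_on_const[OF open'] Ck_on_complexify[OF open'] del: Ck_on.simps)
      qed
      then show "Ck_on k (2 * d) (\<phi>' ` U') (\<lambda>y. s y l)" for k l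
        unfolding s_def using sec cplx by (intro \<rho>_smooth[OF open']) auto
    qed
    have s: "s y \<in> E \<and> p (s y) \<in> U' \<and> \<phi>' (p (s y)) = y" if y: "y \<in> \<phi>' ` U'" for y
    proof -
      let ?x = "S.slice_point (complexify y)"
      have x: "?x \<in> V" "q ?x \<in> U" "\<phi> (q ?x) = complexify y" using sec[OF cplx[OF y]] by auto
      then have "f (p (s y)) = q ?x" unfolding s_def by (intro f_surj)
      then show ?thesis using x \<rho>(1) by (simp add: s_def U'_def \<phi>'_def)
    qed
    have "(U', \<phi>') \<in> charts M"
      unfolding M_def smooth_quotient_def
      by (intro quotient_manifold_chartI[where s = s] pre' inj' open' smooth' s_smooth s) (simp add: U'_def)
    moreover have "smooth_map_on (2 * d) (\<phi>' ` U') (\<phi> \<circ> f \<circ> inv_into U' \<phi>')"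
    proof (rule smooth_map_onI[OF open' Ck_on_complexify[OF open']])
      fix y assume "y \<in> \<phi>' ` U'"
      then have "\<phi>' (inv_into U' \<phi>' y) = y" by (rule f_inv_into_f)
      then show "(\<phi> \<circ> f \<circ> inv_into U' \<phi>') y = complexify y"
        unfolding \<phi>'_def by (metis comp_apply complexify_realify)
    qed
    moreover have "smooth_map_on d (\<phi> ` U) (\<phi>' \<circ> g \<circ> inv_into U \<phi>)"
    proof (rule smooth_map_onI[OF U_facts(4)])
      show "Ck_on k d (\<phi> ` U) (\<lambda>y. realify y l)" for k l
        by (intro Ck_on_realify[OF U_facts(4)] Ck_on_coord[OF U_facts(4)])
      fix y assume "y \<in> \<phi> ` U"
      then have "\<phi> (inv_into U \<phi> y) = y" "inv_into U \<phi> y \<in> U" by (auto intro: f_inv_into_f inv_into_into)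
      then show "(\<phi>' \<circ> g \<circ> inv_into U \<phi>) y = realify y"
        using gU(2) by (simp add: \<phi>'_def)
    qed
    moreover have "g ` U \<subseteq> U'" using gU(1) by blast
    ultimately show ?thesis using U zU gU(1) fU' by blast
  qed
  have "smooth_between M M' f"
    unfolding smooth_between_def pts
  proof (intro conjI ballI)
    show "f ` p ` E \<subseteq> q ` V" using bij by (simp add: bij_betw_def)
    fix x assume x: "x \<in> p ` E"
    then obtain z where z: "z \<in> V" "f x = q z" using bij unfolding bij_betw_def by blast
    have "g (q z) = x" unfolding g_def z(2)[symmetric] using bij x unfolding bij_betw_def by (simp add: inv_into_f_f)
    then show "\<exists>(U, \<phi>)\<in>charts M. \<exists>(W, \<psi>)\<in>charts M'. x \<in> U \<and> f ` U \<subseteq> W \<and>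
        smooth_map_on (2 * d) (\<phi> ` U) (\<psi> \<circ> f \<circ> inv_into U \<phi>)"
      using chart[OF z(1)] by blast
  qed
  moreover have "smooth_between M' M g"
    unfolding smooth_between_def pts
  proof (intro conjI ballI)
    show "g ` q ` V \<subseteq> p ` E" using g(1) by blast
    fix x assume "x \<in> q ` V"
    then obtain z where z: "x = q z" "z \<in> V" by (rule imageE)
    show "\<exists>(U, \<phi>)\<in>charts M'. \<exists>(W, \<psi>)\<in>charts M. x \<in> U \<and> g ` U \<subseteq> W \<and>
        smooth_map_on d (\<phi> ` U) (\<psi> \<circ> g \<circ> inv_into U \<phi>)"
      unfolding z(1) using chart[OF z(2)] by blast
  qed
  ultimately have "diffeomorphic M M'"
    unfolding diffeomorphic_def using bij by (intro exI[of _ f]) (simp add: pts g_def)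
  then show ?thesis unfolding M_def M'_def d_def .
qed

section \<open>Leaves and points of projective space as orbits\<close>

lemma proj_eq_iff: "proj z = proj w \<longleftrightarrow> (\<exists>c. c \<noteq> 0 \<and> w = (\<lambda>i. c * z i))"
proof
  assume eq: "proj z = proj w"
  have "w \<in> proj z" unfolding eq unfolding proj_def by (intro CollectI exI[of _ 1]) simp
  then obtain c where "w = (\<lambda>i. c * z i)" "c \<noteq> 0" unfolding proj_def by (elim CollectE exE conjE)
  then show "\<exists>c. c \<noteq> 0 \<and> w = (\<lambda>i. c * z i)" by (intro exI[of _ c] conjI)
next
  assume "\<exists>c. c \<noteq> 0 \<and> w = (\<lambda>i. c * z i)"
  then obtain c where c: "c \<noteq> 0" "w = (\<lambda>i. c * z i)" by (elim exE conjE)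
  show "proj z = proj w"
  proof (intro equalityI subsetI)
    fix x assume "x \<in> proj z"
    then obtain a where "x = (\<lambda>i. a * z i)" "a \<noteq> 0" unfolding proj_def by (elim CollectE exE conjE)
    then show "x \<in> proj w"
      using c unfolding proj_def by (intro CollectI exI[of _ "a / c"]) simp
  next
    fix x assume "x \<in> proj w"
    then obtain a where "x = (\<lambda>i. a * w i)" "a \<noteq> 0" unfolding proj_def by (elim CollectE exE conjE)
    then show "x \<in> proj z"
      using c unfolding proj_def by (intro CollectI exI[of _ "a * c"]) (simp add: mult.assoc)
  qed
qed

lemma same_orbit_scale:
  assumes "c \<noteq> 0"
  shows "same_orbit m \<Lambda> z (\<lambda>i. c * z i)"
proof -
  have "(\<lambda>i. c * z i) = act m \<Lambda> (\<lambda>j. if j = m then Ln c else 0) z"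
    using assms by (simp add: act_def sum_with_ones)
  then show ?thesis using same_orbit_act[of m \<Lambda> z] by simp
qed

text \<open>
  For \<open>m = 0\<close> the action is the one by homotheties.  Together with the description of \<open>V\<close> in that
  case, this makes projective space an instance of the general construction.
\<close>

lemma same_orbit_0_iff: "same_orbit 0 \<Lambda> z w \<longleftrightarrow> proj z = proj w"
proof
  assume "same_orbit 0 \<Lambda> z w"
  then obtain T where "w = act 0 \<Lambda> T z" unfolding same_orbit_def by blast
  then show "proj z = proj w"
    unfolding proj_eq_iff by (intro exI[of _ "exp (T 0)"]) (simp add: act_def with_ones_def)
next
  assume "proj z = proj w"
  then obtain c where "c \<noteq> 0" "w = (\<lambda>i. c * z i)" unfolding proj_eq_iff by (elim exE conjE)
  then show "same_orbit 0 \<Lambda> z w" using same_orbit_scale by simp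
qed

lemma leaf_eq_iff: "leaf m \<Lambda> z = leaf m \<Lambda> w \<longleftrightarrow> same_orbit m \<Lambda> z w"
proof
  assume eq: "leaf m \<Lambda> z = leaf m \<Lambda> w"
  have "proj w \<in> leaf m \<Lambda> z"
    unfolding eq unfolding leaf_def by (intro CollectI exI[of _ "\<lambda>_. 0"]) (simp add: coord_space_def)
  then obtain T where "proj w = proj (\<lambda>i. exp (\<Sum>j<m. \<Lambda> i j * T j) * z i)"
    unfolding leaf_def by (elim CollectE exE conjE)
  from proj_eq_iff[THEN iffD1, OF this[symmetric]]
  obtain c where c: "c \<noteq> 0" "w = (\<lambda>i. c * (exp (\<Sum>j<m. \<Lambda> i j * T j) * z i))" by (elim exE conjE)
  have "(\<lambda>i. exp (\<Sum>j<m. \<Lambda> i j * T j) * z i) = act m \<Lambda> (\<lambda>j. if j < m then T j else 0) z"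
    by (simp add: act_def sum_with_ones)
  then have "same_orbit m \<Lambda> z (\<lambda>i. exp (\<Sum>j<m. \<Lambda> i j * T j) * z i)"
    using same_orbit_act[of m \<Lambda> z] by simp
  then show "same_orbit m \<Lambda> z w"
    unfolding c(2) by (rule same_orbit_trans[OF _ same_orbit_scale[OF c(1)]])
next
  have sub: "leaf m \<Lambda> w \<subseteq> leaf m \<Lambda> z" if orb: "same_orbit m \<Lambda> z w" for z w
  proof
    fix x assume "x \<in> leaf m \<Lambda> w"
    then obtain S where S: "x = proj (\<lambda>i. exp (\<Sum>j<m. \<Lambda> i j * S j) * w i)"
      unfolding leaf_def by (elim CollectE exE conjE)
    obtain T where T: "w = act m \<Lambda> T z" using orb unfolding same_orbit_def by blast
    define R where "R = (\<lambda>j. if j < m then S j + T j else 0)"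
    have "(\<lambda>i. exp (\<Sum>j<m. \<Lambda> i j * S j) * w i) = (\<lambda>i. exp (T m) * (exp (\<Sum>j<m. \<Lambda> i j * R j) * z i))"
      by (simp add: T act_def sum_with_ones R_def distrib_left sum.distrib exp_add mult.assoc mult.left_commute)
    then have "proj (\<lambda>i. exp (\<Sum>j<m. \<Lambda> i j * R j) * z i) = x"
      unfolding S by (intro proj_eq_iff[THEN iffD2] exI[of _ "exp (T m)"] conjI) simp_all
    then have "x = proj (\<lambda>i. exp (\<Sum>j<m. \<Lambda> i j * R j) * z i)" ..
    then show "x \<in> leaf m \<Lambda> z"
      unfolding leaf_def by (intro CollectI exI[of _ R]) (simp add: R_def coord_space_def)
  qed
  show "leaf m \<Lambda> z = leaf m \<Lambda> w" if "same_orbit m \<Lambda> z w"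
    using sub[OF same_orbit_sym[OF that]] sub[OF that] by (rule equalityI)
qed

lemma cone_V_0: "cone_V n 0 \<Lambda> = coord_space n - {\<lambda>i. 0}"
proof -
  have "zero_in_conv 0 \<Lambda> (support n z) \<longleftrightarrow> z \<noteq> (\<lambda>i. 0)" if z: "z \<in> coord_space n" for z
  proof
    assume "zero_in_conv 0 \<Lambda> (support n z)"
    then show "z \<noteq> (\<lambda>i. 0)" by (auto simp: zero_in_conv_def support_def)
  next
    assume "z \<noteq> (\<lambda>i. 0)"
    then obtain k where "z k \<noteq> 0" by auto
    then have k: "k \<in> support n z" using z by (auto simp: support_def coord_space_def not_less[symmetric])
    then have "(\<Sum>i\<in>support n z. if i = k then 1 else 0 :: real) = 1" by simp
    then show "zero_in_conv 0 \<Lambda> (support n z)"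
      unfolding zero_in_conv_def by (intro exI[of _ "\<lambda>i. if i = k then 1 else 0"]) simp
  qed
  then show ?thesis by (auto simp: cone_V_iff)
qed

section \<open>Admissible matrices\<close>

text \<open>
  The convex combination is realised by a point \<open>z\<close> of the link with \<open>\<bar>z\<^sub>i\<bar>\<^sup>2 = c\<^sub>i\<close>.  Surjectivity of the
  differential there says that the columns \<open>(A\<^sub>i, 1)\<close> with \<open>i \<in> I\<close> have rank \<open>p + 1\<close>.
\<close>

lemma admissible_card:
  assumes adm: "admissible n p A" and I: "I \<subseteq> {..<n}" "conv_zero p (with_ones p A) I c"
  shows "card I > p"
proof -
  have fI: "finite I" using I(1) finite_subset by blast
  define z where "z = (\<lambda>i. if i \<in> I then of_real (sqrt (c i)) else 0 :: complex)"
  have nz: "(norm (z i))\<^sup>2 = (if i \<in> I then c i else 0)" for i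
    using I(2) by (simp add: z_def conv_zero_def)
  have "(\<Sum>i<n. a i * (norm (z i))\<^sup>2) = (\<Sum>i\<in>I. c i * a i)" for a
    unfolding nz using I(1) by (intro sum.mono_neutral_cong_right) auto
  from this this[of "\<lambda>_. 1"] have "z \<in> link_set n p A"
    using I unfolding conv_zero_with_ones link_set_def by (auto simp: coord_space_def z_def)
  then have nd: "nondegenerate_at n p A z" using adm unfolding admissible_def by blast
  have "\<exists>x. (\<forall>j\<le>p. (\<Sum>i\<in>I. with_ones p A i j * x i) = (if j = k then 1 else 0 :: real))" for k
  proof -
    obtain v where v: "\<And>j. j < p \<Longrightarrow> (\<Sum>i<n. A i j * (2 * Re (cnj (z i) * v i))) = (if j = k then 1 else 0)"
      "(\<Sum>i<n. 2 * Re (cnj (z i) * v i)) = (if p = k then 1 else 0)"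
      using nd[unfolded nondegenerate_at_def, rule_format, of "\<lambda>j. if j = k then 1 else 0" "if p = k then 1 else 0"]
      by blast
    define x where "x = (\<lambda>i. 2 * Re (cnj (z i) * v i))"
    have "(\<Sum>i\<in>I. with_ones p A i j * x i) = (\<Sum>i<n. with_ones p A i j * x i)" for j
      using I(1) by (intro sum.mono_neutral_left) (auto simp: z_def x_def)
    moreover have "(\<Sum>i<n. with_ones p A i j * x i) = (if j = k then 1 else 0)" if "j \<le> p" for j
    proof (cases "j = p")
      case True
      then show ?thesis using v(2) by (simp add: with_ones_def x_def)
    next
      case False
      then show ?thesis using v(1)[of j] that by (simp add: with_ones_def x_def)
    qed
    ultimately show ?thesis by (intro exI[of _ x]) simp
  qed
  from choice[OF allI[OF this]] obtain x
    where "\<forall>k. \<forall>j\<le>p. (\<Sum>i\<in>I. with_ones p A i j * x k i) = (if j = k then 1 else 0 :: real)" ..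
  then have x: "\<And>k j. j \<le> p \<Longrightarrow> (\<Sum>i\<in>I. with_ones p A i j * x k i) = (if j = k then 1 else 0 :: real)"
    by simp
  show ?thesis
  proof (rule dual_basis[OF fI finite_atMost[of p], of "with_ones p A"])
    fix v k assume ker: "\<And>i. i \<in> I \<Longrightarrow> (\<Sum>j\<le>p. with_ones p A i j * v j) = 0" and k: "k \<in> {..p}"
    have "0 = (\<Sum>i\<in>I. x k i * (\<Sum>j\<le>p. with_ones p A i j * v j))" using ker by simp
    also have "\<dots> = (\<Sum>j\<le>p. v j * (\<Sum>i\<in>I. with_ones p A i j * x k i))"
      unfolding sum_distrib_left by (subst sum.swap) (simp add: mult_ac)
    also have "\<dots> = (\<Sum>j\<le>p. v j * (if j = k then 1 else 0))" using x by (intro sum.cong) auto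
    also have "\<dots> = v k" using k by (simp add: if_distrib cong: if_cong)
    finally show "v k = 0" by simp
  next
    fix I' assume "I' \<subseteq> I" "card I' = card {..p}"
    then show "p < card I" using card_mono[OF fI, of I'] by simp
  qed
qed

lemma admissible_conv_zero:
  assumes "admissible n p A"
  obtains c where "conv_zero p (with_ones p A) {..<n} c"
proof -
  obtain z where "z \<in> link_set n p A" using assms unfolding admissible_def by blast
  then have "conv_zero p (with_ones p A) {..<n} (\<lambda>i. (norm (z i))\<^sup>2)"
    unfolding conv_zero_with_ones link_set_def by (auto simp: mult.commute)
  then show thesis by (rule that)
qed

lemma admissible_imp_lvm:
  assumes "admissible n (2 * m) A"
  shows "lvm n m (\<lambda>i. complexify (A i))" "siegel n m (\<lambda>i. complexify (A i))" "n > 2 * m"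
proof -
  show "lvm n m (\<lambda>i. complexify (A i))"
    unfolding lvm_def weakly_hyperbolic_def zero_in_conv_realify realify_complexify
    using admissible_card[OF assms] by blast
  obtain c where c: "conv_zero (2 * m) (with_ones (2 * m) A) {..<n} c"
    using admissible_conv_zero[OF assms] .
  then show "siegel n m (\<lambda>i. complexify (A i))"
    unfolding siegel_def zero_in_conv_realify by auto
  show "n > 2 * m" using admissible_card[OF assms _ c] by simp
qed

text \<open>
  Leaves are sets of points of projective space, and for \<open>m = 0\<close> the quotient consists of these
  points themselves; hence the two forms of the hypothesis.
\<close>

lemma admits_LVM_structureI:
  assumes adm: "admissible n (2 * m) A"
    and diffeo: "\<And>q. (\<And>z w. q z = q w \<longleftrightarrow> same_orbit m (\<lambda>i. complexify (A i)) z w) \<Longrightarrow>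
      diffeomorphic M (complex_quotient n (cone_V n m (\<lambda>i. complexify (A i))) (q :: _ \<Rightarrow> (nat \<Rightarrow> complex) set set) (n - m - 1))"
    and diffeo0: "\<And>q. (\<And>z w. q z = q w \<longleftrightarrow> same_orbit m (\<lambda>i. complexify (A i)) z w) \<Longrightarrow>
      diffeomorphic M (complex_quotient n (cone_V n m (\<lambda>i. complexify (A i))) (q :: _ \<Rightarrow> (nat \<Rightarrow> complex) set) (n - m - 1))"
  shows "admits_LVM_structure M"
proof (cases "m = 0")
  case False
  have "diffeomorphic M (LVM_manifold n m (\<lambda>i. complexify (A i)))"
    unfolding LVM_manifold_def using diffeo[of "leaf m (\<lambda>i. complexify (A i))"] leaf_eq_iff by blast
  then show ?thesis
    using admissible_imp_lvm[OF adm] False unfolding admits_LVM_structure_def lvm_def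
    by (intro disjI1 exI[of _ n] exI[of _ m] exI[of _ "\<lambda>i. complexify (A i)"] conjI) simp_all
next
  case True
  have "diffeomorphic M (projective_space n)"
    using diffeo0[of proj] same_orbit_0_iff True
    unfolding projective_space_def by (simp add: cone_V_0)
  moreover have "n > 0" using admissible_imp_lvm(3)[OF adm] by simp
  ultimately show ?thesis
    unfolding admits_LVM_structure_def by (intro disjI2 exI[of _ n] conjI)
qed

section \<open>Links as LV-M manifolds\<close>

lemma (in lvm) diffeomorphic_proj_link:
  assumes q: "\<And>z w. q z = q w \<longleftrightarrow> same_orbit m \<Lambda> z w"
  shows "diffeomorphic (smooth_quotient n (link_set n (2 * m) (\<lambda>i. realify (\<Lambda> i))) proj (2 * (n - m - 1)))
    (complex_quotient n V q (n - m - 1))"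
proof (rule diffeomorphic_complex_quotient[OF q, where \<iota> = "\<lambda>z. z" and \<rho> = to_link])
  let ?X = "link_set n (2 * m) (\<lambda>i. realify (\<Lambda> i))"
  show "?X \<subseteq> coord_space n" by (auto simp: link_set_def)
  show "z \<in> V" if "z \<in> ?X" for z using that balanced_in_cone_V unfolding link_set_iff by blast
  show "proj z = proj w \<longleftrightarrow> same_orbit m \<Lambda> z w" if z: "z \<in> ?X" and w: "w \<in> ?X" for z w
  proof
    assume "proj z = proj w"
    then show "same_orbit m \<Lambda> z w" using same_orbit_scale[of _ m \<Lambda> z] unfolding proj_eq_iff by auto
  next
    assume "same_orbit m \<Lambda> z w"
    then obtain T where T: "w = act m \<Lambda> T z" unfolding same_orbit_def by blast
    have "T j = 0" if "j < m" for j
      using act_between_balanced(1)[of z "\<lambda>_. 0" T j] that z w unfolding link_set_iff T by blast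
    then have "w = (\<lambda>i. exp (T m) * z i)" by (simp add: T act_def sum_with_ones)
    then show "proj z = proj w" unfolding proj_eq_iff by (intro exI[of _ "exp (T m)"]) simp
  qed
  show "Ck_on k n W (\<lambda>y. y i)" if "open_in_space n W" for k W i using that by (rule Ck_on_coord)
  show "Ck_on k D W (\<lambda>y. to_link (\<zeta> y) i)"
    if "open_in_space D W" "\<And>i k. Ck_on k D W (\<lambda>y. \<zeta> y i)" "\<And>y. y \<in> W \<Longrightarrow> \<zeta> y \<in> V"
    for D W k i and \<zeta> :: "(nat \<Rightarrow> real) \<Rightarrow> nat \<Rightarrow> complex"
    using that by (rule Ck_on_to_link)
qed (simp_all add: to_link to_link_same_orbit)

text \<open>
  One more row and one more column, which express \<open>\<Sum>i<n. \<bar>z\<^sub>i\<bar>\<^sup>2 = \<bar>z\<^sub>n\<bar>\<^sup>2\<close>.  The link of the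
  suspension is, up to the factor \<open>\<surd>2\<close>, the product of the link with a circle; its projective link is
  the link itself, as \<open>z\<^sub>n\<close> can be normalised to \<open>1\<close>.
\<close>

definition suspension :: "nat \<Rightarrow> nat \<Rightarrow> (nat \<Rightarrow> nat \<Rightarrow> real) \<Rightarrow> nat \<Rightarrow> nat \<Rightarrow> real" where
  "suspension n p A i j = (if j < p then (if i < n then A i j else 0) else (if i < n then 1 else - 1))"

lemma link_set_suspension:
  "z \<in> link_set (n + 1) (p + 1) (suspension n p A) \<longleftrightarrow>
     z \<in> coord_space (n + 1) \<and> (\<forall>j<p. (\<Sum>i<n. A i j * (norm (z i))\<^sup>2) = 0) \<and>
     (\<Sum>i<n. (norm (z i))\<^sup>2) = 1 / 2 \<and> (norm (z n))\<^sup>2 = 1 / 2"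
proof -
  have "(\<forall>j<p + 1. (\<Sum>i<n + 1. suspension n p A i j * (norm (z i))\<^sup>2) = 0) \<longleftrightarrow>
      (\<forall>j<p. (\<Sum>i<n. A i j * (norm (z i))\<^sup>2) = 0) \<and> (\<Sum>i<n. (norm (z i))\<^sup>2) - (norm (z n))\<^sup>2 = 0"
    by (auto simp: suspension_def less_Suc_eq)
  then show ?thesis unfolding link_set_def by auto
qed

lemma admissible_suspension:
  assumes adm: "admissible n p A"
  shows "admissible (n + 1) (p + 1) (suspension n p A)"
  unfolding admissible_def
proof (intro conjI ballI)
  obtain x where x: "x \<in> link_set n p A" using adm unfolding admissible_def by blast
  define s where "s = complex_of_real (1 / sqrt 2)"
  have s: "(norm (s * t))\<^sup>2 = (norm t)\<^sup>2 / 2" for t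
    by (simp add: s_def norm_mult norm_divide power_divide)
  define y where "y = (\<lambda>i. if i < n then s * x i else if i = n then s * 1 else 0)"
  have "y \<in> link_set (n + 1) (p + 1) (suspension n p A)"
    using x unfolding link_set_suspension
    by (auto simp: y_def s link_set_def coord_space_def sum_divide_distrib[symmetric] simp del: mult_1_right)
  then show "link_set (n + 1) (p + 1) (suspension n p A) \<noteq> {}" by blast
next
  fix z assume "z \<in> link_set (n + 1) (p + 1) (suspension n p A)"
  then have z: "z \<in> coord_space (n + 1)" "\<And>j. j < p \<Longrightarrow> (\<Sum>i<n. A i j * (norm (z i))\<^sup>2) = 0"
    "(\<Sum>i<n. (norm (z i))\<^sup>2) = 1 / 2" "(norm (z n))\<^sup>2 = 1 / 2"
    unfolding link_set_suspension by blast+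
  define s where "s = complex_of_real (sqrt 2)"
  have s: "(norm (s * t))\<^sup>2 = (norm t)\<^sup>2 * 2" for t
    by (simp add: s_def norm_mult power_mult_distrib)
  define x where "x = (\<lambda>i. if i < n then s * z i else 0)"
  have "(\<Sum>i<n. a i * (norm (x i))\<^sup>2) = (\<Sum>i<n. a i * (norm (z i))\<^sup>2) * 2" for a
    unfolding sum_distrib_right by (intro sum.cong) (auto simp: x_def s)
  from this this[of "\<lambda>_. 1"] have "x \<in> link_set n p A"
    using z by (simp add: link_set_def coord_space_def) (simp add: x_def)
  then have nd: "nondegenerate_at n p A x" using adm unfolding admissible_def by blast
  show "nondegenerate_at (n + 1) (p + 1) (suspension n p A) z"
    unfolding nondegenerate_at_def
  proof (intro allI)
    fix b :: "nat \<Rightarrow> real" and c :: real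
    obtain v where v: "\<And>j. j < p \<Longrightarrow> (\<Sum>i<n. A i j * (2 * Re (cnj (x i) * v i))) = b j"
      "(\<Sum>i<n. 2 * Re (cnj (x i) * v i)) = (c + b p) / 2"
      using nd[unfolded nondegenerate_at_def, rule_format, of b "(c + b p) / 2"] by blast
    \<comment> \<open>Since \<open>\<bar>z\<^sub>n\<bar>\<^sup>2 = 1 / 2\<close>, this multiple of \<open>z\<^sub>n\<close> changes \<open>\<bar>z\<^sub>n\<bar>\<^sup>2\<close> at the rate \<open>(c - b\<^sub>p) / 2\<close>.\<close>
    define w where "w = (\<lambda>i. if i < n then s * v i else if i = n then of_real ((c - b p) / 2) * z n else 0)"
    have w: "Re (cnj (z i) * w i) = Re (cnj (x i) * v i)" if "i < n" for i
      using that by (simp add: w_def x_def s_def algebra_simps)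
    have "w n = of_real ((c - b p) / 2) * z n" by (simp add: w_def)
    then have "cnj (z n) * w n = of_real ((c - b p) / 2) * of_real ((norm (z n))\<^sup>2)"
      unfolding complex_norm_square by (simp only: mult_ac)
    then have "cnj (z n) * w n = of_real ((c - b p) / 2 * (1 / 2))" by (simp only: z(4) of_real_mult)
    then have wn: "2 * Re (cnj (z n) * w n) = (c - b p) / 2" by (simp only: Re_complex_of_real)
    define X where "X = (\<lambda>i. 2 * Re (cnj (z i) * w i))"
    have Xw: "X i = 2 * Re (cnj (x i) * v i)" if "i < n" for i
      unfolding X_def w[OF that] ..
    have X: "(\<Sum>i<n. A i j * X i) = b j" if "j < p" for j
      unfolding v(1)[OF that, symmetric] by (intro sum.cong refl) (simp only: lessThan_iff Xw)
    have X1: "(\<Sum>i<n. X i) = (c + b p) / 2" "X n = (c - b p) / 2"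
      unfolding v(2)[symmetric] by (intro sum.cong refl, simp only: lessThan_iff Xw) (simp only: X_def wn)
    have "(\<Sum>i<n + 1. X i) = c" using X1 by (simp add: field_simps)
    moreover have "(\<Sum>i<n + 1. suspension n p A i j * X i) = b j" if "j < p + 1" for j
      using X X1 that by (cases "j = p") (simp_all add: suspension_def field_simps)
    moreover have "w \<in> coord_space (n + 1)" by (auto simp: w_def coord_space_def)
    ultimately show "\<exists>v\<in>coord_space (n + 1). (\<forall>j<p + 1. (\<Sum>i<n + 1. suspension n p A i j * (2 * Re (cnj (z i) * v i))) = b j) \<and>
        (\<Sum>i<n + 1. 2 * Re (cnj (z i) * v i)) = c"
      unfolding X_def by (intro bexI[of _ w] conjI allI impI)
  qed
qed

lemma (in lvm) balanced_scaled:
  assumes "\<kappa> > 0" "\<And>j. j \<le> 2 * m \<Longrightarrow> (\<Sum>i<n. (norm (z i))\<^sup>2 * B i j) = (if j = 2 * m then \<kappa> else 0)"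
  shows "balanced n (2 * m) B (\<lambda>i. (norm (z i))\<^sup>2) (\<lambda>k. if k = 2 * m then - ln \<kappa> else 0)"
proof -
  have "pairing (2 * m) B i (\<lambda>k. if k = 2 * m then - ln \<kappa> else 0) = - ln \<kappa>" for i
    by (simp add: pairing_def if_distrib cong: if_cong)
  then have "(\<Sum>i<n. (norm (z i))\<^sup>2 * exp (pairing (2 * m) B i (\<lambda>k. if k = 2 * m then - ln \<kappa> else 0)) * B i j)
      = (\<Sum>i<n. (norm (z i))\<^sup>2 * B i j) / \<kappa>" for j
    using assms(1) by (simp add: exp_minus sum_divide_distrib field_simps)
  then show ?thesis unfolding balanced_def using assms by simp
qed

text \<open>
  For a configuration that is a suspension, the last coordinate never vanishes on the link and
  may be fixed.  The scale \<open>r\<close> covers both the link (\<open>r = 1\<close>) and its product with the circle,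
  which is the link of a suspension stretched by \<open>\<surd>2\<close>.
\<close>

lemma (in lvm) diffeomorphic_scaled_link:
  assumes \<Lambda>: "\<And>i. realify (\<Lambda> i) = suspension n\<^sub>0 p A i" and dims: "n = n\<^sub>0 + 1" "2 * m = p + 1"
    and r: "r > 0" and q: "\<And>z w. q z = q w \<longleftrightarrow> same_orbit m \<Lambda> z w"
  shows "diffeomorphic (smooth_quotient n\<^sub>0 ((\<lambda>z i. of_real r * z i) ` link_set n\<^sub>0 p A) id (2 * (n - m - 1)))
    (complex_quotient n V q (n - m - 1))"
proof -
  define E where "E = (\<lambda>z i. complex_of_real r * z i) ` link_set n\<^sub>0 p A"
  define \<iota> where "\<iota> = (\<lambda>z::nat \<Rightarrow> complex. z(n\<^sub>0 := complex_of_real r))"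
  define \<rho> where "\<rho> = (\<lambda>z i. if i < n\<^sub>0 then complex_of_real r * (to_link z i / to_link z n\<^sub>0) else 0)"
  have B_eq: "B = with_ones (p + 1) (suspension n\<^sub>0 p A)" unfolding dims(2) \<Lambda> ..
  have E_sub: "E \<subseteq> coord_space n\<^sub>0" by (auto simp: E_def link_set_def coord_space_def)
  have bal: "balanced n (2 * m) B (\<lambda>i. (norm (\<iota> z i))\<^sup>2) (\<lambda>k. if k = 2 * m then - ln (2 * r\<^sup>2) else 0)"
    if z: "z \<in> E" for z
  proof (rule balanced_scaled)
    obtain x where x: "x \<in> link_set n\<^sub>0 p A" "z = (\<lambda>i. of_real r * x i)" using z unfolding E_def by blast
    have sum: "(\<Sum>i<n\<^sub>0. (norm (\<iota> z i))\<^sup>2 * a i) = r\<^sup>2 * (\<Sum>i<n\<^sub>0. a i * (norm (x i))\<^sup>2)" for a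
      unfolding sum_distrib_left
      by (intro sum.cong) (auto simp: \<iota>_def x(2) norm_mult power_mult_distrib)
    have last: "(norm (\<iota> z n\<^sub>0))\<^sup>2 = r\<^sup>2" by (simp add: \<iota>_def)
    show "(\<Sum>i<n. (norm (\<iota> z i))\<^sup>2 * B i j) = (if j = 2 * m then 2 * r\<^sup>2 else 0)" if j: "j \<le> 2 * m" for j
    proof -
      have "(\<Sum>i<n. (norm (\<iota> z i))\<^sup>2 * B i j) = (\<Sum>i<n\<^sub>0. (norm (\<iota> z i))\<^sup>2 * B i j) + r\<^sup>2 * B n\<^sub>0 j"
        by (simp add: dims(1) last)
      also have "\<dots> = r\<^sup>2 * (\<Sum>i<n\<^sub>0. B i j * (norm (x i))\<^sup>2) + r\<^sup>2 * B n\<^sub>0 j"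
        unfolding sum ..
      also have "\<dots> = (if j = 2 * m then 2 * r\<^sup>2 else 0)"
      proof -
        consider "j < p" | "j = p" | "j = p + 1" using j dims(2) by linarith
        then show ?thesis
          using x(1) dims(2) unfolding B_eq by cases (simp_all add: with_ones_def suspension_def link_set_def)
      qed
      finally show ?thesis .
    qed
  qed (use r in simp)
  have \<iota>_coord: "\<iota> z \<in> coord_space n" if "z \<in> coord_space n\<^sub>0" for z
    using that by (auto simp: \<iota>_def coord_space_def dims(1))
  have to_link': "to_link z \<in> link_set (n\<^sub>0 + 1) (p + 1) (suspension n\<^sub>0 p A)" if "z \<in> V" for z
    using to_link[OF that] unfolding \<Lambda> dims .
  have nz: "to_link z n\<^sub>0 \<noteq> 0" if "z \<in> V" for z
    using to_link'[OF that] unfolding link_set_suspension by auto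
  have "diffeomorphic (smooth_quotient n\<^sub>0 E id (2 * (n - m - 1))) (complex_quotient n V q (n - m - 1))"
  proof (rule diffeomorphic_complex_quotient[OF q E_sub, where \<iota> = \<iota> and \<rho> = \<rho>])
    show "\<iota> z \<in> coord_space n" if "z \<in> coord_space n\<^sub>0" for z using that by (rule \<iota>_coord)
    show "\<iota> z \<in> V" if "z \<in> E" for z
      using balanced_in_cone_V[OF \<iota>_coord bal] that E_sub by blast
    show "Ck_on k n\<^sub>0 W (\<lambda>y. \<iota> y i)" if W: "open_in_space n\<^sub>0 W" for k W i
      unfolding \<iota>_def by (cases "i = n\<^sub>0") (simp_all add: Ck_on_const[OF W] Ck_on_coord[OF W] del: Ck_on.simps)
    show "id z = id w \<longleftrightarrow> same_orbit m \<Lambda> (\<iota> z) (\<iota> w)" if z: "z \<in> E" and w: "w \<in> E" for z w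
    proof
      assume "id z = id w"
      then show "same_orbit m \<Lambda> (\<iota> z) (\<iota> w)" using same_orbit_refl by simp
    next
      assume "same_orbit m \<Lambda> (\<iota> z) (\<iota> w)"
      then obtain T where T: "\<iota> w = act m \<Lambda> T (\<iota> z)" unfolding same_orbit_def by blast
      have "T j = 0" if "j < m" for j
        using act_between_balanced(1)[OF \<iota>_coord bal[OF z], of T j] that bal[OF w] z E_sub unfolding T by blast
      then have eq: "\<iota> w i = exp (T m) * \<iota> z i" for i by (simp add: T act_def sum_with_ones)
      have "exp (T m) = 1" using eq[of n\<^sub>0] r by (simp add: \<iota>_def)
      moreover have "z n\<^sub>0 = 0" "w n\<^sub>0 = 0" using z w E_sub by (auto simp: coord_space_def)
      ultimately have "w i = z i" for i
        using eq[of i] by (cases "i = n\<^sub>0") (simp_all add: \<iota>_def)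
      then show "id z = id w" by (simp add: fun_eq_iff)
    qed
    show "\<rho> z \<in> E" if z: "z \<in> V" for z
    proof -
      define y where "y = (\<lambda>i. if i < n\<^sub>0 then to_link z i / to_link z n\<^sub>0 else 0)"
      have t: "\<And>j. j < p \<Longrightarrow> (\<Sum>i<n\<^sub>0. A i j * (norm (to_link z i))\<^sup>2) = 0"
        "(\<Sum>i<n\<^sub>0. (norm (to_link z i))\<^sup>2) = 1 / 2" "(norm (to_link z n\<^sub>0))\<^sup>2 = 1 / 2"
        using to_link'[OF z] unfolding link_set_suspension by blast+
      have "(\<Sum>i<n\<^sub>0. a i * (norm (y i))\<^sup>2) = 2 * (\<Sum>i<n\<^sub>0. a i * (norm (to_link z i))\<^sup>2)" for a
        unfolding sum_distrib_left by (intro sum.cong) (auto simp: y_def norm_divide power_divide t(3))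
      from this this[of "\<lambda>_. 1"] have "y \<in> link_set n\<^sub>0 p A"
        using t by (simp add: link_set_def coord_space_def) (simp add: y_def)
      moreover have "\<rho> z = (\<lambda>i. of_real r * y i)" by (auto simp: \<rho>_def y_def)
      ultimately show ?thesis unfolding E_def by blast
    qed
    show "same_orbit m \<Lambda> z (\<iota> (\<rho> z))" if z: "z \<in> V" for z
    proof -
      have "to_link z i = 0" if "i > n\<^sub>0" for i
        using to_link'[OF z] that by (simp add: link_set_def coord_space_def)
      then have "\<iota> (\<rho> z) = (\<lambda>i. of_real r / to_link z n\<^sub>0 * to_link z i)"
        using nz[OF z] by (auto simp: \<iota>_def \<rho>_def fun_eq_iff not_less le_less)
      then show ?thesis
        using same_orbit_trans[OF to_link_same_orbit same_orbit_scale[of "of_real r / to_link z n\<^sub>0"]] nz[OF z] r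
        by simp
    qed
    show "Ck_on k D W (\<lambda>y. \<rho> (\<zeta> y) i)"
      if W: "open_in_space D W" and \<zeta>: "\<And>i k. Ck_on k D W (\<lambda>y. \<zeta> y i)" and V: "\<And>y. y \<in> W \<Longrightarrow> \<zeta> y \<in> V"
      for D W k i and \<zeta> :: "(nat \<Rightarrow> real) \<Rightarrow> nat \<Rightarrow> complex"
    proof -
      have "Ck_on k D W (\<lambda>y. complex_of_real r * (to_link (\<zeta> y) i / to_link (\<zeta> y) n\<^sub>0))"
        using nz[OF V]
        by (intro Ck_on_mult[OF W] Ck_on_divide[OF W] Ck_on_const[OF W] Ck_on_to_link[OF W] \<zeta> V)
      then show ?thesis
        unfolding \<rho>_def by (cases "i < n\<^sub>0") (simp_all add: Ck_on_const[OF W] del: Ck_on.simps)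
    qed
  qed
  then show ?thesis unfolding E_def .
qed

lemma admits_LVM_structure_scaled_link:
  assumes adm: "admissible n p A" and p: "odd p" and r: "r > 0"
  shows "admits_LVM_structure (smooth_quotient n ((\<lambda>z i. of_real r * z i) ` link_set n p A) id (2 * n - p - 1))"
proof -
  define m where "m = (p + 1) div 2"
  have m: "2 * m = p + 1" using p by (simp add: m_def)
  have adm': "admissible (n + 1) (2 * m) (suspension n p A)"
    unfolding m by (rule admissible_suspension[OF adm])
  interpret lvm "n + 1" m "\<lambda>i. complexify (suspension n p A i)"
    by (rule admissible_imp_lvm(1)[OF adm'])
  have dim: "2 * (n + 1 - m - 1) = 2 * n - p - 1"
    using m by (simp add: right_diff_distrib')
  show ?thesis
    by (rule admits_LVM_structureI[OF adm'];
        rule diffeomorphic_scaled_link[OF _ refl m r, where A = A, unfolded dim]; simp)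
qed

lemma link_times_circle_set:
  "{z(n := u) |z u. z \<in> link_set n p A \<and> norm u = 1}
     = (\<lambda>z i. complex_of_real (sqrt 2) * z i) ` link_set (n + 1) (p + 1) (suspension n p A)"
proof -
  define s where "s = complex_of_real (sqrt 2)"
  have s: "s \<noteq> 0" "(norm (s * t))\<^sup>2 = 2 * (norm t)\<^sup>2" "(norm (t / s))\<^sup>2 = (norm t)\<^sup>2 / 2" for t
    by (auto simp: s_def norm_mult norm_divide power_mult_distrib power_divide)
  show ?thesis
    unfolding s_def[symmetric]
  proof (intro equalityI subsetI)
    fix x assume "x \<in> {z(n := u) |z u. z \<in> link_set n p A \<and> norm u = 1}"
    then obtain z u where x: "x = z(n := u)" and z: "z \<in> link_set n p A" and u: "norm u = 1" by blast
    define y where "y = (\<lambda>i. x i / s)"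
    have "(\<Sum>i<n. a i * (norm (y i))\<^sup>2) = (\<Sum>i<n. a i * (norm (z i))\<^sup>2) / 2" for a
      unfolding sum_divide_distrib by (intro sum.cong) (auto simp: y_def x s)
    note sums = this this[of "\<lambda>_. 1"]
    have "y \<in> link_set (n + 1) (p + 1) (suspension n p A)"
      unfolding link_set_suspension
    proof (intro conjI allI impI)
      show "y \<in> coord_space (n + 1)" using z by (simp add: y_def x link_set_def coord_space_def)
      show "(\<Sum>i<n. A i j * (norm (y i))\<^sup>2) = 0" if "j < p" for j
        unfolding sums(1) using z that by (simp add: link_set_def)
      show "(\<Sum>i<n. (norm (y i))\<^sup>2) = 1 / 2" using sums(2) z by (simp add: link_set_def)
      show "(norm (y n))\<^sup>2 = 1 / 2" using u by (simp add: y_def x s)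
    qed
    moreover have "x = (\<lambda>i. s * y i)" using s(1) by (simp add: y_def)
    ultimately show "x \<in> (\<lambda>z i. s * z i) ` link_set (n + 1) (p + 1) (suspension n p A)" by blast
  next
    fix x assume "x \<in> (\<lambda>z i. s * z i) ` link_set (n + 1) (p + 1) (suspension n p A)"
    then obtain y where x: "x = (\<lambda>i. s * y i)" and y: "y \<in> link_set (n + 1) (p + 1) (suspension n p A)" by blast
    define z where "z = x(n := 0)"
    have sums: "(\<Sum>i<n. a i * (norm (z i))\<^sup>2) = (\<Sum>i<n. a i * (norm (y i))\<^sup>2) * 2" for a
      unfolding sum_distrib_right by (intro sum.cong) (auto simp: z_def x s)
    have "y i = 0" if "i > n" for i
      using y that by (simp add: link_set_def coord_space_def)
    then have "z \<in> coord_space n" by (simp add: z_def x coord_space_def)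
    then have "z \<in> link_set n p A"
      using y sums sums[of "\<lambda>_. 1"] unfolding link_set_suspension by (simp add: link_set_def)
    moreover have "(norm (x n))\<^sup>2 = 1" using y unfolding link_set_suspension by (simp add: x s)
    then have "norm (x n) = 1" by (simp add: power2_eq_1_iff) (use norm_ge_zero[of "x n"] in linarith)
    moreover have "x = z(n := x n)" by (simp add: z_def)
    ultimately show "x \<in> {z(n := u) |z u. z \<in> link_set n p A \<and> norm u = 1}" by blast
  qed
qed

theorem theorem12p2:
  fixes A :: "nat \<Rightarrow> nat \<Rightarrow> real" and n p :: nat
  assumes "admissible n p A"
  shows "(odd p \<longrightarrow> admits_LVM_structure (link n p A)) \<and>
    (even p \<longrightarrow> admits_LVM_structure (proj_link n p A) \<and>
                admits_LVM_structure (link_times_circle n p A))"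
proof (intro conjI impI)
  assume p: "odd p"
  have "(\<lambda>z i. complex_of_real 1 * z i) ` link_set n p A = link_set n p A" by simp
  then show "admits_LVM_structure (link n p A)"
    unfolding link_def using admits_LVM_structure_scaled_link[OF assms p, of 1] by simp
next
  assume p: "even p"
  then have "odd (p + 1)" by simp
  from admits_LVM_structure_scaled_link[OF admissible_suspension[OF assms] this, of "sqrt 2"]
  show "admits_LVM_structure (link_times_circle n p A)"
    unfolding link_times_circle_def link_times_circle_set by simp
  obtain m where m: "p = 2 * m" using p by (elim evenE)
  interpret lvm n m "\<lambda>i. complexify (A i)"
    by (rule admissible_imp_lvm(1)[OF assms[unfolded m]])
  have dim: "2 * (n - m - 1) = 2 * n - p - 2" using m by (simp add: right_diff_distrib')
  show "admits_LVM_structure (proj_link n p A)"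
    unfolding proj_link_def dim[symmetric]
    by (rule admits_LVM_structureI[OF assms[unfolded m]];
        simp only: m; rule diffeomorphic_proj_link[unfolded realify_complexify]; simp)
qed

end
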